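(* Let $d\in\mathbb{N}$ and let $X$ be a Banach space of Fourier type $p_0\in(1,2]$. Let $1\le q\le\infty$ and $b<-1/q$. Then the Fourier transform $f\mapsto(\widehat f(n))_{n\in\mathbb{Z}^d}$ is bounded from $$L^{p_0,q}(\log L)^{b+1/\min\{p_0,q\}}(\mathbb{T}^d;X)\quad\text{into}\quad \ell^{p_0',q}(\log\ell)^{b+1/\max\{p_0',q\}}(\mathbb{Z}^d;X).$$
   Context: Banach spaces are nonzero and over $\mathbb{C}$; $1/p+1/p'=1$, $1/\infty=0$. $\mathbb{T}^d=[-\frac12,\frac12]^d$ and $\widehat f(n)=\int_{\mathbb{T}^d}f(x)e^{-2\pi i x\cdot n}\,dx$. $X$ has Fourier type $p_0$ if there is $C$ with $\|\widehat f\|_{L^{p_0'}(\mathbb{R}^d;X)}\le C\|f\|_{L^{p_0}(\mathbb{R}^d;X)}$ for all $f\in\mathcal{S}(\mathbb{R}^d;X)$, where $\widehat f(\xi)=\int_{\mathbb{R}^d}f(t)e^{-2\pi it\cdot\xi}dt$. For strongly measurable $f:\mathbb{T}^d\to X$ with $f^*$ the non-increasing rearrangement of $\|f(\cdot)\|_X$, $\|f\|_{L^{p,q}(\log L)^{c}(\mathbb{T}^d;X)}=\big(\int_0^1(t^{1/p}(1+|\log t|)^cf^*(t))^q\frac{dt}{t}\big)^{1/q}$; for a sequence $(x_n)_{n\in\mathbb{Z}^d}$ in $X$ with $(x_k^* )_{k\ge1}$ the non-increasing rearrangement of $(\|x_n\|_X)_n$, $\|(x_n)\|_{\ell^{p,q}(\log\ell)^c(\mathbb{Z}^d;X)}=\big(\sum_{k\ge1}(k^{1/p}(1+\log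 k)^cx_k^* )^q\frac1k\big)^{1/q}$ (suprema if $q=\infty$). *)

theory Defs
  imports "HOL-Analysis.Analysis"
begin

class complex_banach = banach +
  fixes scaleC :: "complex \<Rightarrow> 'a \<Rightarrow> 'a"  (infixr \<open>*\<^sub>C\<close> 75)
  assumes scaleC_add_right: "a *\<^sub>C (x + y) = a *\<^sub>C x + a *\<^sub>C y"
    and scaleC_add_left: "(a + b) *\<^sub>C x = a *\<^sub>C x + b *\<^sub>C x"
    and scaleC_scaleC: "a *\<^sub>C (b *\<^sub>C x) = (a * b) *\<^sub>C x"
    and scaleC_of_real: "complex_of_real r *\<^sub>C x = r *\<^sub>R x"
    and norm_scaleC: "norm (a *\<^sub>C x) = cmod a * norm x"

text \<open>
  The library's \<^const>\<open>has_bochner_integral\<close> requires a second countable target space, which would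
  exclude non-separable Banach spaces. The definitions below are the same ones with Borel
  measurability replaced by strong measurability. They are meant for complete measures, where
  almost everywhere limits of measurable real functions are measurable.
\<close>

definition strongly_measurable :: "'a measure \<Rightarrow> ('a \<Rightarrow> 'x::real_normed_vector) \<Rightarrow> bool" where
  "strongly_measurable M f \<longleftrightarrow>
     (\<exists>s. (\<forall>i::nat. simple_function M (s i)) \<and> (AE t in M. (\<lambda>i. s i t) \<longlonglongrightarrow> f t))"

definition has_Bochner_integral :: "'a measure \<Rightarrow> ('a \<Rightarrow> 'x::real_normed_vector) \<Rightarrow> 'x \<Rightarrow> bool" where
  "has_Bochner_integral M f I \<longleftrightarrow>
     strongly_measurable M f \<and>
     (\<exists>s. (\<forall>i::nat. Bochner_Integration.simple_bochner_integrable M (s i)) \<and>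
          (\<lambda>i. \<integral>\<^sup>+t. ennreal (norm (f t - s i t)) \<partial>M) \<longlonglongrightarrow> 0 \<and>
          (\<lambda>i. Bochner_Integration.simple_bochner_integral M (s i)) \<longlonglongrightarrow> I)"

definition Bochner_integrable :: "'a measure \<Rightarrow> ('a \<Rightarrow> 'x::real_normed_vector) \<Rightarrow> bool" where
  "Bochner_integrable M f \<longleftrightarrow> (\<exists>I. has_Bochner_integral M f I)"

definition Bochner_integral :: "'a measure \<Rightarrow> ('a \<Rightarrow> 'x::real_normed_vector) \<Rightarrow> 'x" where
  "Bochner_integral M f = (THE I. has_Bochner_integral M f I)"

definition torus :: "(real ^ 'd::finite) measure" where
  "torus = lebesgue_on (cbox (\<chi> i. - (1/2)) (\<chi> i. 1/2))"

text \<open>With \<open>M = lebesgue\<close> this is the Fourier transform on Euclidean space; with \<open>M = torus\<close> and \<open>\<xi>\<close>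
  an integer vector it gives the Fourier coefficients.\<close>

definition fourier :: "(real ^ 'd::finite) measure \<Rightarrow> (real ^ 'd \<Rightarrow> 'x::complex_banach) \<Rightarrow> real ^ 'd \<Rightarrow> 'x" where
  "fourier M f \<xi> = Bochner_integral M (\<lambda>t. cis (- 2 * pi * (t \<bullet> \<xi>)) *\<^sub>C f t)"

definition fourier_coeff :: "(real ^ 'd::finite \<Rightarrow> 'x::complex_banach) \<Rightarrow> int ^ 'd \<Rightarrow> 'x" where
  "fourier_coeff f n = fourier torus f (\<chi> i. real_of_int (n $ i))"

text \<open>A multi-index derivative is given by the list of coordinate directions to differentiate in.\<close>

fun partial_deriv :: "'d list \<Rightarrow> (real ^ 'd::finite \<Rightarrow> 'x::real_normed_vector) \<Rightarrow> real ^ 'd \<Rightarrow> 'x" where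
  "partial_deriv [] f = f"
| "partial_deriv (i # is) f = (\<lambda>t. frechet_derivative (partial_deriv is f) (at t) (axis i 1))"

text \<open>Differentiability of all iterated partial derivatives makes each of them continuous, so the
  first conjunct says that \<open>f\<close> is smooth.\<close>

definition schwartz :: "(real ^ 'd::finite \<Rightarrow> 'x::real_normed_vector) \<Rightarrow> bool" where
  "schwartz f \<longleftrightarrow>
     (\<forall>is t. partial_deriv is f differentiable (at t)) \<and>
     (\<forall>is (k::nat). \<exists>B. \<forall>t. norm t ^ k * norm (partial_deriv is f t) \<le> B)"

text \<open>Powers of extended nonnegative reals; only used with exponent \<open>a > 0\<close>.\<close>

definition epow :: "ennreal \<Rightarrow> real \<Rightarrow> ennreal" where
  "epow x a = (if x = \<infinity> then \<infinity> else ennreal (enn2real x powr a))"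

definition Lp_norm :: "real \<Rightarrow> (real ^ 'd::finite \<Rightarrow> 'x::real_normed_vector) \<Rightarrow> ennreal" where
  "Lp_norm p f = epow (\<integral>\<^sup>+t. ennreal (norm (f t) powr p) \<partial>lebesgue) (1/p)"

text \<open>Only for \<open>p > 1\<close>; the conjugate exponent \<open>\<infinity>\<close> of \<open>1\<close> is not represented.\<close>

definition conj_exponent :: "real \<Rightarrow> real" where
  "conj_exponent p = p / (p - 1)"

definition fourier_type :: "'d::finite itself \<Rightarrow> 'x::complex_banach itself \<Rightarrow> real \<Rightarrow> bool" where
  "fourier_type _ _ p \<longleftrightarrow>
     (\<exists>C::real. \<forall>f :: real ^ 'd \<Rightarrow> 'x. schwartz f \<longrightarrow>
        Lp_norm (conj_exponent p) (fourier lebesgue f) \<le> ennreal C * Lp_norm p f)"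

definition rearrangement :: "'a measure \<Rightarrow> ('a \<Rightarrow> 'x::real_normed_vector) \<Rightarrow> real \<Rightarrow> ennreal" where
  "rearrangement M f t =
     Inf {s. emeasure M {x \<in> space M. s < ennreal (norm (f x))} \<le> ennreal t}"

definition LZ_norm ::
    "real \<Rightarrow> ennreal \<Rightarrow> real \<Rightarrow> (real ^ 'd::finite \<Rightarrow> 'x::real_normed_vector) \<Rightarrow> ennreal" where
  "LZ_norm p q c f =
     (let g = (\<lambda>t. ennreal (t powr (1/p) * (1 + \<bar>ln t\<bar>) powr c) * rearrangement torus f t) in
      if q = \<infinity> then (SUP t\<in>{0<..<1}. g t)
      else epow (\<integral>\<^sup>+t\<in>{0<..<1}. epow (g t) (enn2real q) * ennreal (1/t) \<partial>lborel) (1 / enn2real q))"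

text \<open>The \<open>k\<close>-th term of the non-increasing rearrangement of a sequence is the rearrangement with
  respect to counting measure at \<open>k - 1\<close>. The summation index below is \<open>j = k - 1\<close>.\<close>

definition lz_seq_norm ::
    "real \<Rightarrow> ennreal \<Rightarrow> real \<Rightarrow> (int ^ 'd::finite \<Rightarrow> 'x::real_normed_vector) \<Rightarrow> ennreal" where
  "lz_seq_norm p q c x =
     (let g = (\<lambda>j::nat. ennreal (real (Suc j) powr (1/p) * (1 + ln (real (Suc j))) powr c)
                          * rearrangement (count_space UNIV) x (real j)) in
      if q = \<infinity> then (SUP j. g j)
      else epow (\<Sum>j. epow (g j) (enn2real q) * ennreal (1 / real (Suc j))) (1 / enn2real q))"

definition LZ_space ::
    "real \<Rightarrow> ennreal \<Rightarrow> real \<Rightarrow> (real ^ 'd::finite \<Rightarrow> 'x::real_normed_vector) set" where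
  "LZ_space p q c = {f. strongly_measurable torus f \<and> LZ_norm p q c f < \<infinity>}"

definition lz_seq_space ::
    "real \<Rightarrow> ennreal \<Rightarrow> real \<Rightarrow> (int ^ 'd::finite \<Rightarrow> 'x::real_normed_vector) set" where
  "lz_seq_space p q c = {x. lz_seq_norm p q c x < \<infinity>}"

end

theory Submission
  imports Defs "HOL-Real_Asymp.Real_Asymp"
begin

text \<open>
  Write \<open>p'\<close> for the exponent conjugate to \<open>p\<close>, \<open>c\<close> for the sequence of Fourier coefficients of \<open>f\<close>, and
  a star for non-increasing rearrangements. The theorem interpolates between two endpoint estimates:
  the coefficients are bounded by the \<open>L\<^sup>1\<close> norm of \<open>f\<close>, and the Fourier transform maps
  \<open>L\<^sup>p(T\<^sup>d; X)\<close> into \<open>\<ell>\<^sup>p'(Z\<^sup>d; X)\<close>. The logarithmic exponents appear because the interpolation takes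
  place at the very end of the scale, where the weights are powers of a logarithm.

  The second endpoint is not the hypothesis, which concerns Euclidean space, and is proved first.
  Let \<open>V\<close> be a small cube around the origin and let \<open>M\<close> be the Fourier transform of its indicator
  function. If \<open>f\<close> lives on the unit cube, then \<open>f = M \<cdot> (f / M)\<close> with \<open>M\<close> bounded away from \<open>0\<close> there,
  so that the coefficient of \<open>f\<close> at \<open>n\<close> is the integral over \<open>n + V\<close> of the Fourier transform of \<open>f / M\<close>.
  The cubes \<open>n + V\<close> are disjoint, hence Jensen's inequality bounds the \<open>\<ell>\<^sup>p'\<close> norm of the coefficients by
  the \<open>L\<^sup>p'\<close> norm of that Fourier transform (\<open>fourier_coeff_approx\<close>, \<open>fourier_coeff_Lp_bound\<close>).
  Fourier type is only given for Schwartz functions; sums of vectors times a polynomial times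
  \<open>exp (- \<Sum> (2 t\<^sub>i)\<^sup>2\<^sup>k)\<close> are Schwartz functions whose derivatives are again of this form, and they are
  dense because the exponential tends to the indicator function of the cube
  (\<open>polynomial_cutoff_dense\<close>, \<open>schwartz_polynomial_cutoff\<close>).

  For the interpolation, cut \<open>f\<close> at the height \<open>f\<^sup>*(2\<^sup>-\<^sup>j)\<close>. Applying the \<open>L\<^sup>1\<close> endpoint to the part above
  and the \<open>L\<^sup>p\<close> endpoint to the part below controls the \<open>\<ell>\<^sup>p'\<close> norm of the \<open>2\<^sup>j\<close> largest coefficients
  (\<open>fourier_coeff_dyadic_estimate\<close>). With \<open>A\<^sub>i\<close> of size \<open>2\<^sup>-\<^sup>i\<^sup>/\<^sup>p f\<^sup>*(2\<^sup>-\<^sup>i)\<close> and \<open>D\<^sub>i\<close> of size \<open>2\<^sup>i\<^sup>/\<^sup>p' c\<^sup>*(2\<^sup>i)\<close> it reads,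
  up to a constant factor,
  \<open>(\<Sum>\<^sub>i\<^sub>\<le>\<^sub>j D\<^sub>i\<^sup>p')\<^sup>1\<^sup>/\<^sup>p' \<le> \<Sum>\<^sub>i\<^sub>\<ge>\<^sub>j \<theta>\<^sup>i\<^sup>-\<^sup>j A\<^sub>i + (\<Sum>\<^sub>i\<^sub>\<le>\<^sub>j A\<^sub>i\<^sup>p)\<^sup>1\<^sup>/\<^sup>p\<close> with \<open>\<theta> < 1\<close>.
  The two Lorentz-Zygmund norms are comparable to \<open>\<ell>\<^sup>q\<close> norms of \<open>A\<close> and \<open>D\<close> with powers of \<open>1 + j\<close> as
  weights, so a statement about sequences remains (\<open>limiting_interpolation_sequences\<close>): take the
  \<open>\<ell>\<^sup>q\<close> norm of both sides with weight \<open>(1 + j)\<^sup>b\<close>. Since \<open>b < - 1/q\<close>, the sums of \<open>(1 + j)\<^sup>b\<^sup>q\<close> over tails gain one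
  power of \<open>1 + j\<close>. Comparing partial sums with their terms by summation by parts turns this gain into
  \<open>1 / max p' q\<close> on the left and costs \<open>1 / min p q\<close> on the right, while the geometric sum is harmless.
\<close>

section \<open>Strong measurability and Bochner integrals\<close>

lemma bounded_bilinear_scaleC: "bounded_bilinear (scaleC :: complex \<Rightarrow> 'x::complex_banach \<Rightarrow> 'x)"
proof
  fix a a' :: complex and x x' :: 'x and r :: real
  show "(a + a') *\<^sub>C x = a *\<^sub>C x + a' *\<^sub>C x" by (rule scaleC_add_left)
  show "a *\<^sub>C (x + x') = a *\<^sub>C x + a *\<^sub>C x'" by (rule scaleC_add_right)
  show "(r *\<^sub>R a) *\<^sub>C x = r *\<^sub>R (a *\<^sub>C x)"
    by (simp add: scaleC_of_real[symmetric] scaleC_scaleC scaleR_conv_of_real)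
  show "a *\<^sub>C (r *\<^sub>R x) = r *\<^sub>R (a *\<^sub>C x)"
    by (simp add: scaleC_of_real[symmetric] scaleC_scaleC mult.commute)
  show "\<exists>K. \<forall>a x. norm (a *\<^sub>C (x::'x)) \<le> norm a * norm x * K"
    by (intro exI[of _ 1]) (simp add: norm_scaleC)
qed

interpretation scaleC: bounded_bilinear "scaleC :: complex \<Rightarrow> 'x::complex_banach \<Rightarrow> 'x"
  by (rule bounded_bilinear_scaleC)

lemma complete_measure_lebesgue_on:
  assumes "S \<in> sets lebesgue"
  shows "complete_measure (lebesgue_on S)"
proof
  fix A B assume "B \<subseteq> A" "A \<in> null_sets (lebesgue_on S)"
  then show "B \<in> sets (lebesgue_on S)"
    using assms by (metis completion.complete2 null_setsD2 null_sets_restrict_space inf_absorb2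
        sets.sets_into_space sets_restrict_space_iff space_restrict_space null_sets_completion_iff
        subset_trans null_setsD1 space_lebesgue_on)
qed

text \<open>Completeness lets a function be changed on any subset of a null set without losing measurability.\<close>

lemma borel_measurable_AE_limit:
  fixes g :: "nat \<Rightarrow> 'a \<Rightarrow> real"
  assumes M: "complete_measure M" and g: "\<And>i. g i \<in> borel_measurable M"
    and lim: "AE t in M. (\<lambda>i. g i t) \<longlonglongrightarrow> h t"
  shows "h \<in> borel_measurable M"
proof -
  interpret complete_measure M by fact
  define h' where "h' = (\<lambda>t. lim (\<lambda>i. g i t))"
  have h': "h' \<in> borel_measurable M"
    unfolding h'_def using g by (intro borel_measurable_lim_metric) auto
  have eq: "AE t in M. h' t = h t"
    using lim by eventually_elim (simp add: h'_def limI)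
  show ?thesis
  proof (rule measurableI)
    fix A :: "real set" assume A: "A \<in> sets borel"
    have "h' -` A \<inter> space M \<in> sets M" using h' A by (rule measurable_sets)
    then show "h -` A \<inter> space M \<in> sets M"
      by (rule in_sets_AE[rotated]) (use eq in \<open>auto elim: eventually_mono\<close>)
  qed simp
qed

lemma strongly_measurable_compose:
  assumes "strongly_measurable M f" and "\<And>a s. s \<longlonglongrightarrow> a \<Longrightarrow> (\<lambda>i. h (s i)) \<longlonglongrightarrow> h a"
  shows "strongly_measurable M (\<lambda>t. h (f t))"
proof -
  obtain s where s: "\<And>i::nat. simple_function M (s i)" "AE t in M. (\<lambda>i. s i t) \<longlonglongrightarrow> f t"
    using assms(1) unfolding strongly_measurable_def by auto
  show ?thesis unfolding strongly_measurable_def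
    by (intro exI[of _ "\<lambda>i t. h (s i t)"] conjI allI simple_function_compose1[OF s(1)])
       (use s(2) assms(2) in \<open>auto elim: eventually_mono\<close>)
qed

lemma strongly_measurable_compose2:
  assumes "strongly_measurable M f" "strongly_measurable M g"
    and h: "\<And>a b s u. s \<longlonglongrightarrow> a \<Longrightarrow> u \<longlonglongrightarrow> b \<Longrightarrow> (\<lambda>i. h (s i) (u i)) \<longlonglongrightarrow> h a b"
  shows "strongly_measurable M (\<lambda>t. h (f t) (g t))"
proof -
  obtain s where s: "\<And>i::nat. simple_function M (s i)" "AE t in M. (\<lambda>i. s i t) \<longlonglongrightarrow> f t"
    using assms(1) unfolding strongly_measurable_def by auto
  obtain u where u: "\<And>i::nat. simple_function M (u i)" "AE t in M. (\<lambda>i. u i t) \<longlonglongrightarrow> g t"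
    using assms(2) unfolding strongly_measurable_def by auto
  have "AE t in M. (\<lambda>i. h (s i t) (u i t)) \<longlonglongrightarrow> h (f t) (g t)"
    using s(2) u(2) by eventually_elim (rule h)
  then show ?thesis unfolding strongly_measurable_def
    by (intro exI[of _ "\<lambda>i t. h (s i t) (u i t)"] conjI allI simple_function_compose2[OF s(1) u(1)])
qed

lemma strongly_measurable_simple: "simple_function M f \<Longrightarrow> strongly_measurable M f"
  unfolding strongly_measurable_def by (intro exI[of _ "\<lambda>_. f"]) auto

lemma strongly_measurable_borel:
  fixes f :: "'a \<Rightarrow> 'b::{real_normed_vector, second_countable_topology}"
  assumes "f \<in> borel_measurable M"
  shows "strongly_measurable M f"
proof -
  obtain F where "\<And>i. simple_function M (F i)" "\<And>x. x \<in> space M \<Longrightarrow> (\<lambda>i. F i x) \<longlonglongrightarrow> f x"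
    using borel_measurable_implies_sequence_metric[OF assms, of 0] by blast
  then show ?thesis unfolding strongly_measurable_def by (intro exI[of _ F]) auto
qed

lemma strongly_measurable_add:
  "strongly_measurable M f \<Longrightarrow> strongly_measurable M g \<Longrightarrow> strongly_measurable M (\<lambda>t. f t + g t)"
  by (rule strongly_measurable_compose2) (auto intro: tendsto_add)

lemma strongly_measurable_diff:
  "strongly_measurable M f \<Longrightarrow> strongly_measurable M g \<Longrightarrow> strongly_measurable M (\<lambda>t. f t - g t)"
  by (rule strongly_measurable_compose2) (auto intro: tendsto_diff)

lemma strongly_measurable_scaleC:
  fixes f :: "'a \<Rightarrow> 'x::complex_banach"
  assumes "g \<in> borel_measurable M" "strongly_measurable M f"
  shows "strongly_measurable M (\<lambda>t. g t *\<^sub>C f t)"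
  by (rule strongly_measurable_compose2[OF strongly_measurable_borel[OF assms(1)] assms(2)])
     (rule scaleC.tendsto)

lemma strongly_measurable_scaleR:
  fixes f :: "'a \<Rightarrow> 'x::real_normed_vector"
  assumes "g \<in> borel_measurable M" "strongly_measurable M f"
  shows "strongly_measurable M (\<lambda>t. g t *\<^sub>R f t)"
  by (rule strongly_measurable_compose2[OF strongly_measurable_borel[OF assms(1)] assms(2)])
     (rule tendsto_scaleR)

lemma strongly_measurable_norm:
  assumes "complete_measure M" "strongly_measurable M f"
  shows "(\<lambda>t. norm (f t)) \<in> borel_measurable M"
proof -
  obtain s where s: "\<And>i::nat. simple_function M (s i)" "AE t in M. (\<lambda>i. s i t) \<longlonglongrightarrow> f t"
    using assms(2) unfolding strongly_measurable_def by auto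
  show ?thesis
    by (rule borel_measurable_AE_limit[OF assms(1), of "\<lambda>i t. norm (s i t)"])
       (use s(2) in \<open>auto intro!: borel_measurable_simple_function simple_function_compose1[OF s(1)]
          elim!: eventually_mono intro: tendsto_norm\<close>)
qed

lemma strongly_measurable_norm_diff:
  assumes "complete_measure M" "strongly_measurable M f" "strongly_measurable M g"
  shows "(\<lambda>t. norm (f t - g t)) \<in> borel_measurable M"
  by (rule strongly_measurable_norm[OF assms(1) strongly_measurable_diff[OF assms(2,3)]])

text \<open>
  Approximating simple functions may be cut off where they exceed twice the norm of the limit, so that
  dominated convergence applies to them. The cut keeps the limit also where \<open>f\<close> vanishes,
  because the approximants are then replaced by \<open>0\<close>.
\<close>

lemma strongly_measurable_dominated_approx:
  assumes M: "complete_measure M" and f: "strongly_measurable M f"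
  obtains s where "\<And>i::nat. simple_function M (s i)" "AE t in M. (\<lambda>i. s i t) \<longlonglongrightarrow> f t"
    "\<And>i t. norm (s i t) \<le> 2 * norm (f t)"
proof -
  obtain s where s: "\<And>i::nat. simple_function M (s i)" "AE t in M. (\<lambda>i. s i t) \<longlonglongrightarrow> f t"
    using f unfolding strongly_measurable_def by auto
  define s' where "s' i t = (if norm (s i t) \<le> 2 * norm (f t) then s i t else 0)" for i t
  have "simple_function M (s' i)" for i
  proof -
    have [measurable]: "(\<lambda>t. norm (f t)) \<in> borel_measurable M"
      by (rule strongly_measurable_norm[OF M f])
    have [measurable]: "(\<lambda>t. norm (s i t)) \<in> borel_measurable M"
      by (intro borel_measurable_simple_function simple_function_compose1[OF s(1)])
    have "{t \<in> space M. norm (s i t) \<le> 2 * norm (f t)} \<in> sets M" by measurable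
    then show ?thesis unfolding s'_def by (intro simple_function_If s) auto
  qed
  moreover have "AE t in M. (\<lambda>i. s' i t) \<longlonglongrightarrow> f t"
    using s(2)
  proof eventually_elim
    case (elim t)
    show ?case
    proof (cases "f t = 0")
      case True
      then have "s' i t = 0" for i by (simp add: s'_def)
      then show ?thesis using True by simp
    next
      case False
      have "(\<lambda>i. norm (s i t)) \<longlonglongrightarrow> norm (f t)" by (intro tendsto_norm elim)
      then have "eventually (\<lambda>i. norm (s i t) < 2 * norm (f t)) sequentially"
        using False by (intro order_tendstoD) auto
      then have "eventually (\<lambda>i. s i t = s' i t) sequentially"
        by eventually_elim (simp add: s'_def)
      then show ?thesis using elim by (rule Lim_transform_eventually[rotated])
    qed
  qed
  moreover have "norm (s' i t) \<le> 2 * norm (f t)" for i t by (simp add: s'_def)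
  ultimately show ?thesis by (rule that)
qed

text \<open>
  The gauge \<open>\<Phi>\<close> is the identity when the Bochner integral is constructed and
  \<open>x + x powr p\<close> when approximation in \<open>L\<^sup>1\<close> and in
  \<open>L\<^sup>p\<close> is needed at the same time.
\<close>

lemma nn_integral_dominated_approx_0:
  assumes M: "complete_measure M" and f: "strongly_measurable M f"
    and s: "\<And>i::nat. simple_function M (s i)" "AE t in M. (\<lambda>i. s i t) \<longlonglongrightarrow> f t"
    "\<And>i t. norm (s i t) \<le> 2 * norm (f t)"
    and \<Phi>: "continuous_on {0..} \<Phi>" "\<Phi> 0 = 0" "mono_on {0..} \<Phi>"
    and fin: "(\<integral>\<^sup>+t. ennreal (\<Phi> (3 * norm (f t))) \<partial>M) < \<infinity>"
  shows "(\<lambda>i. \<integral>\<^sup>+t. ennreal (\<Phi> (norm (f t - s i t))) \<partial>M) \<longlonglongrightarrow> 0"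
proof -
  have \<Phi>m: "(\<lambda>t. \<Phi> (g t)) \<in> borel_measurable M" if g: "g \<in> borel_measurable M" "\<And>t. 0 \<le> g t" for g
  proof -
    have "(\<lambda>t. (\<lambda>x. if x \<in> {0..} then \<Phi> x else 0) (g t)) \<in> borel_measurable M"
      by (rule measurable_compose[OF g(1)])
         (rule borel_measurable_continuous_on_if[OF _ \<Phi>(1)], auto)
    then show ?thesis using g(2) by simp
  qed
  have nm: "(\<lambda>t. norm (f t - s i t)) \<in> borel_measurable M" for i
    by (intro strongly_measurable_norm_diff M f strongly_measurable_simple s)
  have "(\<lambda>i. \<integral>\<^sup>+t. ennreal (\<Phi> (norm (f t - s i t))) \<partial>M) \<longlonglongrightarrow> (\<integral>\<^sup>+t. 0 \<partial>M)"
  proof (rule nn_integral_dominated_convergence[where w = "\<lambda>t. ennreal (\<Phi> (3 * norm (f t)))"])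
    show "(\<lambda>t. ennreal (\<Phi> (norm (f t - s i t)))) \<in> borel_measurable M" for i
      using \<Phi>m[OF nm] by simp
    show "(\<lambda>t. ennreal (\<Phi> (3 * norm (f t)))) \<in> borel_measurable M"
      using strongly_measurable_norm[OF M f] by (intro measurable_compose[OF \<Phi>m measurable_ennreal]) auto
    show "AE t in M. ennreal (\<Phi> (norm (f t - s i t))) \<le> ennreal (\<Phi> (3 * norm (f t)))" for i
    proof (intro AE_I2 ennreal_leI mono_onD[OF \<Phi>(3)])
      fix t
      have "norm (f t - s i t) \<le> norm (f t) + norm (s i t)" by (rule norm_triangle_ineq4)
      then show "norm (f t - s i t) \<le> 3 * norm (f t)" using s(3)[of i t] by simp
    qed auto
    show "AE t in M. (\<lambda>i. ennreal (\<Phi> (norm (f t - s i t)))) \<longlonglongrightarrow> 0"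
      using s(2)
    proof eventually_elim
      case (elim t)
      have "(\<lambda>i. norm (f t - s i t)) \<longlonglongrightarrow> norm (f t - f t)"
        by (intro tendsto_intros elim)
      then have "(\<lambda>i. \<Phi> (norm (f t - s i t))) \<longlonglongrightarrow> \<Phi> 0"
        by (intro continuous_on_tendsto_compose[OF \<Phi>(1)]) auto
      then have "(\<lambda>i. ennreal (\<Phi> (norm (f t - s i t)))) \<longlonglongrightarrow> ennreal (\<Phi> 0)"
        by (rule tendsto_ennrealI)
      then show ?case using \<Phi>(2) by simp
    qed
  qed (use fin in auto)
  then show ?thesis by simp
qed

text \<open>
  This is what makes the integrals of approximating simple functions a Cauchy sequence and the Bochner
  integral unique. Measurability enters through norms of differences only, so that a non-separable space is
  covered.
\<close>

lemma simple_bochner_integral_norm_diff_le: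
  fixes f :: "'a \<Rightarrow> 'b::real_normed_vector"
  assumes M: "complete_measure M" and f: "strongly_measurable M f"
    and s: "Bochner_Integration.simple_bochner_integrable M s"
    and t: "Bochner_Integration.simple_bochner_integrable M t"
  shows "ennreal (norm (Bochner_Integration.simple_bochner_integral M s - Bochner_Integration.simple_bochner_integral M t)) \<le>
    (\<integral>\<^sup>+ x. norm (f x - s x) \<partial>M) + (\<integral>\<^sup>+ x. norm (f x - t x) \<partial>M)"
    (is "ennreal (norm (?s - ?t)) \<le> ?S + ?T")
proof -
  have sf: "simple_function M s" "simple_function M t"
    using s t by (auto elim: simple_bochner_integrable.cases)
  have [measurable]: "(\<lambda>x. norm (f x - s x)) \<in> borel_measurable M"
       "(\<lambda>x. norm (f x - t x)) \<in> borel_measurable M"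
    using sf by (auto intro!: strongly_measurable_norm_diff M f strongly_measurable_simple)
  have "ennreal (norm (?s - ?t)) = norm (Bochner_Integration.simple_bochner_integral M (\<lambda>x. s x - t x))"
    using s t by (subst simple_bochner_integral_diff) auto
  also have "\<dots> \<le> Bochner_Integration.simple_bochner_integral M (\<lambda>x. norm (s x - t x))"
    using simple_bochner_integrable_compose2[of "(-)" M "s" "t"] s t
    by (auto intro!: simple_bochner_integral_norm_bound)
  also have "\<dots> = (\<integral>\<^sup>+x. norm (s x - t x) \<partial>M)"
    using simple_bochner_integrable_compose2[of "\<lambda>x y. norm (x - y)" M "s" "t"] s t
    by (auto intro!: simple_bochner_integral_eq_nn_integral)
  also have "\<dots> \<le> (\<integral>\<^sup>+x. ennreal (norm (f x - s x)) + ennreal (norm (f x - t x)) \<partial>M)"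
    by (intro nn_integral_mono)
       (metis dual_order.refl norm_diff_triangle_le norm_minus_commute ennreal_leI ennreal_plus norm_ge_zero)
  also have "\<dots> = ?S + ?T"
    by (rule nn_integral_add) auto
  finally show ?thesis .
qed

lemma has_Bochner_integral_unique:
  fixes f :: "'a \<Rightarrow> 'b::real_normed_vector"
  assumes M: "complete_measure M" and "has_Bochner_integral M f I" "has_Bochner_integral M f J"
  shows "I = J"
proof -
  let ?S = "Bochner_Integration.simple_bochner_integral M"
  have f: "strongly_measurable M f" using assms(2) by (simp add: has_Bochner_integral_def)
  obtain s where s: "\<And>i::nat. Bochner_Integration.simple_bochner_integrable M (s i)"
    "(\<lambda>i. \<integral>\<^sup>+t. ennreal (norm (f t - s i t)) \<partial>M) \<longlonglongrightarrow> 0" "(\<lambda>i. ?S (s i)) \<longlonglongrightarrow> I"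
    using assms(2) by (auto simp: has_Bochner_integral_def)
  obtain u where u: "\<And>i::nat. Bochner_Integration.simple_bochner_integrable M (u i)"
    "(\<lambda>i. \<integral>\<^sup>+t. ennreal (norm (f t - u i t)) \<partial>M) \<longlonglongrightarrow> 0" "(\<lambda>i. ?S (u i)) \<longlonglongrightarrow> J"
    using assms(3) by (auto simp: has_Bochner_integral_def)
  have "(\<lambda>i. ennreal (norm (?S (s i) - ?S (u i)))) \<longlonglongrightarrow> ennreal (norm (I - J))"
    by (intro tendsto_intros s u tendsto_ennrealI)
  moreover have "(\<lambda>i. (\<integral>\<^sup>+t. ennreal (norm (f t - s i t)) \<partial>M) + (\<integral>\<^sup>+t. ennreal (norm (f t - u i t)) \<partial>M)) \<longlonglongrightarrow> 0 + 0"
    by (intro tendsto_add s u)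
  ultimately have "ennreal (norm (I - J)) \<le> 0 + 0"
    by (rule LIMSEQ_le) (use simple_bochner_integral_norm_diff_le[OF M f s(1) u(1)] in auto)
  then show ?thesis by simp
qed

lemma Bochner_integral_eq:
  assumes "complete_measure M" "has_Bochner_integral M f I"
  shows "Bochner_integral M f = I"
  unfolding Bochner_integral_def using assms by (blast intro: has_Bochner_integral_unique)

lemma has_Bochner_integral_norm_le:
  fixes f :: "'a \<Rightarrow> 'b::real_normed_vector"
  assumes M: "complete_measure M" and "has_Bochner_integral M f I"
  shows "ennreal (norm I) \<le> (\<integral>\<^sup>+t. ennreal (norm (f t)) \<partial>M)"
proof -
  let ?S = "Bochner_Integration.simple_bochner_integral M"
  have f: "strongly_measurable M f" using assms(2) by (simp add: has_Bochner_integral_def)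
  obtain s where s: "\<And>i::nat. Bochner_Integration.simple_bochner_integrable M (s i)"
    "(\<lambda>i. \<integral>\<^sup>+t. ennreal (norm (f t - s i t)) \<partial>M) \<longlonglongrightarrow> 0" "(\<lambda>i. ?S (s i)) \<longlonglongrightarrow> I"
    using assms(2) by (auto simp: has_Bochner_integral_def)
  have z: "Bochner_Integration.simple_bochner_integrable M (\<lambda>_. 0)" "?S (\<lambda>_. 0) = 0"
    by (simp add: simple_bochner_integrable.simps) (simp add: simple_bochner_integral_def image_constant_conv)
  have "(\<lambda>i. ennreal (norm (?S (s i)))) \<longlonglongrightarrow> ennreal (norm I)"
    by (intro tendsto_intros s tendsto_ennrealI)
  moreover have "(\<lambda>i. (\<integral>\<^sup>+t. ennreal (norm (f t - s i t)) \<partial>M) + (\<integral>\<^sup>+t. ennreal (norm (f t)) \<partial>M))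
      \<longlonglongrightarrow> 0 + (\<integral>\<^sup>+t. ennreal (norm (f t)) \<partial>M)"
    by (intro tendsto_add s tendsto_const)
  ultimately have "ennreal (norm I) \<le> 0 + (\<integral>\<^sup>+t. ennreal (norm (f t)) \<partial>M)"
    by (rule LIMSEQ_le)
       (use simple_bochner_integral_norm_diff_le[OF M f s(1) z(1)] in \<open>auto simp: z(2)\<close>)
  then show ?thesis by simp
qed

lemma has_Bochner_integral_add:
  fixes f :: "'a \<Rightarrow> 'b::real_normed_vector"
  assumes M: "complete_measure M" and "has_Bochner_integral M f I" "has_Bochner_integral M g J"
  shows "has_Bochner_integral M (\<lambda>t. f t + g t) (I + J)"
proof -
  let ?S = "Bochner_Integration.simple_bochner_integral M"
  have f: "strongly_measurable M f" "strongly_measurable M g"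
    using assms(2,3) by (auto simp: has_Bochner_integral_def)
  obtain s where s: "\<And>i::nat. Bochner_Integration.simple_bochner_integrable M (s i)"
    "(\<lambda>i. \<integral>\<^sup>+t. ennreal (norm (f t - s i t)) \<partial>M) \<longlonglongrightarrow> 0" "(\<lambda>i. ?S (s i)) \<longlonglongrightarrow> I"
    using assms(2) by (auto simp: has_Bochner_integral_def)
  obtain u where u: "\<And>i::nat. Bochner_Integration.simple_bochner_integrable M (u i)"
    "(\<lambda>i. \<integral>\<^sup>+t. ennreal (norm (g t - u i t)) \<partial>M) \<longlonglongrightarrow> 0" "(\<lambda>i. ?S (u i)) \<longlonglongrightarrow> J"
    using assms(3) by (auto simp: has_Bochner_integral_def)
  have sf: "simple_function M (s i)" "simple_function M (u i)" for i
    using s(1)[of i] u(1)[of i] by (auto elim: simple_bochner_integrable.cases)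
  have le: "(\<integral>\<^sup>+t. ennreal (norm ((f t + g t) - (s i t + u i t))) \<partial>M)
      \<le> (\<integral>\<^sup>+t. ennreal (norm (f t - s i t)) \<partial>M) + (\<integral>\<^sup>+t. ennreal (norm (g t - u i t)) \<partial>M)" for i
  proof -
    have [measurable]: "(\<lambda>x. norm (f x - s i x)) \<in> borel_measurable M"
         "(\<lambda>x. norm (g x - u i x)) \<in> borel_measurable M"
      using sf by (auto intro!: strongly_measurable_norm_diff M f strongly_measurable_simple)
    have "(\<integral>\<^sup>+t. ennreal (norm ((f t + g t) - (s i t + u i t))) \<partial>M)
        \<le> (\<integral>\<^sup>+t. ennreal (norm (f t - s i t)) + ennreal (norm (g t - u i t)) \<partial>M)"
    proof (intro nn_integral_mono)
      fix t
      have "norm ((f t + g t) - (s i t + u i t)) \<le> norm (f t - s i t) + norm (g t - u i t)"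
        by (rule norm_diff_triangle_ineq)
      then show "ennreal (norm ((f t + g t) - (s i t + u i t)))
          \<le> ennreal (norm (f t - s i t)) + ennreal (norm (g t - u i t))"
        by (simp flip: ennreal_plus)
    qed
    also have "\<dots> = (\<integral>\<^sup>+t. ennreal (norm (f t - s i t)) \<partial>M) + (\<integral>\<^sup>+t. ennreal (norm (g t - u i t)) \<partial>M)"
      by (rule nn_integral_add) auto
    finally show ?thesis .
  qed
  have sum0: "(\<lambda>i. (\<integral>\<^sup>+t. ennreal (norm (f t - s i t)) \<partial>M) + (\<integral>\<^sup>+t. ennreal (norm (g t - u i t)) \<partial>M)) \<longlonglongrightarrow> 0"
    using tendsto_add[OF s(2) u(2)] by (simp only: add_0_left)
  have "(\<lambda>i. \<integral>\<^sup>+t. ennreal (norm ((f t + g t) - (s i t + u i t))) \<partial>M) \<longlonglongrightarrow> 0"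
    by (rule tendsto_sandwich[OF _ _ tendsto_const sum0]) (intro always_eventually allI zero_le le)+
  moreover have "(\<lambda>i. ?S (\<lambda>t. s i t + u i t)) \<longlonglongrightarrow> I + J"
    using tendsto_add[OF s(3) u(3)] by (simp only: simple_bochner_integral_add[OF s(1) u(1)])
  moreover have "Bochner_Integration.simple_bochner_integrable M (\<lambda>t. s i t + u i t)" for i
    by (rule simple_bochner_integrable_compose2[OF _ s(1) u(1)]) simp
  ultimately show ?thesis
    unfolding has_Bochner_integral_def using strongly_measurable_add[OF f]
    by (intro conjI exI[of _ "\<lambda>i t. s i t + u i t"] allI)
qed

text \<open>
  Completeness of the space is used once, for the limit of the integrals of the approximating simple
  functions.
\<close>

lemma Bochner_integrableI:
  fixes f :: "'a \<Rightarrow> 'b::banach"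
  assumes M: "complete_measure M" and f: "strongly_measurable M f"
    and fin: "(\<integral>\<^sup>+t. ennreal (norm (f t)) \<partial>M) < \<infinity>"
  shows "Bochner_integrable M f"
proof -
  let ?S = "Bochner_Integration.simple_bochner_integral M"
  have nf: "(\<lambda>t. norm (f t)) \<in> borel_measurable M" by (rule strongly_measurable_norm[OF M f])
  obtain s where s: "\<And>i::nat. simple_function M (s i)" "AE t in M. (\<lambda>i. s i t) \<longlonglongrightarrow> f t"
    "\<And>i t. norm (s i t) \<le> 2 * norm (f t)"
    using strongly_measurable_dominated_approx[OF M f] by blast
  have fin3: "(\<integral>\<^sup>+t. ennreal (c * norm (f t)) \<partial>M) < \<infinity>" if "c \<ge> 0" for c
    using nf fin that by (simp add: ennreal_mult nn_integral_cmult ennreal_mult_less_top)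
  have lim: "(\<lambda>i. \<integral>\<^sup>+t. ennreal (norm (f t - s i t)) \<partial>M) \<longlonglongrightarrow> 0"
    by (rule nn_integral_dominated_approx_0[OF M f s, of "\<lambda>x. x"])
       (use fin3[of 3] in \<open>auto simp: mono_on_def intro: continuous_on_id\<close>)
  have si: "Bochner_Integration.simple_bochner_integrable M (s i)" for i
  proof (rule simple_bochner_integrableI_bounded[OF s(1)])
    have "(\<integral>\<^sup>+t. ennreal (norm (s i t)) \<partial>M) \<le> (\<integral>\<^sup>+t. ennreal (2 * norm (f t)) \<partial>M)"
      by (intro nn_integral_mono ennreal_leI s)
    then show "(\<integral>\<^sup>+t. ennreal (norm (s i t)) \<partial>M) < \<infinity>" using fin3[of 2] by (rule le_less_trans) auto
  qed
  have "Cauchy (\<lambda>i. ?S (s i))"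
  proof (rule metric_CauchyI)
    fix e :: real assume e: "0 < e"
    have "eventually (\<lambda>i. (\<integral>\<^sup>+t. ennreal (norm (f t - s i t)) \<partial>M) < ennreal (e/2)) sequentially"
      using lim e by (intro order_tendstoD) auto
    then obtain N where N: "\<And>i. i \<ge> N \<Longrightarrow> (\<integral>\<^sup>+t. ennreal (norm (f t - s i t)) \<partial>M) < ennreal (e/2)"
      by (auto simp: eventually_sequentially)
    show "\<exists>N. \<forall>m\<ge>N. \<forall>n\<ge>N. dist (?S (s m)) (?S (s n)) < e"
    proof (intro exI[of _ N] allI impI)
      fix m n assume "N \<le> m" "N \<le> n"
      then have "ennreal (norm (?S (s m) - ?S (s n))) < ennreal (e/2) + ennreal (e/2)"
        using simple_bochner_integral_norm_diff_le[OF M f si[of m] si[of n]] N[of m] N[of n]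
        by (meson add_strict_mono le_less_trans)
      also have "\<dots> = ennreal e" using e by (simp flip: ennreal_plus)
      finally show "dist (?S (s m)) (?S (s n)) < e" by (simp add: dist_norm ennreal_less_iff)
    qed
  qed
  then obtain I where "(\<lambda>i. ?S (s i)) \<longlonglongrightarrow> I"
    by (auto simp: Cauchy_convergent_iff convergent_def)
  then show ?thesis
    unfolding Bochner_integrable_def has_Bochner_integral_def using f si lim by blast
qed

lemma has_Bochner_integral_Bochner_integral:
  "complete_measure M \<Longrightarrow> Bochner_integrable M f \<Longrightarrow> has_Bochner_integral M f (Bochner_integral M f)"
  unfolding Bochner_integrable_def using Bochner_integral_eq by metis

text \<open>
  Integrals of functions with values in a line reduce to scalar integrals, to which
  Fubini's theorem and dominated convergence apply.
\<close>

lemma has_Bochner_integral_scaleC_left: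
  fixes g :: "'a \<Rightarrow> complex" and x :: "'x::complex_banach"
  assumes "integrable M g"
  shows "has_Bochner_integral M (\<lambda>t. g t *\<^sub>C x) ((\<integral>t. g t \<partial>M) *\<^sub>C x)"
proof -
  let ?S = "\<lambda>f. Bochner_Integration.simple_bochner_integral M f"
  have "has_bochner_integral M g (\<integral>t. g t \<partial>M)" using assms by (rule has_bochner_integral_integrable)
  then obtain s where s: "\<And>i::nat. Bochner_Integration.simple_bochner_integrable M (s i)"
    "(\<lambda>i. \<integral>\<^sup>+t. ennreal (norm (g t - s i t)) \<partial>M) \<longlonglongrightarrow> 0" "(\<lambda>i. ?S (s i)) \<longlonglongrightarrow> (\<integral>t. g t \<partial>M)"
    unfolding has_bochner_integral.simps by blast
  have bl: "bounded_linear (\<lambda>a. a *\<^sub>C x)" by (rule scaleC.bounded_linear_left)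
  have g: "g \<in> borel_measurable M" using assms by auto
  have sm: "strongly_measurable M (\<lambda>t. g t *\<^sub>C x)"
    by (rule strongly_measurable_compose[OF strongly_measurable_borel[OF g]])
       (rule bounded_linear.tendsto[OF bl])
  have si: "Bochner_Integration.simple_bochner_integrable M (\<lambda>t. s i t *\<^sub>C x)" for i
    by (rule simple_bochner_integrable_compose2[of "\<lambda>a b. a *\<^sub>C x", OF _ s(1) s(1)]) (rule scaleC.zero_left)
  have "(\<lambda>i. \<integral>\<^sup>+t. ennreal (norm (g t *\<^sub>C x - s i t *\<^sub>C x)) \<partial>M) =
      (\<lambda>i. ennreal (norm x) * (\<integral>\<^sup>+t. ennreal (norm (g t - s i t)) \<partial>M))"
  proof
    fix i
    have "s i \<in> borel_measurable M"
      using s(1)[of i] by (auto elim!: simple_bochner_integrable.cases intro: borel_measurable_simple_function)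
    with g show "(\<integral>\<^sup>+t. ennreal (norm (g t *\<^sub>C x - s i t *\<^sub>C x)) \<partial>M) =
      ennreal (norm x) * (\<integral>\<^sup>+t. ennreal (norm (g t - s i t)) \<partial>M)"
      by (subst nn_integral_cmult[symmetric])
         (auto simp: scaleC.diff_left[symmetric] norm_scaleC ennreal_mult[symmetric] mult.commute)
  qed
  moreover have "(\<lambda>i. ennreal (norm x) * (\<integral>\<^sup>+t. ennreal (norm (g t - s i t)) \<partial>M)) \<longlonglongrightarrow> ennreal (norm x) * 0"
    by (intro tendsto_intros s) auto
  moreover have "(\<lambda>i. ?S (\<lambda>t. s i t *\<^sub>C x)) = (\<lambda>i. ?S (s i) *\<^sub>C x)"
    using simple_bochner_integral_linear[OF bounded_linear.linear[OF bl] s(1)] by simp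
  moreover have "(\<lambda>i. ?S (s i) *\<^sub>C x) \<longlonglongrightarrow> (\<integral>t. g t \<partial>M) *\<^sub>C x"
    by (rule bounded_linear.tendsto[OF bl s(3)])
  ultimately show ?thesis
    unfolding has_Bochner_integral_def using sm si
    by (intro conjI exI[of _ "\<lambda>i t. s i t *\<^sub>C x"]) auto
qed

lemma has_Bochner_integral_sum:
  fixes f :: "'i \<Rightarrow> 'a \<Rightarrow> 'b::real_normed_vector"
  assumes M: "complete_measure M" and "finite J"
    and "\<And>j. j \<in> J \<Longrightarrow> has_Bochner_integral M (f j) (I j)"
  shows "has_Bochner_integral M (\<lambda>t. \<Sum>j\<in>J. f j t) (\<Sum>j\<in>J. I j)"
  using assms(2,3)
proof (induction J rule: finite_induct)
  case empty
  have z: "Bochner_Integration.simple_bochner_integrable M (\<lambda>_. 0::'b)"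
    "Bochner_Integration.simple_bochner_integral M (\<lambda>_. 0::'b) = 0"
    by (simp add: simple_bochner_integrable.simps) (simp add: simple_bochner_integral_def image_constant_conv)
  have "strongly_measurable M (\<lambda>_. 0::'b)" by (rule strongly_measurable_simple) simp
  then have "has_Bochner_integral M (\<lambda>t. 0::'b) 0"
    unfolding has_Bochner_integral_def
    by (intro conjI exI[of _ "\<lambda>_ _. 0::'b"]) (simp_all add: z)
  then show ?case by simp
next
  case (insert j J)
  then show ?case by (simp add: has_Bochner_integral_add[OF M])
qed

section \<open>Weighted inequalities for sequences\<close>

lemma powr_add_le:
  fixes x y r :: real
  assumes "0 \<le> x" "0 \<le> y" "1 \<le> r"
  shows "(x + y) powr r \<le> 2 powr r * (x powr r + y powr r)"
proof -
  have "(x + y) powr r \<le> (2 * max x y) powr r" using assms by (intro powr_mono2) auto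
  also have "\<dots> = 2 powr r * max x y powr r" using assms by (simp add: powr_mult)
  also have "\<dots> \<le> 2 powr r * (x powr r + y powr r)"
    by (intro mult_left_mono) (auto simp: max_def)
  finally show ?thesis .
qed

text \<open>
  The middle term is the increment bound \<open>S\<^sub>j\<^sup>r - S\<^sub>j\<^sub>-\<^sub>1\<^sup>r
  \<ge> D\<^sub>j S\<^sub>j\<^sup>r\<^sup>-\<^sup>1\<close> for partial sums \<open>S\<close> with
  terms \<open>D\<close> and exponents \<open>r \<ge> 1\<close>.
\<close>

lemma powr_superadditive:
  fixes x y r :: real
  assumes "0 \<le> x" "0 \<le> y" "1 \<le> r"
  shows "x powr r + y * (x + y) powr (r - 1) \<le> (x + y) powr r"
proof (cases "x + y = 0")
  case False
  then have pos: "x + y > 0" using assms by linarith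
  have "x powr r = x * x powr (r - 1)"
    using assms by (cases "x = 0") (auto simp: powr_diff)
  also have "\<dots> \<le> x * (x + y) powr (r - 1)"
    using assms by (intro mult_left_mono powr_mono2) auto
  finally have "x powr r + y * (x + y) powr (r - 1) \<le> (x + y) * (x + y) powr (r - 1)"
    by (simp add: algebra_simps)
  also have "\<dots> = (x + y) powr r" using pos by (simp add: powr_diff)
  finally show ?thesis .
qed (use assms in auto)

text \<open>
  The graph of a convex power lies above its tangents. Together with the concave counterpart below,
  this replaces Jensen's inequality and bounds increments of powers of partial sums.
\<close>

lemma powr_tangent:
  fixes x y r :: real
  assumes "0 \<le> x" "0 < y" "1 \<le> r"
  shows "y powr r + r * y powr (r - 1) * (x - y) \<le> x powr r"
proof (cases "r = 1")
  case False
  then have r: "r > 1" using assms by simp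
  have "x * y powr (r - 1) \<le> x powr r / r + (y powr (r - 1)) powr (r / (r - 1)) / (r / (r - 1))"
    using r assms by (intro Youngs_inequality) (auto simp: field_simps)
  also have "(y powr (r - 1)) powr (r / (r - 1)) = y powr r" using r by (simp add: powr_powr)
  finally have "r * (x * y powr (r - 1)) \<le> r * (x powr r / r + y powr r / (r / (r - 1)))"
    using r by (intro mult_left_mono) auto
  also have "\<dots> = x powr r + (r - 1) * y powr r" using r by (simp add: field_simps)
  finally have "r * (x * y powr (r - 1)) \<le> x powr r + (r - 1) * y powr r" .
  moreover have "y * y powr (r - 1) = y powr r" using assms by (simp add: powr_diff)
  ultimately show ?thesis by (simp add: algebra_simps)
qed (use assms in auto)

lemma powr_tangent_concave:
  fixes x y r :: real
  assumes "0 \<le> x" "0 < y" "0 < r" "r \<le> 1"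
  shows "x powr r \<le> y powr r + r * y powr (r - 1) * (x - y)"
proof -
  have y: "y * y powr (r - 1) = y powr r" using assms by (simp add: powr_diff)
  have "x powr r * y powr (1 - r) \<le> r * x + (1 - r) * y"
    using assms by (cases "x = 0") (auto intro: Youngs_inequality_0)
  then have "x powr r * y powr (1 - r) * y powr (r - 1) \<le> (r * x + (1 - r) * y) * y powr (r - 1)"
    by (intro mult_right_mono) auto
  moreover have "y powr (1 - r) * y powr (r - 1) = 1"
    using assms by (simp flip: powr_add)
  ultimately have "x powr r \<le> r * x * y powr (r - 1) + (1 - r) * (y * y powr (r - 1))"
    by (simp add: algebra_simps)
  then show ?thesis unfolding y using y by (simp add: algebra_simps)
qed

lemma powr_subadditive:
  fixes x y r :: real
  assumes "0 \<le> x" "0 \<le> y" "0 < r" "r \<le> 1"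
  shows "(x + y) powr r \<le> x powr r + y powr r"
proof -
  have *: "u * (x + y) powr (r - 1) \<le> u powr r" if "0 \<le> u" "u \<le> x + y" for u
  proof (cases "u = 0")
    case False
    then have "u * (x + y) powr (r - 1) \<le> u * u powr (r - 1)"
      using that assms by (intro mult_left_mono powr_mono2') auto
    also have "\<dots> = u powr r" using False that by (simp add: powr_diff)
    finally show ?thesis .
  qed simp
  have "(x + y) powr r = (x + y) * (x + y) powr (r - 1)"
    using assms by (cases "x + y = 0") (auto simp: powr_diff)
  also have "\<dots> = x * (x + y) powr (r - 1) + y * (x + y) powr (r - 1)"
    by (rule distrib_right)
  also have "\<dots> \<le> x powr r + y powr r" using assms by (intro add_mono *) auto
  finally show ?thesis .
qed

lemma powr_sum_subadditive:
  fixes u :: "'i \<Rightarrow> real"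
  assumes "finite I" "\<And>i. i \<in> I \<Longrightarrow> 0 \<le> u i" "0 < r" "r \<le> 1"
  shows "(\<Sum>i\<in>I. u i) powr r \<le> (\<Sum>i\<in>I. u i powr r)"
  using assms(1,2)
proof (induction I rule: finite_induct)
  case (insert i I)
  have "(u i + sum u I) powr r \<le> u i powr r + sum u I powr r"
    using insert.prems assms(3,4) by (intro powr_subadditive) (auto intro: sum_nonneg)
  then show ?case using insert by fastforce
qed simp

text \<open>
  Jensen's inequality for a finite measure with weights \<open>c\<close>: take the tangent at the
  weighted mean and sum.
\<close>

lemma weighted_powr_sum_le:
  fixes c x :: "'i \<Rightarrow> real"
  assumes "finite I" "\<And>i. i \<in> I \<Longrightarrow> 0 \<le> c i" "\<And>i. i \<in> I \<Longrightarrow> 0 \<le> x i" "1 \<le> q"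
  shows "(\<Sum>i\<in>I. c i * x i) powr q \<le> (\<Sum>i\<in>I. c i) powr (q - 1) * (\<Sum>i\<in>I. c i * x i powr q)"
proof (cases "(\<Sum>i\<in>I. c i * x i) = 0")
  case True
  then show ?thesis using assms by (auto intro!: mult_nonneg_nonneg sum_nonneg)
next
  case False
  define X where "X = (\<Sum>i\<in>I. c i * x i)"
  define c0 where "c0 = sum c I"
  have X: "X > 0" using False assms unfolding X_def by (simp add: less_le sum_nonneg)
  have c0: "c0 > 0"
  proof (rule ccontr)
    assume "\<not> c0 > 0"
    moreover have "c0 \<ge> 0" unfolding c0_def using assms(2) by (rule sum_nonneg)
    ultimately have "c0 = 0" by simp
    then have "\<forall>i\<in>I. c i = 0" using assms(1,2) unfolding c0_def by (subst (asm) sum_nonneg_eq_0_iff) auto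
    then show False using False by simp
  qed
  define y where "y = X / c0"
  have y: "y > 0" using X c0 by (simp add: y_def)
  have "c0 * y powr q = c0 * y powr q + q * y powr (q - 1) * (X - c0 * y)"
    using c0 by (simp add: y_def)
  also have "\<dots> = (\<Sum>i\<in>I. c i * (y powr q + q * y powr (q - 1) * (x i - y)))"
    unfolding X_def c0_def by (simp add: algebra_simps sum.distrib sum_subtractf sum_distrib_left sum_distrib_right)
  also have "\<dots> \<le> (\<Sum>i\<in>I. c i * x i powr q)"
    using assms y by (intro sum_mono mult_left_mono powr_tangent) auto
  finally have "c0 * y powr q \<le> (\<Sum>i\<in>I. c i * x i powr q)" .
  then have "c0 powr (q - 1) * (c0 * y powr q) \<le> c0 powr (q - 1) * (\<Sum>i\<in>I. c i * x i powr q)"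
    by (intro mult_left_mono) auto
  moreover have "c0 powr (q - 1) * (c0 * y powr q) = X powr q"
    using c0 X by (simp add: y_def powr_divide powr_diff)
  ultimately show ?thesis by (simp add: X_def c0_def)
qed

text \<open>
  Both bounds come from the mean value theorem; the factor \<open>2 powr (\<beta> - 1)\<close> is the
  price for replacing \<open>j + 2\<close> by \<open>j + 1\<close>.
\<close>

lemma powr_decrement_bounds:
  fixes \<beta> :: real and j :: nat
  assumes "\<beta> < 0"
  shows "real (Suc j) powr \<beta> - real (Suc (Suc j)) powr \<beta> \<le> - \<beta> * real (Suc j) powr (\<beta> - 1)"
    and "- \<beta> * 2 powr (\<beta> - 1) * real (Suc j) powr (\<beta> - 1) \<le> real (Suc j) powr \<beta> - real (Suc (Suc j)) powr \<beta>"
proof -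
  have "\<exists>z. real (Suc j) < z \<and> z < real (Suc (Suc j)) \<and>
     real (Suc (Suc j)) powr \<beta> - real (Suc j) powr \<beta> = (real (Suc (Suc j)) - real (Suc j)) * (\<beta> * z powr (\<beta> - 1))"
    by (rule MVT2) (auto intro!: derivative_eq_intros)
  then obtain z where z: "real (Suc j) < z" "z < real (Suc (Suc j))"
     "real (Suc j) powr \<beta> - real (Suc (Suc j)) powr \<beta> = - \<beta> * z powr (\<beta> - 1)" by auto
  have "z powr (\<beta> - 1) \<le> real (Suc j) powr (\<beta> - 1)" using z assms by (intro powr_mono2') auto
  then show "real (Suc j) powr \<beta> - real (Suc (Suc j)) powr \<beta> \<le> - \<beta> * real (Suc j) powr (\<beta> - 1)"
    using z(3) assms by (simp add: mult_left_mono_neg)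
  have "(2 * real (Suc j)) powr (\<beta> - 1) \<le> z powr (\<beta> - 1)" using z assms by (intro powr_mono2') auto
  then have "2 powr (\<beta> - 1) * real (Suc j) powr (\<beta> - 1) \<le> z powr (\<beta> - 1)"
    by (subst (asm) powr_mult) auto
  then show "- \<beta> * 2 powr (\<beta> - 1) * real (Suc j) powr (\<beta> - 1) \<le> real (Suc j) powr \<beta> - real (Suc (Suc j)) powr \<beta>"
    using z(3) assms by (simp add: mult_left_mono_neg mult.assoc)
qed

text \<open>
  The terms are dominated by the telescoping decrements of \<open>(1 + j) powr (a + 1)\<close>. This
  gain of one power is where \<open>b < - 1/q\<close> enters.
\<close>

lemma powr_tail_sum_le:
  fixes a :: real
  assumes "a < -1"
  obtains K where "K \<ge> 0" "\<And>i J. (\<Sum>j=i..J. real (Suc j) powr a) \<le> K * real (Suc i) powr (a + 1)"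
proof -
  define \<beta> where "\<beta> = a + 1"
  define K where "K = inverse (- \<beta> * 2 powr (\<beta> - 1))"
  have \<beta>: "\<beta> < 0" using assms by (simp add: \<beta>_def)
  have K: "K > 0" unfolding K_def using \<beta> by (intro positive_imp_inverse_positive mult_pos_pos) auto
  have term_le: "real (Suc j) powr a \<le> K * (real (Suc j) powr \<beta> - real (Suc (Suc j)) powr \<beta>)" for j
  proof -
    have "K * (- \<beta> * 2 powr (\<beta> - 1) * real (Suc j) powr (\<beta> - 1)) \<le> K * (real (Suc j) powr \<beta> - real (Suc (Suc j)) powr \<beta>)"
      using K by (intro mult_left_mono powr_decrement_bounds(2)[OF \<beta>]) auto
    moreover have "K * (- \<beta> * 2 powr (\<beta> - 1)) = 1" unfolding K_def by (rule left_inverse) (use \<beta> in auto)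
    ultimately show ?thesis by (simp add: mult.assoc[symmetric] \<beta>_def)
  qed
  have "(\<Sum>j=i..J. real (Suc j) powr a) \<le> K * real (Suc i) powr \<beta>" for i J
  proof (cases "i \<le> J")
    case True
    have "(\<Sum>j=i..J. real (Suc j) powr a) \<le> (\<Sum>j=i..J. K * (real (Suc j) powr \<beta> - real (Suc (Suc j)) powr \<beta>))"
      by (intro sum_mono term_le)
    also have "\<dots> = K * (\<Sum>j=i..J. real (Suc j) powr \<beta> - real (Suc (Suc j)) powr \<beta>)"
      by (simp add: sum_distrib_left)
    also have "(\<Sum>j=i..J. real (Suc j) powr \<beta> - real (Suc (Suc j)) powr \<beta>) = real (Suc i) powr \<beta> - real (Suc (Suc J)) powr \<beta>"
      using True by (induction J rule: dec_induct) auto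
    also have "K * (real (Suc i) powr \<beta> - real (Suc (Suc J)) powr \<beta>) \<le> K * real (Suc i) powr \<beta>"
      using K by (intro mult_left_mono) auto
    finally show ?thesis .
  qed (use K in auto)
  then show ?thesis using that[of K] K by (simp add: \<beta>_def)
qed

lemma Abel_sum_increments:
  fixes w T :: "nat \<Rightarrow> real"
  shows "(\<Sum>j\<le>J. w j * (T j - (if j = 0 then 0 else T (j - 1)))) =
    (\<Sum>j\<le>J. (w j - w (Suc j)) * T j) + w (Suc J) * T J"
  by (induction J) (auto simp: algebra_simps)

text \<open>
  Summation by parts: the weight \<open>(1 + j) powr (a + 1)\<close> decreases by about \<open>(1 + j)
  powr a\<close> at each step, so increments of \<open>T\<close> against the larger weight are
  controlled by \<open>T\<close> against the smaller one.
\<close>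

lemma increments_weighted_sum_le:
  fixes T :: "nat \<Rightarrow> real" and a :: real
  assumes a: "a < -1"
  obtains K where "K \<ge> 0" "\<And>T N J. (\<And>j. 0 \<le> T j) \<Longrightarrow> mono T \<Longrightarrow>
    (\<And>J. (\<Sum>j\<le>J. real (Suc j) powr a * T j) \<le> N) \<Longrightarrow>
    (\<Sum>j\<le>J. real (Suc j) powr (a + 1) * (T j - (if j = 0 then 0 else T (j - 1)))) \<le> K * N"
proof -
  define \<beta> where "\<beta> = a + 1"
  have \<beta>: "\<beta> < 0" using a by (simp add: \<beta>_def)
  have "(\<Sum>j\<le>J. real (Suc j) powr \<beta> * (T j - (if j = 0 then 0 else T (j - 1)))) \<le> (- \<beta> + 2 powr (-a)) * N"
    if T: "\<And>j. 0 \<le> T j" "mono T" and N: "\<And>J. (\<Sum>j\<le>J. real (Suc j) powr a * T j) \<le> N" for T N J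
  proof -
    have "(\<Sum>j\<le>J. (real (Suc j) powr \<beta> - real (Suc (Suc j)) powr \<beta>) * T j)
        \<le> (\<Sum>j\<le>J. (- \<beta> * real (Suc j) powr (\<beta> - 1)) * T j)"
      by (intro sum_mono mult_right_mono powr_decrement_bounds \<beta> T)
    also have "\<dots> = - \<beta> * (\<Sum>j\<le>J. real (Suc j) powr a * T j)"
      by (simp add: sum_distrib_left \<beta>_def mult.assoc)
    also have "\<dots> \<le> - \<beta> * N" using \<beta> by (intro mult_left_mono N) auto
    finally have 1: "(\<Sum>j\<le>J. (real (Suc j) powr \<beta> - real (Suc (Suc j)) powr \<beta>) * T j) \<le> - \<beta> * N" .
    \<comment> \<open>The boundary term of the summation by parts is at most the sum over the block from \<open>J\<close> to \<open>2 J\<close>, as \<open>T\<close> is monotone.\<close>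
    have "real (Suc (Suc J)) powr \<beta> * T J \<le> real (Suc J) powr \<beta> * T J"
      using \<beta> T by (intro mult_right_mono powr_mono2') auto
    also have "real (Suc J) powr \<beta> = real (Suc J) * real (Suc J) powr a"
      by (simp add: \<beta>_def powr_add)
    also have "real (Suc J) * real (Suc J) powr a * T J = 2 powr (-a) * (\<Sum>j=J..2*J. (2 * real (Suc J)) powr a * T J)"
    proof -
      have "(2 * real (Suc J)) powr a = 2 powr a * real (Suc J) powr a" by (rule powr_mult)
      moreover have "real (card {J..2*J}) = real (Suc J)" by simp
      moreover have "2 powr (-a) * 2 powr a = (1::real)" by (simp flip: powr_add)
      ultimately show ?thesis by (simp del: of_nat_Suc)
    qed
    also have "\<dots> \<le> 2 powr (-a) * (\<Sum>j=J..2*J. real (Suc j) powr a * T j)"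
      using T a by (intro mult_left_mono sum_mono mult_mono powr_mono2') (auto simp: mono_def)
    also have "\<dots> \<le> 2 powr (-a) * (\<Sum>j\<le>2*J. real (Suc j) powr a * T j)"
      using T by (intro mult_left_mono sum_mono2) auto
    also have "\<dots> \<le> 2 powr (-a) * N" by (intro mult_left_mono N) auto
    finally have 2: "real (Suc (Suc J)) powr \<beta> * T J \<le> 2 powr (-a) * N" .
    show ?thesis
      using Abel_sum_increments[of "\<lambda>j. real (Suc j) powr \<beta>" T J] 1 2 unfolding distrib_right by linarith
  qed
  then show ?thesis using that[of "- \<beta> + 2 powr (-a)"] \<beta> by (simp add: \<beta>_def)
qed

text \<open>
  For \<open>r \<ge> 1\<close> the term \<open>D\<^sub>j\<^sup>r\<close> is at most the increment of
  \<open>S\<^sub>j\<^sup>r\<close>, where \<open>S\<close> is the partial sum, and summation by parts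
  gains the full power \<open>1\<close>. For \<open>r < 1\<close> concavity gives \<open>((1 + j)
  D\<^sub>j)\<^sup>r \<le> (1 + j) (S\<^sub>j\<^sup>r - S\<^sub>j\<^sub>-\<^sub>1\<^sup>r) +
  S\<^sub>j\<^sup>r\<close>, which gains the power \<open>r\<close> only. With \<open>r = q /
  p'\<close> the gain divided by \<open>q\<close> is \<open>1 / max p' q\<close>.
\<close>

lemma weighted_terms_le_partial_sums:
  fixes a r :: real
  assumes a: "a < -1" and r: "0 < r"
  obtains K where "K \<ge> 0" "\<And>D N J. (\<And>i. 0 \<le> D i) \<Longrightarrow>
    (\<And>J. (\<Sum>j\<le>J. real (Suc j) powr a * (\<Sum>i\<le>j. D i) powr r) \<le> N) \<Longrightarrow>
    (\<Sum>j\<le>J. real (Suc j) powr (a + min 1 r) * D j powr r) \<le> K * N"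
proof -
  obtain K where K: "K \<ge> 0" "\<And>T N J. (\<And>j. 0 \<le> T j) \<Longrightarrow> mono T \<Longrightarrow>
    (\<And>J. (\<Sum>j\<le>J. real (Suc j) powr a * T j) \<le> N) \<Longrightarrow>
    (\<Sum>j\<le>J. real (Suc j) powr (a + 1) * (T j - (if j = 0 then 0 else T (j - 1)))) \<le> K * N"
    using increments_weighted_sum_le[OF a] by blast
  have "(\<Sum>j\<le>J. real (Suc j) powr (a + min 1 r) * D j powr r) \<le> (K + 1) * N"
    if D: "\<And>i. 0 \<le> D i" and N: "\<And>J. (\<Sum>j\<le>J. real (Suc j) powr a * (\<Sum>i\<le>j. D i) powr r) \<le> N" for D N J
  proof -
    define S where "S j = (\<Sum>i\<le>j. D i)" for j
    define T where "T j = S j powr r" for j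
    have S0: "S j \<ge> 0" for j using D by (simp add: S_def sum_nonneg)
    have Smono: "S i \<le> S j" if "i \<le> j" for i j using D that unfolding S_def by (intro sum_mono2) auto
    have T: "0 \<le> T j" "mono T" for j
      using S0 Smono r by (auto simp: T_def mono_def intro!: powr_mono2)
    have inc: "(\<Sum>j\<le>J. real (Suc j) powr (a + 1) * (T j - (if j = 0 then 0 else T (j - 1)))) \<le> K * N"
      by (rule K(2)[OF T]) (use N in \<open>simp add: T_def S_def\<close>)
    have N0: "0 \<le> N" using N[of 0] by (rule order_trans[rotated]) (auto intro!: mult_nonneg_nonneg)
    have SS: "S j = (if j = 0 then 0 else S (j - 1)) + D j" for j
      by (cases j) (auto simp: S_def)
    show ?thesis
    proof (cases "r \<ge> 1")
      case True
      have "D j powr r \<le> T j - (if j = 0 then 0 else T (j - 1))" for j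
      proof -
        define x where "x = (if j = 0 then 0 else S (j - 1))"
        have x: "x \<ge> 0" using S0 by (simp add: x_def)
        have "D j powr r \<le> D j * (x + D j) powr (r - 1)"
        proof (cases "D j = 0")
          case False
          then have "D j > 0" using D[of j] by simp
          then have "D j powr r = D j * D j powr (r - 1)" by (simp add: powr_diff)
          also have "\<dots> \<le> D j * (x + D j) powr (r - 1)"
            using True x D by (intro mult_left_mono powr_mono2) auto
          finally show ?thesis .
        qed simp
        moreover have "x powr r + D j * (x + D j) powr (r - 1) \<le> (x + D j) powr r"
          using x D True by (intro powr_superadditive) auto
        moreover have "x + D j = S j" using SS by (simp add: x_def)
        moreover have "x powr r = (if j = 0 then 0 else T (j - 1))" by (simp add: x_def T_def)
        ultimately show ?thesis by (simp add: T_def)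
      qed
      then have "(\<Sum>j\<le>J. real (Suc j) powr (a + 1) * D j powr r) \<le> K * N"
        by (intro order_trans[OF sum_mono inc] mult_left_mono) auto
      then show ?thesis using True N0 by (simp add: min_def algebra_simps)
    next
      case False
      have *: "real (Suc j) powr r * D j powr r \<le> real (Suc j) * (T j - (if j = 0 then 0 else T (j - 1))) + T j" for j
      proof (cases "S j = 0")
        case True
        then have "D j = 0" using SS[of j] S0[of "j - 1"] D[of j] by (auto split: if_splits)
        moreover have "real (Suc j) * (T j - (if j = 0 then 0 else T (j - 1))) \<ge> 0"
          using T by (auto simp: mono_def)
        ultimately show ?thesis using T(1)[of j] by simp
      next
        case False
        then have Sp: "S j > 0" using S0[of j] by simp
        define L where "L = real (Suc j)"
        have "(L * D j) powr r \<le> S j powr r + r * S j powr (r - 1) * (L * D j - S j)"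
          using D Sp r \<open>\<not> r \<ge> 1\<close> by (intro powr_tangent_concave) (auto simp: L_def)
        also have "\<dots> \<le> T j + L * (r * S j powr (r - 1) * D j)"
          using r Sp by (auto simp: T_def algebra_simps)
        finally have *: "(L * D j) powr r \<le> T j + L * (r * S j powr (r - 1) * D j)" .
        have "r * S j powr (r - 1) * D j \<le> T j - (if j = 0 then 0 else T (j - 1))"
        proof -
          define x where "x = (if j = 0 then 0 else S (j - 1))"
          have "x powr r \<le> S j powr r + r * S j powr (r - 1) * (x - S j)"
            using S0 Sp r \<open>\<not> r \<ge> 1\<close> by (intro powr_tangent_concave) (auto simp: x_def)
          moreover have "x - S j = - D j" using SS[of j] by (simp add: x_def)
          moreover have "x powr r = (if j = 0 then 0 else T (j - 1))" by (simp add: x_def T_def)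
          ultimately show ?thesis by (simp add: T_def)
        qed
        then have "L * (r * S j powr (r - 1) * D j) \<le> L * (T j - (if j = 0 then 0 else T (j - 1)))"
          by (intro mult_left_mono) (auto simp: L_def)
        with * show ?thesis unfolding L_def powr_mult by linarith
      qed
      have "(\<Sum>j\<le>J. real (Suc j) powr (a + r) * D j powr r) \<le>
         (\<Sum>j\<le>J. real (Suc j) powr (a + 1) * (T j - (if j = 0 then 0 else T (j - 1))) + real (Suc j) powr a * T j)"
      proof (intro sum_mono)
        fix j
        have "real (Suc j) powr (a + r) * D j powr r = real (Suc j) powr a * (real (Suc j) powr r * D j powr r)"
          by (simp add: powr_add)
        also have "\<dots> \<le> real (Suc j) powr a * (real (Suc j) * (T j - (if j = 0 then 0 else T (j - 1))) + T j)"
          by (intro mult_left_mono *) auto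
        also have "\<dots> = real (Suc j) powr (a + 1) * (T j - (if j = 0 then 0 else T (j - 1))) + real (Suc j) powr a * T j"
          by (simp add: powr_add algebra_simps del: of_nat_Suc)
        finally show "real (Suc j) powr (a + r) * D j powr r \<le> \<dots>" .
      qed
      also have "\<dots> \<le> K * N + N"
        unfolding sum.distrib using N[of J] by (intro add_mono inc) (simp add: T_def S_def)
      finally show ?thesis using False by (simp add: min_def algebra_simps)
    qed
  qed
  then show ?thesis using that[of "K + 1"] K(1) by simp
qed

text \<open>
  Dual to the previous lemma. For \<open>\<rho> \<le> 1\<close> the power of the sum is at most the
  sum of the powers, and exchanging the summations costs the power \<open>1\<close> of a tail sum. For
  \<open>\<rho> > 1\<close> this is a discrete Hardy inequality: summation by parts leaves
  \<open>u\<^sub>j U\<^sub>j\<^sup>\<rho>\<^sup>-\<^sup>1\<close>, in which half of the left-hand side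
  is absorbed. The sums are finite, which makes the absorption legitimate. With \<open>\<rho> = q /
  p\<close> the cost divided by \<open>q\<close> is \<open>1 / min p q\<close>.
\<close>

lemma partial_sums_weighted_le_terms:
  fixes a \<rho> :: real
  assumes a: "a < -1" and \<rho>: "0 < \<rho>"
  obtains K where "K \<ge> 0" "\<And>u J. (\<And>i. 0 \<le> u i) \<Longrightarrow>
    (\<Sum>j\<le>J. real (Suc j) powr a * (\<Sum>i\<le>j. u i) powr \<rho>) \<le>
    K * (\<Sum>j\<le>J. real (Suc j) powr (a + max 1 \<rho>) * u j powr \<rho>)"
proof -
  obtain K where K: "K \<ge> 0" "\<And>i J. (\<Sum>j=i..J. real (Suc j) powr a) \<le> K * real (Suc i) powr (a + 1)"
    using powr_tail_sum_le[OF a] by blast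
  have swap: "(\<Sum>j\<le>J. real (Suc j) powr a * (\<Sum>i\<le>j. v i)) \<le> K * (\<Sum>i\<le>J. real (Suc i) powr (a + 1) * v i)"
    if v: "\<And>i. 0 \<le> v i" for v J
  proof -
    have "(\<Sum>j\<le>J. real (Suc j) powr a * (\<Sum>i\<le>j. v i)) = (\<Sum>j\<le>J. \<Sum>i\<le>j. real (Suc j) powr a * v i)"
      by (simp add: sum_distrib_left)
    also have "\<dots> = (\<Sum>i\<le>J. \<Sum>j=i..J. real (Suc j) powr a * v i)"
      by (simp add: sum.Sigma)
        (rule sum.reindex_bij_witness[of _ "\<lambda>(i, j). (j, i)" "\<lambda>(j, i). (i, j)"], auto)
    also have "\<dots> = (\<Sum>i\<le>J. (\<Sum>j=i..J. real (Suc j) powr a) * v i)"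
      by (simp add: sum_distrib_right)
    also have "\<dots> \<le> (\<Sum>i\<le>J. (K * real (Suc i) powr (a + 1)) * v i)"
      by (intro sum_mono mult_right_mono K v)
    finally show ?thesis by (simp add: sum_distrib_left mult.assoc)
  qed
  show ?thesis
  proof (cases "\<rho> \<le> 1")
    case True
    show ?thesis
    proof (rule that[OF K(1)])
      fix u :: "nat \<Rightarrow> real" and J assume u: "\<And>i. 0 \<le> u i"
      have "(\<Sum>j\<le>J. real (Suc j) powr a * (\<Sum>i\<le>j. u i) powr \<rho>) \<le> (\<Sum>j\<le>J. real (Suc j) powr a * (\<Sum>i\<le>j. u i powr \<rho>))"
        using u True \<rho> by (intro sum_mono mult_left_mono powr_sum_subadditive) auto
      also have "\<dots> \<le> K * (\<Sum>i\<le>J. real (Suc i) powr (a + 1) * u i powr \<rho>)" by (rule swap) simp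
      finally show "(\<Sum>j\<le>J. real (Suc j) powr a * (\<Sum>i\<le>j. u i) powr \<rho>) \<le>
          K * (\<Sum>j\<le>J. real (Suc j) powr (a + max 1 \<rho>) * u j powr \<rho>)" using max_absorb1[OF True] by simp
    qed
  next
    case False
    then have \<rho>1: "\<rho> > 1" by simp
    define M where "M = 2 * K * \<rho> + 1"
    have M: "M > 0" using K \<rho> by (simp add: M_def add_nonneg_pos)
    define C where "C = 2 * K * \<rho> * (M powr (\<rho> - 1))"
    have C: "C \<ge> 0" using K \<rho> by (simp add: C_def)
    show ?thesis
    proof (rule that[OF C])
      fix u :: "nat \<Rightarrow> real" and J assume u: "\<And>i. 0 \<le> u i"
      define U where "U j = (\<Sum>i\<le>j. u i)" for j
      define V where "V j = U j powr \<rho> - (if j = 0 then 0 else U (j - 1) powr \<rho>)" for j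
      have U0: "U j \<ge> 0" for j using u by (simp add: U_def sum_nonneg)
      have US: "U j = (if j = 0 then 0 else U (j - 1)) + u j" for j by (cases j) (auto simp: U_def)
      have V0: "V j \<ge> 0" for j
        using US[of j] U0 u \<rho> by (auto simp: V_def intro!: powr_mono2)
      have Vsum: "(\<Sum>i\<le>j. V i) = U j powr \<rho>" for j by (induction j) (auto simp: V_def)
      have term_le: "K * (real (Suc j) * V j) \<le> C / 2 * (real (Suc j) powr \<rho> * u j powr \<rho>) + U j powr \<rho> / 2" for j
      proof (cases "U j = 0")
        case True
        then have "V j = 0" using V0[of j] by (auto simp: V_def split: if_splits)
        then show ?thesis using C by simp
      next
        case False
        then have Up: "U j > 0" using U0[of j] by simp
        define x where "x = (if j = 0 then 0 else U (j - 1))"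
        have x: "x \<ge> 0" "U j = x + u j" "V j = U j powr \<rho> - x powr \<rho>"
          using US[of j] U0 by (auto simp: x_def V_def)
        have "U j powr \<rho> + \<rho> * U j powr (\<rho> - 1) * (x - U j) \<le> x powr \<rho>"
          using \<rho>1 Up x by (intro powr_tangent) auto
        then have V: "V j \<le> \<rho> * (U j powr (\<rho> - 1) * u j)" using x by (simp add: algebra_simps)
        define w where "w = real (Suc j) * u j"
        have w: "w \<ge> 0" using u by (simp add: w_def)
        \<comment> \<open>Either the new summand dominates the partial sum, or the partial sum absorbs it.\<close>
        have main: "K * \<rho> * (U j powr (\<rho> - 1) * w) \<le> C / 2 * w powr \<rho> + U j powr \<rho> / 2"
        proof (cases "U j \<le> M * w")
          case True
          have wp: "w > 0" using True Up M by (metis less_le_trans w mult_zero_right not_less order_less_le)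
          have "U j powr (\<rho> - 1) * w \<le> (M * w) powr (\<rho> - 1) * w"
            using True Up w \<rho>1 by (intro mult_right_mono powr_mono2) auto
          also have "\<dots> = M powr (\<rho> - 1) * w powr \<rho>"
            using M wp by (simp add: powr_mult powr_diff)
          finally have "K * \<rho> * (U j powr (\<rho> - 1) * w) \<le> K * \<rho> * (M powr (\<rho> - 1) * w powr \<rho>)"
            using K \<rho> by (intro mult_left_mono) auto
          also have "\<dots> = C / 2 * w powr \<rho>" by (simp add: C_def)
          also have "\<dots> \<le> C / 2 * w powr \<rho> + U j powr \<rho> / 2" by simp
          finally show ?thesis .
        next
          case False
          have "(2 * K * \<rho>) * w \<le> M * w" using w by (intro mult_right_mono) (auto simp: M_def)
          then have "(2 * K * \<rho>) * w \<le> U j" using False by simp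
          then have "U j powr (\<rho> - 1) * ((2 * K * \<rho>) * w) \<le> U j powr (\<rho> - 1) * U j"
            by (intro mult_left_mono) auto
          also have "\<dots> = U j powr \<rho>" using Up by (simp add: powr_diff)
          finally have "K * \<rho> * (U j powr (\<rho> - 1) * w) \<le> U j powr \<rho> / 2" by (simp add: algebra_simps)
          moreover have "0 \<le> C / 2 * w powr \<rho>" using C by simp
          ultimately show ?thesis by linarith
        qed
        have "K * (real (Suc j) * V j) \<le> K * (real (Suc j) * (\<rho> * (U j powr (\<rho> - 1) * u j)))"
          by (intro mult_left_mono V K) auto
        also have "\<dots> = K * \<rho> * (U j powr (\<rho> - 1) * w)" by (simp add: w_def algebra_simps)
        also note main
        also have "w powr \<rho> = real (Suc j) powr \<rho> * u j powr \<rho>"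
          unfolding w_def by (rule powr_mult)
        finally show ?thesis .
      qed
      define X where "X = (\<Sum>j\<le>J. real (Suc j) powr a * U j powr \<rho>)"
      define Y where "Y = (\<Sum>j\<le>J. real (Suc j) powr (a + \<rho>) * u j powr \<rho>)"
      have "X = (\<Sum>j\<le>J. real (Suc j) powr a * (\<Sum>i\<le>j. V i))" unfolding X_def Vsum ..
      also have "\<dots> \<le> K * (\<Sum>i\<le>J. real (Suc i) powr (a + 1) * V i)" by (rule swap[OF V0])
      also have "\<dots> = (\<Sum>i\<le>J. real (Suc i) powr a * (K * (real (Suc i) * V i)))"
        by (simp add: sum_distrib_left powr_add algebra_simps)
      also have "\<dots> \<le> (\<Sum>i\<le>J. real (Suc i) powr a * (C / 2 * (real (Suc i) powr \<rho> * u i powr \<rho>) + U i powr \<rho> / 2))"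
        by (intro sum_mono mult_left_mono term_le) auto
      also have "\<dots> = C / 2 * Y + X / 2"
        unfolding X_def Y_def by (simp add: sum.distrib sum_distrib_left sum_divide_distrib powr_add algebra_simps)
      finally have "X \<le> C * Y" by simp
      then show "(\<Sum>j\<le>J. real (Suc j) powr a * (\<Sum>i\<le>j. u i) powr \<rho>) \<le>
          C * (\<Sum>j\<le>J. real (Suc j) powr (a + max 1 \<rho>) * u j powr \<rho>)"
        using \<rho>1 by (simp add: X_def Y_def U_def max_def)
    qed
  qed
qed

text \<open>
  Half of the geometric decay, in the form of the square root of \<open>\<theta>\<close>, beats the
  power.
\<close>

lemma geometric_powr_sum_le:
  fixes \<theta> k :: real
  assumes "0 < \<theta>" "\<theta> < 1"
  obtains K where "K > 0" "\<And>n. (\<Sum>m\<le>n. \<theta> ^ m * real (Suc m) powr k) \<le> K"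
proof -
  define \<tau> where "\<tau> = sqrt \<theta>"
  have \<tau>: "0 < \<tau>" "\<tau> < 1" "\<tau> * \<tau> = \<theta>" using assms by (auto simp: \<tau>_def)
  have "(\<lambda>m. real (Suc m) powr k * \<tau> ^ m) \<longlonglongrightarrow> 0" using \<tau> by real_asymp
  then have "Bseq (\<lambda>m. real (Suc m) powr k * \<tau> ^ m)" by (simp add: convergentI convergent_imp_Bseq)
  then obtain B where B: "B > 0" "\<And>m. norm (real (Suc m) powr k * \<tau> ^ m) \<le> B" by (auto elim: BseqE)
  have "(\<Sum>m\<le>n. \<theta> ^ m * real (Suc m) powr k) \<le> B / (1 - \<tau>)" for n
  proof -
    have "(\<Sum>m\<le>n. \<theta> ^ m * real (Suc m) powr k) \<le> (\<Sum>m\<le>n. B * \<tau> ^ m)"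
    proof (intro sum_mono)
      fix m
      have "\<theta> ^ m * real (Suc m) powr k = (real (Suc m) powr k * \<tau> ^ m) * \<tau> ^ m"
        using \<tau>(3) by (simp flip: power_mult_distrib add: algebra_simps)
      also have "\<dots> \<le> B * \<tau> ^ m" using B(2)[of m] \<tau> by (intro mult_right_mono) auto
      finally show "\<theta> ^ m * real (Suc m) powr k \<le> B * \<tau> ^ m" .
    qed
    also have "\<dots> = B * ((1 - \<tau> ^ Suc n) / (1 - \<tau>))"
      using \<tau> by (simp add: sum_distrib_left[symmetric] sum_gp0)
    also have "\<dots> \<le> B / (1 - \<tau>)"
      using \<tau> B by (simp add: divide_right_mono mult_left_le)
    finally show ?thesis .
  qed
  moreover have "B / (1 - \<tau>) > 0" using B \<tau> by simp
  ultimately show ?thesis using that by blast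
qed

text \<open>
  Power weights are nearly constant on the scale of the geometric kernel, because \<open>1 + (j + m)
  \<le> (1 + j) (1 + m)\<close>.
\<close>

lemma geometric_convolution_pointwise_le:
  fixes \<theta> a :: real
  assumes "0 < \<theta>" "\<theta> < 1" "a \<le> 0"
  obtains K where "K > 0"
    "\<And>j J. (\<Sum>i=j..J. \<theta> ^ (i - j) * real (Suc i) powr (-a)) \<le> K * real (Suc j) powr (-a)"
    "\<And>i. (\<Sum>j\<le>i. \<theta> ^ (i - j) * real (Suc j) powr a) \<le> K * real (Suc i) powr a"
proof -
  obtain K where K: "K > 0" "\<And>n. (\<Sum>m\<le>n. \<theta> ^ m * real (Suc m) powr (-a)) \<le> K"
    using geometric_powr_sum_le[OF assms(1,2)] by blast
  have le: "real (Suc (j + m)) powr (-a) \<le> real (Suc m) powr (-a) * real (Suc j) powr (-a)" for j m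
  proof -
    have "real (Suc (j + m)) \<le> real (Suc m) * real (Suc j)" by (simp add: algebra_simps)
    then have "real (Suc (j + m)) powr (-a) \<le> (real (Suc m) * real (Suc j)) powr (-a)"
      using assms by (intro powr_mono2) auto
    then show ?thesis unfolding powr_mult .
  qed
  have 1: "(\<Sum>i=j..J. \<theta> ^ (i - j) * real (Suc i) powr (-a)) \<le> K * real (Suc j) powr (-a)" for j J
  proof (cases "j \<le> J")
    case True
    have "(\<Sum>i=j..J. \<theta> ^ (i - j) * real (Suc i) powr (-a)) = (\<Sum>m\<le>J - j. \<theta> ^ m * real (Suc (j + m)) powr (-a))"
      using True by (intro sum.reindex_bij_witness[of _ "\<lambda>m. j + m" "\<lambda>i. i - j"]) auto
    also have "\<dots> \<le> (\<Sum>m\<le>J - j. \<theta> ^ m * (real (Suc m) powr (-a) * real (Suc j) powr (-a)))"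
      using assms by (intro sum_mono mult_left_mono le) auto
    also have "\<dots> = (\<Sum>m\<le>J - j. \<theta> ^ m * real (Suc m) powr (-a)) * real (Suc j) powr (-a)"
      by (simp add: sum_distrib_right mult.assoc)
    also have "\<dots> \<le> K * real (Suc j) powr (-a)" by (intro mult_right_mono K) auto
    finally show ?thesis .
  qed (use K in auto)
  have 2: "(\<Sum>j\<le>i. \<theta> ^ (i - j) * real (Suc j) powr a) \<le> K * real (Suc i) powr a" for i
  proof -
    have "(\<Sum>j\<le>i. \<theta> ^ (i - j) * real (Suc j) powr a) = (\<Sum>m\<le>i. \<theta> ^ m * real (Suc (i - m)) powr a)"
      by (intro sum.reindex_bij_witness[of _ "\<lambda>m. i - m" "\<lambda>j. i - j"]) auto
    also have "\<dots> \<le> (\<Sum>m\<le>i. \<theta> ^ m * (real (Suc m) powr (-a) * real (Suc i) powr a))"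
    proof (intro sum_mono mult_left_mono)
      fix m assume "m \<in> {..i}"
      then have *: "real (Suc i) powr (-a) \<le> real (Suc m) powr (-a) * real (Suc (i - m)) powr (-a)"
        using le[of "i - m" m] by simp
      have "real (Suc i) powr (-a) * (real (Suc i) powr a * real (Suc (i - m)) powr a)
          \<le> (real (Suc m) powr (-a) * real (Suc (i - m)) powr (-a)) * (real (Suc i) powr a * real (Suc (i - m)) powr a)"
        by (intro mult_right_mono *) auto
      moreover have inv: "real (Suc n) powr (-a) * real (Suc n) powr a = 1" for n by (simp flip: powr_add)
      have "real (Suc i) powr (-a) * (real (Suc i) powr a * real (Suc (i - m)) powr a) = real (Suc (i - m)) powr a"
        by (simp only: mult.assoc[symmetric] inv mult_1_left)
      moreover have "(real (Suc m) powr (-a) * real (Suc (i - m)) powr (-a)) * (real (Suc i) powr a * real (Suc (i - m)) powr a)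
          = (real (Suc m) powr (-a) * real (Suc i) powr a) * (real (Suc (i - m)) powr (-a) * real (Suc (i - m)) powr a)"
        by (simp only: mult_ac)
      ultimately show "real (Suc (i - m)) powr a \<le> real (Suc m) powr (-a) * real (Suc i) powr a"
        by (simp only: inv mult_1_right)
    qed (use assms in auto)
    also have "\<dots> = (\<Sum>m\<le>i. \<theta> ^ m * real (Suc m) powr (-a)) * real (Suc i) powr a"
      by (simp add: sum_distrib_right mult.assoc)
    also have "\<dots> \<le> K * real (Suc i) powr a" by (intro mult_right_mono K) auto
    finally show ?thesis .
  qed
  show ?thesis using that[OF K(1) 1 2] .
qed

text \<open>Jensen's inequality for the geometric kernel reduces the claim to the weights alone.\<close>

lemma geometric_convolution_weighted_le:
  fixes \<theta> a q :: real
  assumes \<theta>: "0 < \<theta>" "\<theta> < 1" and a: "a \<le> 0" and q: "1 \<le> q"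
  obtains K where "K > 0" "\<And>A J J'. (\<And>i. 0 \<le> A i) \<Longrightarrow>
    (\<Sum>j\<le>J. real (Suc j) powr a * (\<Sum>i=j..J'. \<theta> ^ (i - j) * A i) powr q) \<le>
    K * (\<Sum>i\<le>J'. real (Suc i) powr a * A i powr q)"
proof -
  obtain K where K: "K > 0" "\<And>i. (\<Sum>j\<le>i. \<theta> ^ (i - j) * real (Suc j) powr a) \<le> K * real (Suc i) powr a"
    using geometric_convolution_pointwise_le[OF \<theta> a] by metis
  define G where "G = 1 / (1 - \<theta>)"
  have G: "G > 0" using \<theta> by (simp add: G_def)
  have geo: "(\<Sum>i=j..J'. \<theta> ^ (i - j)) \<le> G" for j J'
  proof (cases "j \<le> J'")
    case True
    have "(\<Sum>i=j..J'. \<theta> ^ (i - j)) = (\<Sum>m\<le>J' - j. \<theta> ^ m)"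
      using True by (intro sum.reindex_bij_witness[of _ "\<lambda>m. j + m" "\<lambda>i. i - j"]) auto
    also have "\<dots> = (1 - \<theta> ^ Suc (J' - j)) / (1 - \<theta>)" using \<theta> by (simp add: sum_gp0)
    also have "\<dots> \<le> G" unfolding G_def using \<theta> by (intro divide_right_mono) auto
    finally show ?thesis .
  qed (use G in auto)
  have "(\<Sum>j\<le>J. real (Suc j) powr a * (\<Sum>i=j..J'. \<theta> ^ (i - j) * A i) powr q) \<le>
    (G powr (q - 1) * K) * (\<Sum>i\<le>J'. real (Suc i) powr a * A i powr q)" if A: "\<And>i. 0 \<le> A i" for A J J'
  proof -
    have "(\<Sum>j\<le>J. real (Suc j) powr a * (\<Sum>i=j..J'. \<theta> ^ (i - j) * A i) powr q)
       \<le> (\<Sum>j\<le>J. real (Suc j) powr a * (G powr (q - 1) * (\<Sum>i=j..J'. \<theta> ^ (i - j) * A i powr q)))"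
    proof (intro sum_mono mult_left_mono)
      fix j
      have "(\<Sum>i=j..J'. \<theta> ^ (i - j) * A i) powr q \<le>
          (\<Sum>i=j..J'. \<theta> ^ (i - j)) powr (q - 1) * (\<Sum>i=j..J'. \<theta> ^ (i - j) * A i powr q)"
        using \<theta> A q by (intro weighted_powr_sum_le) auto
      also have "\<dots> \<le> G powr (q - 1) * (\<Sum>i=j..J'. \<theta> ^ (i - j) * A i powr q)"
        using \<theta> q geo by (intro mult_right_mono powr_mono2 sum_nonneg) auto
      finally show "(\<Sum>i=j..J'. \<theta> ^ (i - j) * A i) powr q \<le> \<dots>" .
    qed auto
    also have "\<dots> = G powr (q - 1) * (\<Sum>j\<le>J. \<Sum>i=j..J'. real (Suc j) powr a * \<theta> ^ (i - j) * A i powr q)"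
      by (simp add: sum_distrib_left algebra_simps)
    also have "(\<Sum>j\<le>J. \<Sum>i=j..J'. real (Suc j) powr a * \<theta> ^ (i - j) * A i powr q)
        = (\<Sum>i\<le>J'. \<Sum>j\<le>min i J. real (Suc j) powr a * \<theta> ^ (i - j) * A i powr q)"
      by (simp add: sum.Sigma)
        (rule sum.reindex_bij_witness[of _ "\<lambda>(i, j). (j, i)" "\<lambda>(j, i). (i, j)"], auto)
    also have "\<dots> \<le> (\<Sum>i\<le>J'. \<Sum>j\<le>i. real (Suc j) powr a * \<theta> ^ (i - j) * A i powr q)"
      using \<theta> by (intro sum_mono sum_mono2) auto
    also have "\<dots> = (\<Sum>i\<le>J'. (\<Sum>j\<le>i. \<theta> ^ (i - j) * real (Suc j) powr a) * A i powr q)"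
      by (simp add: sum_distrib_left mult_ac)
    also have "\<dots> \<le> (\<Sum>i\<le>J'. (K * real (Suc i) powr a) * A i powr q)"
      by (intro sum_mono mult_right_mono K) auto
    also have "\<dots> = K * (\<Sum>i\<le>J'. real (Suc i) powr a * A i powr q)"
      by (simp add: sum_distrib_left mult.assoc)
    finally show ?thesis by (simp add: mult.assoc mult_left_mono)
  qed
  moreover have "G powr (q - 1) * K > 0" using G K by simp
  ultimately show ?thesis using that by blast
qed

text \<open>
  This is \<open>2\<^sup>-\<^sup>1\<^sup>/\<^sup>p'\<close>, the ratio of the geometric sums that come
  from the \<open>L\<^sup>1\<close> endpoint.
\<close>

lemma dyadic_ratio_less_1:
  fixes p :: real
  assumes "1 < p"
  shows "2 powr (- 1 / (p / (p - 1))) < 1"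
proof -
  have "- 1 / (p / (p - 1)) < 0" using assms by (simp add: field_simps)
  then have "(2::real) powr (- 1 / (p / (p - 1))) < 2 powr 0" by (rule powr_less_mono) simp
  then show ?thesis by simp
qed

text \<open>
  The number \<open>H\<close> stands for the infinite sum over \<open>i \<ge> j\<close>. Asking the
  hypothesis for every upper bound of its partial sums avoids assuming convergence, which follows from
  the weighted bound on \<open>A\<close>.
\<close>

lemma limiting_interpolation_sequences:
  fixes p q b L :: real
  assumes p: "1 < p" and q: "1 \<le> q" and b: "b < - 1 / q" and L: "0 \<le> L"
  defines "P \<equiv> p / (p - 1)" and "\<theta> \<equiv> 2 powr (- 1 / (p / (p - 1)))"
  obtains C where "C \<ge> 0" "\<And>A D M J. (\<And>i. 0 \<le> A i) \<Longrightarrow> (\<And>i. 0 \<le> D i) \<Longrightarrow>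
    (\<And>J. (\<Sum>j\<le>J. (real (Suc j) powr (b + 1 / min p q) * A j) powr q) \<le> M) \<Longrightarrow>
    (\<And>j H. (\<And>J. (\<Sum>i=j..J. \<theta> ^ (i - j) * A i) \<le> H) \<Longrightarrow>
       (\<Sum>i\<le>j. D i powr P) powr (1 / P) \<le> L * (H + (\<Sum>i\<le>j. A i powr p) powr (1 / p))) \<Longrightarrow>
    (\<Sum>j\<le>J. (real (Suc j) powr (b + 1 / max P q) * D j) powr q) \<le> C * M"
proof -
  define a where "a = b * q"
  have a: "a < -1" using b q by (simp add: a_def field_simps)
  have P: "P > 1" using p by (simp add: P_def)
  have \<theta>: "0 < \<theta>" "\<theta> < 1" unfolding \<theta>_def by (simp, rule dyadic_ratio_less_1[OF p])
  have q0: "q > 0" "p > 0" "P > 0" using q p P by auto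
  have qP: "0 < q / P" and qp: "0 < q / p" and a0: "a \<le> 0" using q0 a by auto
  obtain K1 where K1: "K1 \<ge> 0" "\<And>D N J. (\<And>i. 0 \<le> D i) \<Longrightarrow>
    (\<And>J. (\<Sum>j\<le>J. real (Suc j) powr a * (\<Sum>i\<le>j. D i) powr (q / P)) \<le> N) \<Longrightarrow>
    (\<Sum>j\<le>J. real (Suc j) powr (a + min 1 (q / P)) * D j powr (q / P)) \<le> K1 * N"
    using weighted_terms_le_partial_sums[OF a qP] by blast
  obtain K2 where K2: "K2 \<ge> 0" "\<And>u J. (\<And>i. 0 \<le> u i) \<Longrightarrow>
    (\<Sum>j\<le>J. real (Suc j) powr a * (\<Sum>i\<le>j. u i) powr (q / p)) \<le>
    K2 * (\<Sum>j\<le>J. real (Suc j) powr (a + max 1 (q / p)) * u j powr (q / p))"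
    using partial_sums_weighted_le_terms[OF a qp] by blast
  obtain K3 where K3: "K3 > 0" "\<And>A J J'. (\<And>i. 0 \<le> A i) \<Longrightarrow>
    (\<Sum>j\<le>J. real (Suc j) powr a * (\<Sum>i=j..J'. \<theta> ^ (i - j) * A i) powr q) \<le>
    K3 * (\<Sum>i\<le>J'. real (Suc i) powr a * A i powr q)"
    using geometric_convolution_weighted_le[OF \<theta> a0 q] by blast
  define C where "C = K1 * (L powr q * (2 powr q * (K3 + K2)))"
  have C: "C \<ge> 0" using K1 K2 K3 by (simp add: C_def)
  have ex1: "(b + 1 / min p q) * q = a + max 1 (q / p)"
    using q0 by (cases "p \<le> q") (auto simp: a_def min_def max_def distrib_right)
  have ex2: "(b + 1 / max P q) * q = a + min 1 (q / P)"
    using q0 by (cases "P \<le> q") (auto simp: a_def min_def max_def distrib_right)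
  show ?thesis
  proof (rule that[OF C])
    fix A D :: "nat \<Rightarrow> real" and M J
    assume A: "\<And>i. 0 \<le> A i" and D: "\<And>i. 0 \<le> D i"
      and M: "\<And>J. (\<Sum>j\<le>J. (real (Suc j) powr (b + 1 / min p q) * A j) powr q) \<le> M"
      and AD: "\<And>j H. (\<And>J. (\<Sum>i=j..J. \<theta> ^ (i - j) * A i) \<le> H) \<Longrightarrow>
       (\<Sum>i\<le>j. D i powr P) powr (1 / P) \<le> L * (H + (\<Sum>i\<le>j. A i powr p) powr (1 / p))"
    have split_w: "(real (Suc j) powr c * x) powr q = real (Suc j) powr (c * q) * x powr q" for j c x
      by (simp add: powr_mult powr_powr)
    have M': "(\<Sum>j\<le>J. real (Suc j) powr (a + max 1 (q / p)) * A j powr q) \<le> M" for J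
      using M[of J] unfolding split_w ex1 .
    have M'': "(\<Sum>j\<le>J. real (Suc j) powr a * A j powr q) \<le> M" for J
      by (rule order_trans[OF sum_mono M'[of J]]) (auto intro!: mult_right_mono powr_mono)
    have M0: "0 \<le> M" using M''[of 0] by (rule order_trans[rotated]) auto
    \<comment> \<open>The bounds for the truncated sums are uniform in the truncation and pass to the limit \<open>h\<close>.\<close>
    define H where "H n j = (\<Sum>i=j..n. \<theta> ^ (i - j) * A i)" for n j
    have H0: "0 \<le> H n j" for n j using A \<theta> by (auto simp: H_def intro!: sum_nonneg)
    have Hinc: "incseq (\<lambda>n. H n j)" for j
      using A \<theta> by (auto simp: H_def mono_def intro!: sum_mono2)
    have Hb: "(\<Sum>j\<le>J. real (Suc j) powr a * H n j powr q) \<le> K3 * M" for J n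
      unfolding H_def using K3 by (intro order_trans[OF K3(2)[OF A]] mult_left_mono M'') auto
    have "\<exists>h. (\<lambda>n. H n j) \<longlonglongrightarrow> h" for j
    proof -
      have "H n j \<le> (K3 * M / real (Suc j) powr a) powr (1 / q)" for n
      proof -
        have "real (Suc j) powr a * H n j powr q \<le> K3 * M"
          by (rule order_trans[OF member_le_sum Hb[of n j]]) auto
        then have "H n j powr q \<le> K3 * M / real (Suc j) powr a" by (simp add: field_simps)
        then have "(H n j powr q) powr (1 / q) \<le> (K3 * M / real (Suc j) powr a) powr (1 / q)"
          using q0 by (intro powr_mono2) auto
        then show ?thesis using q0 H0 by (simp add: powr_powr)
      qed
      then show ?thesis using incseq_convergent[OF Hinc[of j]] by blast
    qed
    then obtain h where h: "\<And>j. (\<lambda>n. H n j) \<longlonglongrightarrow> h j" by metis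
    have h0: "0 \<le> h j" for j using h[of j] by (rule LIMSEQ_le_const) (use H0 in auto)
    have hb: "(\<Sum>j\<le>J. real (Suc j) powr a * h j powr q) \<le> K3 * M" for J
    proof (rule LIMSEQ_le_const2)
      show "(\<lambda>n. \<Sum>j\<le>J. real (Suc j) powr a * H n j powr q) \<longlonglongrightarrow> (\<Sum>j\<le>J. real (Suc j) powr a * h j powr q)"
        using q0 H0 by (intro tendsto_intros tendsto_powr' h) auto
    qed (use Hb in auto)
    have Hh: "H n j \<le> h j" for n j by (rule incseq_le[OF Hinc h])
    have pw: "(x powr (1 / c)) powr q = x powr (q / c)" for x c by (simp add: powr_powr)
    have S: "(\<Sum>i\<le>j. D i powr P) powr (q / P) \<le>
        L powr q * (2 powr q * (h j powr q + (\<Sum>i\<le>j. A i powr p) powr (q / p)))" for j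
    proof -
      have "(\<Sum>i\<le>j. D i powr P) powr (q / P) \<le> (L * (h j + (\<Sum>i\<le>j. A i powr p) powr (1 / p))) powr q"
        unfolding pw[symmetric] using Hh q0 by (intro powr_mono2 AD) (auto simp: H_def)
      also have "\<dots> = L powr q * (h j + (\<Sum>i\<le>j. A i powr p) powr (1 / p)) powr q" by (rule powr_mult)
      also have "\<dots> \<le> L powr q * (2 powr q * (h j powr q + ((\<Sum>i\<le>j. A i powr p) powr (1 / p)) powr q))"
        using h0 q by (intro mult_left_mono powr_add_le) auto
      finally show ?thesis unfolding pw .
    qed
    have "(\<Sum>j\<le>J. real (Suc j) powr (a + min 1 (q / P)) * (D j powr P) powr (q / P)) \<le>
        K1 * (L powr q * (2 powr q * (K3 * M + K2 * M)))"
    proof (rule K1(2))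
      fix J
      have "(\<Sum>j\<le>J. real (Suc j) powr a * (\<Sum>i\<le>j. D i powr P) powr (q / P)) \<le>
        (\<Sum>j\<le>J. real (Suc j) powr a * (L powr q * (2 powr q * (h j powr q + (\<Sum>i\<le>j. A i powr p) powr (q / p)))))"
        by (intro sum_mono mult_left_mono S) auto
      also have "\<dots> = L powr q * (2 powr q * ((\<Sum>j\<le>J. real (Suc j) powr a * h j powr q) +
         (\<Sum>j\<le>J. real (Suc j) powr a * (\<Sum>i\<le>j. A i powr p) powr (q / p))))"
        by (simp add: sum.distrib sum_distrib_left distrib_left mult_ac)
      also have "\<dots> \<le> L powr q * (2 powr q * (K3 * M + K2 * M))"
      proof (intro mult_left_mono add_mono hb)
        have "(\<Sum>j\<le>J. real (Suc j) powr a * (\<Sum>i\<le>j. A i powr p) powr (q / p)) \<le>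
          K2 * (\<Sum>j\<le>J. real (Suc j) powr (a + max 1 (q / p)) * (A j powr p) powr (q / p))"
          by (rule K2(2)) auto
        also have "\<dots> = K2 * (\<Sum>j\<le>J. real (Suc j) powr (a + max 1 (q / p)) * A j powr q)"
          using q0 by (simp add: powr_powr)
        also have "\<dots> \<le> K2 * M" by (intro mult_left_mono M' K2)
        finally show "(\<Sum>j\<le>J. real (Suc j) powr a * (\<Sum>i\<le>j. A i powr p) powr (q / p)) \<le> K2 * M" .
      qed auto
      finally show "(\<Sum>j\<le>J. real (Suc j) powr a * (\<Sum>i\<le>j. D i powr P) powr (q / P)) \<le>
        L powr q * (2 powr q * (K3 * M + K2 * M))" .
    qed auto
    also have "\<dots> = C * M" by (simp add: C_def algebra_simps)
    finally show "(\<Sum>j\<le>J. (real (Suc j) powr (b + 1 / max P q) * D j) powr q) \<le> C * M"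
      unfolding split_w ex2 using q0 by (simp add: powr_powr)
  qed
qed

text \<open>
  For \<open>e \<le> 1\<close> the terms are bounded by the telescoping differences of \<open>j powr e
  / e\<close>; otherwise they increase and the last one is the largest.
\<close>

lemma sum_powr_le:
  fixes e :: real
  assumes e: "0 < e"
  shows "(\<Sum>i\<le>j. real (Suc i) powr (e - 1)) \<le> max 1 (1 / e) * real (Suc j) powr e"
proof (cases "e \<le> 1")
  case True
  have "(\<Sum>i\<le>j. real (Suc i) powr (e - 1)) \<le> (\<Sum>i\<le>j. (real (Suc i) powr e - real i powr e) / e)"
  proof (intro sum_mono)
    fix i
    have "real i powr e \<le> real (Suc i) powr e + e * real (Suc i) powr (e - 1) * (real i - real (Suc i))"
      using True e by (intro powr_tangent_concave) auto
    then show "real (Suc i) powr (e - 1) \<le> (real (Suc i) powr e - real i powr e) / e"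
      using e by (simp add: field_simps)
  qed
  also have "\<dots> = real (Suc j) powr e / e"
    by (induction j) (use e in \<open>auto simp: diff_divide_distrib\<close>)
  also have "\<dots> \<le> max 1 (1 / e) * real (Suc j) powr e"
    using mult_right_mono[of "1 / e" "max 1 (1 / e)" "real (Suc j) powr e"] by simp
  finally show ?thesis .
next
  case False
  have "(\<Sum>i\<le>j. real (Suc i) powr (e - 1)) \<le> (\<Sum>i\<le>j. real (Suc j) powr (e - 1))"
    using False by (intro sum_mono powr_mono2) auto
  also have "\<dots> = real (Suc j) powr e" by (simp add: powr_diff)
  also have "\<dots> \<le> max 1 (1 / e) * real (Suc j) powr e"
    using mult_right_mono[of 1 "max 1 (1 / e)" "real (Suc j) powr e"] by simp
  finally show ?thesis .
qed

text \<open>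
  The case of the exponent \<open>\<infinity>\<close>: the weighted bound on \<open>A\<close> is
  inserted into the two sums, and no gain in the weight is available on the left.
\<close>

lemma limiting_interpolation_sequences_sup:
  fixes p b L :: real
  assumes p: "1 < p" and b: "b < 0" and L: "0 \<le> L"
  defines "P \<equiv> p / (p - 1)" and "\<theta> \<equiv> 2 powr (- 1 / (p / (p - 1)))"
  obtains C where "C \<ge> 0" "\<And>A D M j. (\<And>i. 0 \<le> A i) \<Longrightarrow> (\<And>i. 0 \<le> D i) \<Longrightarrow>
    (\<And>j. real (Suc j) powr (b + 1 / p) * A j \<le> M) \<Longrightarrow>
    (\<And>j H. (\<And>J. (\<Sum>i=j..J. \<theta> ^ (i - j) * A i) \<le> H) \<Longrightarrow>
       (\<Sum>i\<le>j. D i powr P) powr (1 / P) \<le> L * (H + (\<Sum>i\<le>j. A i powr p) powr (1 / p))) \<Longrightarrow>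
    real (Suc j) powr b * D j \<le> C * M"
proof -
  have P: "P > 1" using p by (simp add: P_def)
  have \<theta>: "0 < \<theta>" "\<theta> < 1" unfolding \<theta>_def by (simp, rule dyadic_ratio_less_1[OF p])
  have p0: "p > 0" "P > 0" using p P by auto
  obtain K where K: "K > 0" 
    "\<And>j J. (\<Sum>i=j..J. \<theta> ^ (i - j) * real (Suc i) powr (-b)) \<le> K * real (Suc j) powr (-b)"
    using geometric_convolution_pointwise_le[OF \<theta> less_imp_le[OF b]] by metis
  define e where "e = - b * p"
  have e: "e > 0" using b p by (simp add: e_def mult_neg_pos)
  define K' where "K' = max 1 (1 / e) powr (1 / p)"
  have K': "K' \<ge> 0" by (simp add: K'_def)
  define C where "C = L * (K + K')"
  have C: "C \<ge> 0" using L K K' by (simp add: C_def)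
  show ?thesis
  proof (rule that[OF C])
    fix A D :: "nat \<Rightarrow> real" and M j
    assume A: "\<And>i. 0 \<le> A i" and D: "\<And>i. 0 \<le> D i"
      and M: "\<And>j. real (Suc j) powr (b + 1 / p) * A j \<le> M"
      and AD: "\<And>j H. (\<And>J. (\<Sum>i=j..J. \<theta> ^ (i - j) * A i) \<le> H) \<Longrightarrow>
       (\<Sum>i\<le>j. D i powr P) powr (1 / P) \<le> L * (H + (\<Sum>i\<le>j. A i powr p) powr (1 / p))"
    have M0: "0 \<le> M" using M[of 0] A[of 0] by simp
    have A1: "A i \<le> M * real (Suc i) powr (- b - 1 / p)" for i
    proof -
      have "(real (Suc i) powr (b + 1 / p) * A i) * real (Suc i) powr (- b - 1 / p) \<le> M * real (Suc i) powr (- b - 1 / p)"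
        by (intro mult_right_mono M) auto
      moreover have "real (Suc i) powr (b + 1 / p) * real (Suc i) powr (- b - 1 / p) = 1"
        by (simp flip: powr_add)
      then have "(real (Suc i) powr (b + 1 / p) * A i) * real (Suc i) powr (- b - 1 / p) = A i"
        by (metis mult.assoc mult.commute mult.left_neutral)
      ultimately show ?thesis by (simp only:)
    qed
    have A2: "A i \<le> M * real (Suc i) powr (- b)" for i
      using p by (intro order_trans[OF A1] mult_left_mono powr_mono M0) auto
    have H: "(\<Sum>i=j..J. \<theta> ^ (i - j) * A i) \<le> M * (K * real (Suc j) powr (- b))" for J
    proof -
      have "(\<Sum>i=j..J. \<theta> ^ (i - j) * A i) \<le> (\<Sum>i=j..J. \<theta> ^ (i - j) * (M * real (Suc i) powr (- b)))"
        using \<theta> by (intro sum_mono mult_left_mono A2) auto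
      also have "\<dots> = M * (\<Sum>i=j..J. \<theta> ^ (i - j) * real (Suc i) powr (- b))"
        by (simp add: sum_distrib_left mult_ac)
      also have "\<dots> \<le> M * (K * real (Suc j) powr (- b))" by (intro mult_left_mono K M0)
      finally show ?thesis .
    qed
    have "(\<Sum>i\<le>j. A i powr p) \<le> (\<Sum>i\<le>j. M powr p * real (Suc i) powr (e - 1))"
    proof (intro sum_mono)
      fix i
      have "A i powr p \<le> (M * real (Suc i) powr (- b - 1 / p)) powr p" using A p0 by (intro powr_mono2 A1) auto
      also have "\<dots> = M powr p * real (Suc i) powr (e - 1)"
        using p0 by (simp add: powr_mult powr_powr e_def algebra_simps)
      finally show "A i powr p \<le> \<dots>" .
    qed
    also have "\<dots> = M powr p * (\<Sum>i\<le>j. real (Suc i) powr (e - 1))" by (simp add: sum_distrib_left)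
    also have "\<dots> \<le> M powr p * (max 1 (1 / e) * real (Suc j) powr e)"
      by (intro mult_left_mono sum_powr_le e) auto
    finally have "(\<Sum>i\<le>j. A i powr p) powr (1 / p) \<le> (M powr p * (max 1 (1 / e) * real (Suc j) powr e)) powr (1 / p)"
      using p0 by (intro powr_mono2 sum_nonneg) auto
    also have "\<dots> = M * (K' * real (Suc j) powr (- b))"
      using p0 M0 by (simp add: K'_def powr_mult powr_powr e_def del: of_nat_Suc)
    finally have "(\<Sum>i\<le>j. A i powr p) powr (1 / p) \<le> M * (K' * real (Suc j) powr (- b))" .
    then have "(\<Sum>i\<le>j. D i powr P) powr (1 / P) \<le> L * (M * (K * real (Suc j) powr (- b)) + M * (K' * real (Suc j) powr (- b)))"
      by (intro order_trans[OF AD[OF H] mult_left_mono[OF add_left_mono L]])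
    moreover have "D j \<le> (\<Sum>i\<le>j. D i powr P) powr (1 / P)"
    proof -
      have "(D j powr P) powr (1 / P) \<le> (\<Sum>i\<le>j. D i powr P) powr (1 / P)"
        using p0 by (intro powr_mono2 member_le_sum) auto
      then show ?thesis using p0 D by (simp add: powr_powr)
    qed
    ultimately have "real (Suc j) powr b * D j \<le> real (Suc j) powr b * (C * M * real (Suc j) powr (- b))"
      by (intro mult_left_mono) (auto simp: C_def algebra_simps)
    also have "\<dots> = C * M" by (simp flip: powr_add add: mult.left_commute[of "real (Suc j) powr b"])
    finally show "real (Suc j) powr b * D j \<le> C * M" .
  qed
qed

section \<open>A dense class of Schwartz functions\<close>

definition unit_cube :: "(real ^ 'd::finite) set" where
  "unit_cube = cbox (\<chi> i. - (1/2)) (\<chi> i. 1/2)"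

text \<open>
  Smallness of the integral of \<open>mixed_power p \<circ> norm \<circ> h\<close> means that
  \<open>h\<close> is small in \<open>L\<^sup>1\<close> and in \<open>L\<^sup>p\<close>. The first
  controls Fourier coefficients, the second is the norm in the definition of Fourier type.
\<close>

definition mixed_power :: "real \<Rightarrow> real \<Rightarrow> real" where
  "mixed_power p x = x + x powr p"

lemma mixed_power_0 [simp]: "mixed_power p 0 = 0"
  by (simp add: mixed_power_def)

lemma mixed_power_nonneg [simp]: "0 \<le> x \<Longrightarrow> 0 \<le> mixed_power p x"
  by (simp add: mixed_power_def)

lemma mixed_power_mono: "0 \<le> x \<Longrightarrow> x \<le> y \<Longrightarrow> 0 \<le> p \<Longrightarrow> mixed_power p x \<le> mixed_power p y"
  unfolding mixed_power_def by (intro add_mono powr_mono2) auto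

lemma mixed_power_add_le:
  assumes "0 \<le> x" "0 \<le> y" "1 \<le> p"
  shows "mixed_power p (x + y) \<le> 2 powr p * (mixed_power p x + mixed_power p y)"
proof -
  have "1 \<le> 2 powr p" using assms by (simp add: ge_one_powr_ge_zero)
  then have "1 * (x + y) \<le> 2 powr p * (x + y)" using assms by (intro mult_right_mono) auto
  then show ?thesis using powr_add_le[OF assms] by (simp add: mixed_power_def algebra_simps)
qed

lemma mixed_power_mult_le:
  assumes "0 \<le> x" "0 \<le> c" "1 \<le> p"
  shows "mixed_power p (c * x) \<le> (1 + c) powr p * mixed_power p x"
proof -
  have "(1 + c) powr 1 \<le> (1 + c) powr p" using assms by (intro powr_mono) auto
  then have "c * x \<le> (1 + c) powr p * x" using assms by (intro mult_right_mono) auto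
  moreover have "c powr p * x powr p \<le> (1 + c) powr p * x powr p"
    using assms by (intro mult_right_mono powr_mono2) auto
  ultimately show ?thesis by (simp add: mixed_power_def powr_mult algebra_simps)
qed

lemma continuous_on_mixed_power: "0 < p \<Longrightarrow> continuous_on {0..} (mixed_power p)"
  unfolding mixed_power_def by (intro continuous_intros continuous_on_powr') auto

lemma borel_measurable_mixed_power [measurable]:
  "g \<in> borel_measurable M \<Longrightarrow> (\<lambda>t. mixed_power p (g t)) \<in> borel_measurable M"
  unfolding mixed_power_def
  by (rule borel_measurable_add[OF _ powr_real_measurable[OF _ borel_measurable_const]])

lemma nn_integral_mixed_power_triangle:
  assumes [measurable]: "g \<in> borel_measurable M" "h \<in> borel_measurable M"
    and "1 \<le> p" and le: "\<And>t. 0 \<le> f t" "\<And>t. f t \<le> g t + h t" "\<And>t. 0 \<le> g t" "\<And>t. 0 \<le> h t"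
  shows "(\<integral>\<^sup>+t. ennreal (mixed_power p (f t)) \<partial>M) \<le> ennreal (2 powr p) *
    ((\<integral>\<^sup>+t. ennreal (mixed_power p (g t)) \<partial>M) + (\<integral>\<^sup>+t. ennreal (mixed_power p (h t)) \<partial>M))"
proof -
  have "(\<integral>\<^sup>+t. ennreal (mixed_power p (f t)) \<partial>M) \<le>
    (\<integral>\<^sup>+t. ennreal (2 powr p) * (ennreal (mixed_power p (g t)) + ennreal (mixed_power p (h t))) \<partial>M)"
  proof (intro nn_integral_mono)
    fix t
    have "mixed_power p (f t) \<le> mixed_power p (g t + h t)"
      using assms by (intro mixed_power_mono) auto
    also have "\<dots> \<le> 2 powr p * (mixed_power p (g t) + mixed_power p (h t))"
      using assms by (intro mixed_power_add_le) auto
    finally have "ennreal (mixed_power p (f t)) \<le> ennreal (2 powr p * (mixed_power p (g t) + mixed_power p (h t)))"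
      by (rule ennreal_leI)
    then show "ennreal (mixed_power p (f t)) \<le>
        ennreal (2 powr p) * (ennreal (mixed_power p (g t)) + ennreal (mixed_power p (h t)))"
      using le by (simp add: ennreal_mult ennreal_plus)
  qed
  also have "\<dots> = ennreal (2 powr p) *
    ((\<integral>\<^sup>+t. ennreal (mixed_power p (g t)) \<partial>M) + (\<integral>\<^sup>+t. ennreal (mixed_power p (h t)) \<partial>M))"
    by (subst nn_integral_cmult) (auto simp: nn_integral_add)
  finally show ?thesis .
qed

text \<open>
  These smooth functions tend to the indicator function of the unit cube as \<open>k\<close> grows. A
  product of one of them with a polynomial has derivatives of the same form.
\<close>

definition cutoff :: "nat \<Rightarrow> real ^ 'd::finite \<Rightarrow> real" where
  "cutoff k t = exp (- (\<Sum>i\<in>UNIV. (2 * t $ i) ^ (2 * k)))"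

lemma cutoff_pos [simp]: "0 < cutoff k t"
  by (simp add: cutoff_def)

lemma power_le_fact_mult_exp:
  fixes x :: real
  assumes "0 \<le> x"
  shows "x ^ n \<le> fact n * exp x"
proof -
  have "(\<Sum>i\<in>{n}. x ^ i /\<^sub>R fact i) \<le> (\<Sum>i. x ^ i /\<^sub>R fact i)"
    using assms by (intro sum_le_suminf summable_exp_generic) auto
  also have "\<dots> = exp x" using exp_converges[of x] by (simp add: sums_iff)
  finally show ?thesis by (simp add: field_simps)
qed

lemma real_polynomial_function_bound:
  fixes R :: "'a::real_normed_vector \<Rightarrow> real"
  assumes "real_polynomial_function R"
  shows "\<exists>B N. 0 \<le> B \<and> (\<forall>t. \<bar>R t\<bar> \<le> B * (1 + norm t) ^ N)"
  using assms
proof induction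
  case (linear f)
  then obtain K where "\<And>x. norm (f x) \<le> norm x * K" "K \<ge> 0" using bounded_linear.nonneg_bounded by blast
  then have "\<bar>f t\<bar> \<le> K * (1 + norm t) ^ 1" for t by (simp add: algebra_simps add_increasing)
  then show ?case using \<open>K \<ge> 0\<close> by blast
next
  case (const c)
  show ?case by (intro exI[of _ "\<bar>c\<bar>"] exI[of _ 0]) auto
next
  case (add f g)
  then obtain B N B' N' where *: "0 \<le> B" "\<And>t. \<bar>f t\<bar> \<le> B * (1 + norm t) ^ N" "0 \<le> B'" "\<And>t. \<bar>g t\<bar> \<le> B' * (1 + norm t) ^ N'"
    by metis
  have "\<bar>f t + g t\<bar> \<le> (B + B') * (1 + norm t) ^ (N + N')" for t
  proof -
    have "B * (1 + norm t) ^ N \<le> B * (1 + norm t) ^ (N + N')" "B' * (1 + norm t) ^ N' \<le> B' * (1 + norm t) ^ (N + N')"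
      using * by (auto intro!: mult_left_mono power_increasing)
    then show ?thesis using *(2)[of t] *(4)[of t] by (simp add: distrib_right)
  qed
  then show ?case using * by (intro exI[of _ "B + B'"] exI[of _ "N + N'"]) auto
next
  case (mult f g)
  then obtain B N B' N' where *: "0 \<le> B" "\<And>t. \<bar>f t\<bar> \<le> B * (1 + norm t) ^ N" "0 \<le> B'" "\<And>t. \<bar>g t\<bar> \<le> B' * (1 + norm t) ^ N'"
    by metis
  have "\<bar>f t * g t\<bar> \<le> (B * B') * (1 + norm t) ^ (N + N')" for t
    using mult_mono[OF *(2)[of t] *(4)[of t]] * by (simp add: abs_mult power_add mult_ac)
  then show ?case using * by (intro exI[of _ "B * B'"] exI[of _ "N + N'"]) auto
qed

text \<open>
  Domination by a Gaussian uniformly in \<open>k\<close>, since \<open>x - 1 \<le> x\<^sup>k\<close>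
  for \<open>x \<ge> 0\<close>. The constant \<open>exp d\<close> pays for the \<open>d\<close>
  subtracted ones.
\<close>

lemma cutoff_le:
  fixes t :: "real ^ 'd::finite"
  assumes "1 \<le> k"
  shows "cutoff k t \<le> exp (real CARD('d)) * exp (- 4 * (norm t)\<^sup>2)"
proof -
  have "(2 * t $ i)\<^sup>2 - 1 \<le> (2 * t $ i) ^ (2 * k)" for i
  proof -
    have "x - 1 \<le> x ^ k" if "0 \<le> x" for x :: real
    proof (cases "x \<le> 1")
      case True
      moreover have "0 \<le> x ^ k" using that by simp
      ultimately show ?thesis by linarith
    next
      case False
      then have "x \<le> x ^ k" using assms by (intro self_le_power) auto
      then show ?thesis by simp
    qed
    from this[of "(2 * t $ i)\<^sup>2"] show ?thesis by (simp add: power_mult)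
  qed
  then have "(\<Sum>i\<in>UNIV. (2 * t $ i)\<^sup>2 - 1) \<le> (\<Sum>i\<in>UNIV. (2 * t $ i) ^ (2 * k))"
    by (intro sum_mono)
  moreover have "(norm t)\<^sup>2 = (\<Sum>i\<in>UNIV. (t $ i)\<^sup>2)"
    by (subst power2_norm_eq_inner) (simp add: inner_vec_def power2_eq_square)
  then have "(\<Sum>i\<in>UNIV. (2 * t $ i)\<^sup>2 - 1) = 4 * (norm t)\<^sup>2 - real CARD('d)"
    by (simp only: sum_subtractf power_mult_distrib sum_distrib_left) simp
  ultimately show ?thesis unfolding cutoff_def by (simp flip: exp_add)
qed

text \<open>One bound serves as an integrable majorant for all \<open>k\<close> and shows rapid decay.\<close>

lemma polynomial_cutoff_bound:
  fixes R :: "real ^ 'd::finite \<Rightarrow> real"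
  assumes "real_polynomial_function R"
  obtains B where "0 \<le> B" "\<And>k t. 1 \<le> k \<Longrightarrow> \<bar>R t * cutoff k t\<bar> \<le> B * exp (- norm t)"
proof -
  obtain B N where B: "0 \<le> B" "\<And>t. \<bar>R t\<bar> \<le> B * (1 + norm t) ^ N"
    using real_polynomial_function_bound[OF assms] by blast
  define C where "C = B * fact N * exp (2 + real CARD('d))"
  have "\<bar>R t * cutoff k t\<bar> \<le> C * exp (- norm t)" if "1 \<le> k" for k t
  proof -
    define n where "n = norm t"
    \<comment> \<open>Completing the square leaves room for a factor \<open>exp (1 + n)\<close> that dominates the polynomial.\<close>
    have "0 \<le> (2 * n - 1 / 2)\<^sup>2" by simp
    then have sq: "1 + n - 4 * n\<^sup>2 \<le> 2 - n" by (simp add: power2_eq_square algebra_simps)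
    have "\<bar>R t * cutoff k t\<bar> = \<bar>R t\<bar> * cutoff k t" by (simp add: abs_mult cutoff_def)
    also have "\<dots> \<le> (B * (1 + n) ^ N) * (exp (real CARD('d)) * exp (- 4 * n\<^sup>2))"
      unfolding n_def by (intro mult_mono B cutoff_le that) (auto simp: B cutoff_def)
    also have "\<dots> \<le> (B * (fact N * exp (1 + n))) * (exp (real CARD('d)) * exp (- 4 * n\<^sup>2))"
      using power_le_fact_mult_exp[of "1 + n" N] by (intro mult_right_mono mult_left_mono B) (auto simp: n_def)
    also have "\<dots> = B * fact N * exp (real CARD('d)) * exp (1 + n - 4 * n\<^sup>2)"
      by (simp add: exp_diff exp_minus field_simps exp_add)
    also have "\<dots> \<le> B * fact N * exp (real CARD('d)) * exp (2 - n)"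
      using sq B by (intro mult_left_mono) auto
    also have "\<dots> = C * exp (- n)" by (simp add: C_def exp_add exp_diff exp_minus field_simps)
    finally show ?thesis by (simp add: n_def)
  qed
  moreover have "0 \<le> C" using B by (simp add: C_def)
  ultimately show ?thesis using that by blast
qed

text \<open>
  Integrate over the balls of radius \<open>k + 1\<close>: their volumes grow like a power of
  \<open>k\<close>, while \<open>exp (- k)\<close> decays geometrically.
\<close>

lemma nn_integral_exp_norm_finite:
  "(\<integral>\<^sup>+t. ennreal (exp (- norm (t::'a::euclidean_space))) \<partial>lborel) < \<infinity>"
proof -
  let ?D = "real DIM('a)"
  obtain K where K: "K > 0" "\<And>n. (\<Sum>m\<le>n. exp (-1) ^ m * real (Suc m) powr ?D) \<le> K"
    using geometric_powr_sum_le[of "exp (-1)" ?D] by (metis exp_gt_zero exp_less_one_iff less_numeral_extra(1) neg_less_0_iff_less)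
  let ?V = "unit_ball_vol ?D"
  have "(\<integral>\<^sup>+t. ennreal (exp (- norm (t::'a))) \<partial>lborel) \<le>
      (\<integral>\<^sup>+t. (\<Sum>k. ennreal (exp (- real k)) * indicator (ball (0::'a) (real (Suc k))) t) \<partial>lborel)"
  proof (intro nn_integral_mono)
    fix t :: 'a
    define k where "k = nat \<lfloor>norm t\<rfloor>"
    have k: "real k \<le> norm t" by (simp add: k_def of_nat_floor)
    have k': "norm t < real (Suc k)" unfolding k_def by linarith
    have "ennreal (exp (- norm t)) \<le> ennreal (exp (- real k)) * indicator (ball (0::'a) (real (Suc k))) t"
      using k k' by (auto simp: indicator_def intro!: ennreal_leI)
    also have "\<dots> \<le> (\<Sum>k. ennreal (exp (- real k)) * indicator (ball (0::'a) (real (Suc k))) t)" (is "?F k \<le> _")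
      using sum_le_suminf[of ?F "{k}"] by (simp only: sum.insert sum.empty finite.emptyI finite.insertI
          empty_iff not_False_eq_True add_0_right zero_le summableI_nonneg_bounded summableI ball_simps simp_thms)
    finally show "ennreal (exp (- norm t)) \<le> \<dots>" .
  qed
  also have "\<dots> = (\<Sum>k. ennreal (exp (- real k)) * emeasure lborel (ball (0::'a) (real (Suc k))))"
    by (subst nn_integral_suminf) (measurable, auto simp: nn_integral_cmult_indicator)
  also have "\<dots> = (\<Sum>k. ennreal (?V * (exp (-1) ^ k * real (Suc k) powr ?D)))"
    by (intro suminf_cong)
       (simp add: emeasure_ball ennreal_mult'[symmetric] powr_realpow exp_of_nat_mult[symmetric] mult_ac del: of_nat_Suc)
  also have "\<dots> \<le> ennreal (?V * K)"
  proof (subst suminf_eq_SUP, intro SUP_least)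
    fix n
    have "(\<Sum>k<n. ennreal (?V * (exp (-1) ^ k * real (Suc k) powr ?D))) = ennreal (\<Sum>k<n. ?V * (exp (-1) ^ k * real (Suc k) powr ?D))"
      by (intro sum_ennreal) auto
    also have "\<dots> \<le> ennreal (?V * K)"
    proof (intro ennreal_leI)
      have "(\<Sum>k<n. ?V * (exp (-1) ^ k * real (Suc k) powr ?D)) = ?V * (\<Sum>k<n. exp (-1) ^ k * real (Suc k) powr ?D)"
        by (simp add: sum_distrib_left)
      also have "\<dots> \<le> ?V * (\<Sum>k\<le>n. exp (-1) ^ k * real (Suc k) powr ?D)"
        by (intro mult_left_mono sum_mono2) auto
      also have "\<dots> \<le> ?V * K" by (intro mult_left_mono K) auto
      finally show "(\<Sum>k<n. ?V * (exp (-1) ^ k * real (Suc k) powr ?D)) \<le> ?V * K" .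
    qed
    finally show "(\<Sum>k<n. ennreal (?V * (exp (-1) ^ k * real (Suc k) powr ?D))) \<le> ennreal (?V * K)" .
  qed
  also have "\<dots> < \<infinity>" by simp
  finally show ?thesis .
qed

lemma mixed_power_exp_le:
  assumes "0 \<le> B" "1 \<le> p" "0 \<le> n"
  shows "mixed_power p (B * exp (- n)) \<le> (B + B powr p) * exp (- n)"
proof -
  have "exp (- n) powr p \<le> exp (- n) powr 1"
    using assms by (intro powr_mono') auto
  then have "B powr p * exp (- n) powr p \<le> B powr p * exp (- n)" by (intro mult_left_mono) auto
  then show ?thesis by (simp add: mixed_power_def powr_mult algebra_simps)
qed

lemma nn_integral_mixed_power_exp_finite:
  assumes "0 \<le> B" "1 \<le> p"
  shows "(\<integral>\<^sup>+t. ennreal (mixed_power p (B * exp (- norm (t::'a::euclidean_space)))) \<partial>lebesgue) < \<infinity>"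
proof -
  have "(\<integral>\<^sup>+t. ennreal (mixed_power p (B * exp (- norm (t::'a)))) \<partial>lebesgue) \<le>
    (\<integral>\<^sup>+t. ennreal (B + B powr p) * ennreal (exp (- norm (t::'a))) \<partial>lborel)"
    unfolding nn_integral_completion
    using assms by (subst ennreal_mult''[symmetric]) (auto intro!: nn_integral_mono ennreal_leI mixed_power_exp_le)
  also have "\<dots> = ennreal (B + B powr p) * (\<integral>\<^sup>+t. ennreal (exp (- norm (t::'a))) \<partial>lborel)"
    by (rule nn_integral_cmult) simp
  also have "\<dots> < \<infinity>" using nn_integral_exp_norm_finite[where 'a='a] by (simp add: ennreal_mult_less_top)
  finally show ?thesis .
qed

lemma continuous_on_real_polynomial_function:
  "real_polynomial_function R \<Longrightarrow> continuous_on S (R :: 'a::euclidean_space \<Rightarrow> real)"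
  using continuous_on_polymonial_function real_polynomial_function_eq by metis

lemma continuous_on_cutoff: "continuous_on S (cutoff k)"
  unfolding cutoff_def by (intro continuous_intros)

lemma emeasure_unit_cube: "emeasure lborel (unit_cube :: (real ^ 'd::finite) set) = 1"
proof -
  have "measure lborel (unit_cube :: (real ^ 'd) set) = 1"
    unfolding unit_cube_def by (subst content_cbox_cart) (auto simp: interval_eq_empty_cart)
  then show ?thesis unfolding unit_cube_def
    by (metis emeasure_eq_ennreal_measure emeasure_lborel_cbox_finite ennreal_1 less_irrefl infinity_ennreal_def)
qed

lemma cutoff_tendsto:
  fixes t :: "real ^ 'd::finite"
  assumes "\<And>i. \<bar>t $ i\<bar> \<noteq> 1/2"
  shows "(\<lambda>k. cutoff k t) \<longlonglongrightarrow> indicator unit_cube t"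
proof (cases "t \<in> unit_cube")
  case True
  have lt: "\<bar>t $ i\<bar> < 1/2" for i
  proof -
    have "- (1/2) \<le> t $ i" "t $ i \<le> 1/2" using True by (auto simp: unit_cube_def mem_box_cart)
    then show ?thesis using assms[of i] by linarith
  qed
  have "\<bar>(2 * t $ i)\<^sup>2\<bar> < 1" for i
    using lt[of i] abs_square_less_1[of "2 * t $ i"] by (simp add: abs_mult)
  then have "(\<lambda>k. (2 * t $ i) ^ (2 * k)) \<longlonglongrightarrow> 0" for i
    unfolding power_mult by (intro LIMSEQ_power_zero) auto
  then have "(\<lambda>k. cutoff k t) \<longlonglongrightarrow> exp (- (\<Sum>i\<in>(UNIV::'d set). 0))"
    unfolding cutoff_def by (intro tendsto_intros)
  then show ?thesis using True by simp
next
  case False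
  then obtain i where "\<not> (- (1/2) \<le> t $ i \<and> t $ i \<le> 1/2)"
    by (auto simp: unit_cube_def mem_box_cart)
  then have i: "\<bar>t $ i\<bar> > 1/2" by linarith
  define x where "x = (2 * t $ i)\<^sup>2"
  have "1 < \<bar>2 * t $ i\<bar>" using i by (simp add: abs_mult)
  then have x: "x > 1" unfolding x_def by (metis abs_square_eq_1 abs_square_le_1 less_le not_le)
  have le: "cutoff k t \<le> exp (- (x ^ k))" for k
  proof -
    have "x ^ k \<le> (\<Sum>i\<in>UNIV. (2 * t $ i) ^ (2 * k))"
      unfolding x_def power_mult[symmetric] by (rule member_le_sum) auto
    then show ?thesis by (simp add: cutoff_def)
  qed
  have "filterlim (\<lambda>k. - (x ^ k)) at_bot sequentially"
    using filterlim_realpow_sequentially_gt1[of x] x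
    by (intro filterlim_uminus_at_bot[THEN iffD2]) (auto simp: filterlim_at_infinity_imp_filterlim_at_top)
  then have lim0: "(\<lambda>k. exp (- (x ^ k))) \<longlonglongrightarrow> 0"
    by (rule filterlim_compose[OF exp_at_bot])
  have "(\<lambda>k. cutoff k t) \<longlonglongrightarrow> 0"
    by (rule tendsto_sandwich[OF _ _ tendsto_const lim0])
      (auto intro!: always_eventually le less_imp_le[OF cutoff_pos])
  then show ?thesis using False by simp
qed

text \<open>
  On the faces of the cube a power \<open>(2 t\<^sub>i)\<^sup>2\<^sup>k\<close> equals \<open>1\<close> for all
  \<open>k\<close>, so the cutoffs do not tend to the indicator function there. Only convergence almost
  everywhere is true.
\<close>

lemma AE_off_unit_cube_faces: "AE t::real ^ 'd::finite in lborel. \<forall>i. \<bar>t $ i\<bar> \<noteq> 1/2"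
proof -
  have n: "negligible {t::real ^ 'd. t $ i = c}" for i c
  proof -
    have "negligible {t::real ^ 'd. t \<bullet> axis i 1 = c}"
      by (rule negligible_standard_hyperplane) (auto simp: axis_in_Basis_iff)
    then show ?thesis by (simp add: inner_axis)
  qed
  have "negligible (\<Union>i. {t::real ^ 'd. t $ i = 1/2} \<union> {t. t $ i = -(1/2)})"
  proof (rule negligible_Union)
    fix S assume "S \<in> range (\<lambda>i. {t::real ^ 'd. t $ i = 1/2} \<union> {t. t $ i = -(1/2)})"
    then show "negligible S" using negligible_Un[OF n n] by blast
  qed simp
  then have "AE t::real ^ 'd in lebesgue. t \<notin> (\<Union>i. {t. t $ i = 1/2} \<union> {t. t $ i = -(1/2)})"
    using AE_not_in negligible_iff_null_sets by blast
  then show ?thesis unfolding AE_completion_iff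
  proof eventually_elim
    case (elim t)
    have "t $ i = 1/2 \<or> t $ i = -(1/2)" if "\<bar>t $ i\<bar> = 1/2" for i using that by linarith
    with elim show ?case by blast
  qed
qed

lemma nn_integral_mixed_power_cutoff_tendsto:
  fixes R :: "real ^ 'd::finite \<Rightarrow> real"
  assumes R: "real_polynomial_function R" and p: "1 \<le> p"
  shows "(\<lambda>k. \<integral>\<^sup>+t. ennreal (mixed_power p \<bar>R t * cutoff k t - R t * indicator unit_cube t\<bar>) \<partial>lebesgue) \<longlonglongrightarrow> 0"
proof -
  obtain B where B: "0 \<le> B" "\<And>k t. 1 \<le> k \<Longrightarrow> \<bar>R t * cutoff k t\<bar> \<le> B * exp (- norm t)"
    using polynomial_cutoff_bound[OF R] by blast
  have Rm [measurable]: "R \<in> borel_measurable borel"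
    by (intro borel_measurable_continuous_onI continuous_on_real_polynomial_function R)
  have cm [measurable]: "cutoff k \<in> borel_measurable (borel :: (real ^ 'd) measure)" for k
    by (intro borel_measurable_continuous_onI continuous_on_cutoff)
  have [measurable]: "unit_cube \<in> sets (borel :: (real ^ 'd) measure)" by (simp add: unit_cube_def)
  let ?f = "\<lambda>k t. R t * cutoff k t - R t * indicator unit_cube t"
  have ae: "AE t in lborel. (\<lambda>k. ?f (Suc k) t) \<longlonglongrightarrow> 0"
    using AE_off_unit_cube_faces
  proof eventually_elim
    case (elim t)
    have "(\<lambda>k. cutoff (Suc k) t) \<longlonglongrightarrow> indicator unit_cube t"
      using LIMSEQ_Suc[OF cutoff_tendsto[of t]] elim by blast
    then have "(\<lambda>k. ?f (Suc k) t) \<longlonglongrightarrow> R t * indicator unit_cube t - R t * indicator unit_cube t"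
      by (intro tendsto_intros)
    then show ?case by simp
  qed
  have bound: "AE t in lborel. \<forall>k. \<bar>?f (Suc k) t\<bar> \<le> 2 * B * exp (- norm t)"
    using AE_off_unit_cube_faces
  proof eventually_elim
    case (elim t)
    have "(\<lambda>k. \<bar>R t * cutoff (Suc k) t\<bar>) \<longlonglongrightarrow> \<bar>R t * indicator unit_cube t\<bar>"
      using LIMSEQ_Suc[OF cutoff_tendsto[of t]] elim by (intro tendsto_intros) blast
    then have b: "\<bar>R t * indicator unit_cube t\<bar> \<le> B * exp (- norm t)"
      by (rule LIMSEQ_le_const2) (use B in auto)
    have "\<bar>R t * cutoff (Suc k) t\<bar> + \<bar>R t * indicator unit_cube t\<bar> \<le> 2 * B * exp (- norm t)" for k
      using add_mono[OF B(2)[of "Suc k" t] b] by (simp only: mult.assoc mult_2) simp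
    then show ?case by (intro allI) (rule order_trans[OF abs_triangle_ineq4])
  qed
  have "(\<lambda>k. \<integral>\<^sup>+t. ennreal (mixed_power p \<bar>?f (Suc k) t\<bar>) \<partial>lborel) \<longlonglongrightarrow> (\<integral>\<^sup>+t. 0 \<partial>(lborel :: (real ^ 'd) measure))"
  proof (rule nn_integral_dominated_convergence[where w = "\<lambda>t. ennreal (mixed_power p (2 * B * exp (- norm t)))"])
    show "AE t in lborel. ennreal (mixed_power p \<bar>?f (Suc k) t\<bar>) \<le> ennreal (mixed_power p (2 * B * exp (- norm t)))" for k
      using bound by eventually_elim (use p in \<open>auto intro!: ennreal_leI mixed_power_mono\<close>)
    show "(\<integral>\<^sup>+ t. ennreal (mixed_power p (2 * B * exp (- norm (t::real^'d)))) \<partial>lborel) < \<infinity>"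
      using nn_integral_mixed_power_exp_finite[of "2 * B" p, where 'a = "real ^ 'd"] B p
      by (simp add: nn_integral_completion)
    show "AE t in lborel. (\<lambda>k. ennreal (mixed_power p \<bar>?f (Suc k) t\<bar>)) \<longlonglongrightarrow> 0"
      using ae
    proof eventually_elim
      case (elim t)
      have "(\<lambda>k. \<bar>?f (Suc k) t\<bar>) \<longlonglongrightarrow> 0" using tendsto_rabs[OF elim] by simp
      then have "(\<lambda>k. mixed_power p \<bar>?f (Suc k) t\<bar>) \<longlonglongrightarrow> mixed_power p 0"
        using p by (intro continuous_on_tendsto_compose[OF continuous_on_mixed_power]) auto
      then show ?case using tendsto_ennrealI[of _ "mixed_power p 0"] by simp
    qed
  qed measurable
  then have "(\<lambda>k. \<integral>\<^sup>+t. ennreal (mixed_power p \<bar>?f (Suc k) t\<bar>) \<partial>lebesgue) \<longlonglongrightarrow> 0"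
    by (simp add: nn_integral_completion)
  then show ?thesis by (rule LIMSEQ_imp_Suc)
qed

lemma ennreal_mult_add_same:
  assumes "0 \<le> c" "0 \<le> x"
  shows "ennreal c * (ennreal x + ennreal x) = ennreal (c * (x + x))"
  unfolding ennreal_mult[OF assms(1) add_nonneg_nonneg[OF assms(2,2)]] ennreal_plus[OF assms(2,2)] ..

text \<open>
  On the compact cube, a measurable set is approximated by continuous functions and those by
  polynomials. The polynomial is not controlled outside the cube.
\<close>

lemma polynomial_approx_indicator:
  fixes A :: "(real ^ 'd::finite) set"
  assumes A: "A \<in> sets lebesgue" and p: "1 \<le> p" and \<epsilon>: "0 < \<epsilon>"
  obtains R where "real_polynomial_function R"
    "(\<integral>\<^sup>+t. ennreal (mixed_power p (indicator unit_cube t * \<bar>R t - indicator A t\<bar>)) \<partial>lebesgue) < ennreal \<epsilon>"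
proof -
  let ?Q = "unit_cube :: (real ^ 'd) set"
  define c where "c = 2 powr p"
  have c: "c > 0" by (simp add: c_def)
  have Q: "?Q \<in> sets borel" "?Q \<in> sets lebesgue" "compact ?Q" by (auto simp: unit_cube_def)
  have Qm: "emeasure lebesgue ?Q = 1" using emeasure_unit_cube Q by simp
  have "(indicator A :: _ \<Rightarrow> real) measurable_on UNIV"
    by (rule lebesgue_measurable_imp_measurable_on_real) (use A in auto)
  then obtain N g where N: "negligible N" and g: "\<And>n. continuous_on UNIV (g n)"
      "\<And>x. x \<notin> N \<Longrightarrow> (\<lambda>n. g n x) \<longlonglongrightarrow> (indicator A x :: real)"
    unfolding measurable_on_def by auto
  define h where "h n x = max 0 (min 1 (g n x))" for n :: nat and x
  have h01: "0 \<le> h n x" "h n x \<le> 1" for n x by (auto simp: h_def)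
  have h: "continuous_on UNIV (h n)" for n unfolding h_def by (intro continuous_intros g)
  have hm: "h n \<in> borel_measurable lebesgue" for n
    using borel_measurable_continuous_onI[OF h[of n]] by (simp add: measurable_completion)
  have Am: "(indicator A :: _ \<Rightarrow> real) \<in> borel_measurable lebesgue"
    and Qi: "(indicator ?Q :: _ \<Rightarrow> real) \<in> borel_measurable lebesgue"
    by (rule borel_measurable_indicator[OF A], rule borel_measurable_indicator[OF Q(2)])
  have hA: "(\<lambda>t. indicator ?Q t * \<bar>h n t - indicator A t\<bar>) \<in> borel_measurable lebesgue" for n
    by (rule borel_measurable_times[OF Qi borel_measurable_abs[OF borel_measurable_diff[OF hm Am]]])
  have "(\<lambda>n. \<integral>\<^sup>+t. ennreal (mixed_power p (indicator ?Q t * \<bar>h n t - indicator A t\<bar>)) \<partial>lebesgue) \<longlonglongrightarrow> (\<integral>\<^sup>+t. 0 \<partial>(lebesgue :: (real ^ 'd) measure))"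
  proof (rule nn_integral_dominated_convergence[where w = "\<lambda>t. ennreal (mixed_power p 1) * indicator ?Q t"])
    show "AE t in lebesgue. ennreal (mixed_power p (indicator ?Q t * \<bar>h n t - indicator A t\<bar>))
        \<le> ennreal (mixed_power p 1) * indicator ?Q t" for n
    proof (intro AE_I2)
      fix t
      have "\<bar>h n t - indicator A t\<bar> \<le> 1" using h01[of n t] by (cases "t \<in> A") auto
      then have "mixed_power p \<bar>h n t - indicator A t\<bar> \<le> mixed_power p 1" using p by (intro mixed_power_mono) auto
      then show "ennreal (mixed_power p (indicator ?Q t * \<bar>h n t - indicator A t\<bar>)) \<le> ennreal (mixed_power p 1) * indicator ?Q t"
        by (cases "t \<in> ?Q") (auto intro: ennreal_leI)
    qed
    show "(\<integral>\<^sup>+ t. ennreal (mixed_power p 1) * indicator ?Q t \<partial>lebesgue) < \<infinity>"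
      unfolding nn_integral_cmult_indicator[OF Q(2)] Qm by simp
    have "AE t in lebesgue. t \<notin> N" using N AE_not_in negligible_iff_null_sets by blast
    then show "AE t in lebesgue. (\<lambda>n. ennreal (mixed_power p (indicator ?Q t * \<bar>h n t - indicator A t\<bar>))) \<longlonglongrightarrow> 0"
    proof eventually_elim
      case (elim t)
      have "(\<lambda>n. h n t) \<longlonglongrightarrow> max 0 (min 1 (indicator A t))"
        unfolding h_def by (rule tendsto_max[OF tendsto_const tendsto_min[OF tendsto_const g(2)[OF elim]]])
      also have "max 0 (min 1 (indicator A t)) = (indicator A t :: real)" by (cases "t \<in> A") auto
      finally have "(\<lambda>n. indicator ?Q t * \<bar>h n t - indicator A t\<bar>) \<longlonglongrightarrow> indicator ?Q t * \<bar>indicator A t - indicator A t\<bar>"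
        by (rule tendsto_mult[OF tendsto_const tendsto_rabs[OF tendsto_diff[OF _ tendsto_const]]])
      then have "(\<lambda>n. indicator ?Q t * \<bar>h n t - indicator A t\<bar>) \<longlonglongrightarrow> 0" by simp
      then have "(\<lambda>n. mixed_power p (indicator ?Q t * \<bar>h n t - indicator A t\<bar>)) \<longlonglongrightarrow> mixed_power p 0"
        using p by (intro continuous_on_tendsto_compose[OF continuous_on_mixed_power]) auto
      then show ?case using tendsto_ennrealI[of _ "mixed_power p 0"] by simp
    qed
  next
    show "(\<lambda>t. ennreal (mixed_power p (indicator ?Q t * \<bar>h n t - indicator A t\<bar>))) \<in> borel_measurable lebesgue" for n
      by (rule measurable_compose[OF borel_measurable_mixed_power[OF hA] measurable_ennreal])
    show "(\<lambda>t. ennreal (mixed_power p 1) * indicator ?Q t) \<in> borel_measurable lebesgue"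
      by (rule borel_measurable_times_ennreal[OF borel_measurable_const borel_measurable_indicator[OF Q(2)]])
  qed simp
  then have "eventually (\<lambda>n. (\<integral>\<^sup>+t. ennreal (mixed_power p (indicator ?Q t * \<bar>h n t - indicator A t\<bar>)) \<partial>lebesgue) < ennreal (\<epsilon> / (4 * c))) sequentially"
    using \<epsilon> c by (intro order_tendstoD) auto
  then obtain n where n: "(\<integral>\<^sup>+t. ennreal (mixed_power p (indicator ?Q t * \<bar>h n t - indicator A t\<bar>)) \<partial>lebesgue) < ennreal (\<epsilon> / (4 * c))"
    by (meson eventually_happens trivial_limit_sequentially)
  define \<delta> where "\<delta> = min 1 (\<epsilon> / (8 * c))"
  have \<delta>: "0 < \<delta>" "\<delta> \<le> 1" using \<epsilon> c by (auto simp: \<delta>_def)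
  have "\<delta> powr p \<le> \<delta> powr 1" using \<delta> p by (intro powr_mono') auto
  moreover have "\<delta> powr 1 = \<delta>" using \<delta> by simp
  moreover have "\<delta> \<le> \<epsilon> / (8 * c)" by (simp add: \<delta>_def)
  moreover have "\<epsilon> / (8 * c) + \<epsilon> / (8 * c) = \<epsilon> / (4 * c)" by simp
  ultimately have m\<delta>: "mixed_power p \<delta> \<le> \<epsilon> / (4 * c)" unfolding mixed_power_def by linarith
  obtain R where R: "real_polynomial_function R" "\<And>x. x \<in> ?Q \<Longrightarrow> \<bar>h n x - R x\<bar> < \<delta>"
    using Stone_Weierstrass_real_polynomial_function[OF Q(3) continuous_on_subset[OF h] \<delta>(1)] by blast
  have "(\<integral>\<^sup>+t. ennreal (mixed_power p (indicator ?Q t * \<bar>R t - indicator A t\<bar>)) \<partial>lebesgue) \<le> ennreal (2 powr p) *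
      ((\<integral>\<^sup>+t. ennreal (mixed_power p (\<delta> * indicator ?Q t)) \<partial>lebesgue) +
       (\<integral>\<^sup>+t. ennreal (mixed_power p (indicator ?Q t * \<bar>h n t - indicator A t\<bar>)) \<partial>lebesgue))"
  proof (rule nn_integral_mixed_power_triangle)
    fix t show "indicator ?Q t * \<bar>R t - indicator A t\<bar> \<le> \<delta> * indicator ?Q t + indicator ?Q t * \<bar>h n t - indicator A t\<bar>"
      using R(2)[of t] by (cases "t \<in> ?Q") auto
  next
    show "(\<lambda>t. \<delta> * indicator ?Q t) \<in> borel_measurable lebesgue"
      by (rule borel_measurable_times[OF borel_measurable_const Qi])
  qed (use p \<delta> hA in simp_all)
  also have "(\<integral>\<^sup>+t. ennreal (mixed_power p (\<delta> * indicator ?Q t)) \<partial>lebesgue) = (\<integral>\<^sup>+t. ennreal (mixed_power p \<delta>) * indicator ?Q t \<partial>lebesgue)"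
    by (intro nn_integral_cong) (auto simp: indicator_def)
  also have "\<dots> = ennreal (mixed_power p \<delta>)" unfolding nn_integral_cmult_indicator[OF Q(2)] Qm by simp
  also have "ennreal (2 powr p) * (ennreal (mixed_power p \<delta>) +
       (\<integral>\<^sup>+t. ennreal (mixed_power p (indicator ?Q t * \<bar>h n t - indicator A t\<bar>)) \<partial>lebesgue))
      \<le> ennreal c * (ennreal (\<epsilon> / (4 * c)) + ennreal (\<epsilon> / (4 * c)))"
    using n m\<delta> unfolding c_def by (intro mult_left_mono add_mono ennreal_leI) auto
  also have "\<dots> = ennreal (c * (\<epsilon> / (4 * c) + \<epsilon> / (4 * c)))"
    by (rule ennreal_mult_add_same) (use c \<epsilon> in auto)
  also have "c * (\<epsilon> / (4 * c) + \<epsilon> / (4 * c)) = \<epsilon> / 2" using c by (simp add: field_simps)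
  also have "\<dots> < ennreal \<epsilon>" using \<epsilon> by (simp add: ennreal_less_iff)
  finally show ?thesis by (rule that[OF R(1)])
qed

text \<open>
  The cutoff is chosen after the polynomial, so that it removes whatever the polynomial does outside
  the cube. All large \<open>k\<close> work, which allows a common \<open>k\<close> for finitely many
  sets.
\<close>

lemma polynomial_cutoff_approx_indicator:
  fixes A :: "(real ^ 'd::finite) set"
  assumes A: "A \<in> sets lebesgue" "A \<subseteq> unit_cube" and p: "1 \<le> p" and \<epsilon>: "0 < \<epsilon>"
  obtains R where "real_polynomial_function R"
    "eventually (\<lambda>k. (\<integral>\<^sup>+t. ennreal (mixed_power p \<bar>R t * cutoff k t - indicator A t\<bar>) \<partial>lebesgue) < ennreal \<epsilon>) sequentially"
proof -
  define c where "c = 2 powr p"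
  have c: "c > 0" by (simp add: c_def)
  obtain R where R: "real_polynomial_function R"
    "(\<integral>\<^sup>+t. ennreal (mixed_power p (indicator unit_cube t * \<bar>R t - indicator A t\<bar>)) \<partial>lebesgue) < ennreal (\<epsilon> / (2 * c))"
    using polynomial_approx_indicator[OF A(1) p, of "\<epsilon> / (2 * c)"] \<epsilon> c by auto
  have Rm: "R \<in> borel_measurable lebesgue"
    using borel_measurable_continuous_onI[OF continuous_on_real_polynomial_function[OF R(1)]]
    by (simp add: measurable_completion)
  have cm: "cutoff k \<in> borel_measurable (lebesgue :: (real ^ 'd) measure)" for k
    by (rule measurable_completion) (simp add: borel_measurable_continuous_onI continuous_on_cutoff)
  let ?Q = "unit_cube :: (real ^ 'd) set"
  have Am: "(indicator A :: _ \<Rightarrow> real) \<in> borel_measurable lebesgue" by (rule borel_measurable_indicator[OF A(1)])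
  have Qi: "(indicator ?Q :: _ \<Rightarrow> real) \<in> borel_measurable lebesgue"
    by (rule borel_measurable_indicator) (simp add: unit_cube_def)
  have m1: "(\<lambda>t. \<bar>R t * cutoff k t - R t * indicator ?Q t\<bar>) \<in> borel_measurable lebesgue" for k
    by (intro borel_measurable_abs borel_measurable_diff borel_measurable_times Rm cm Qi)
  have m2: "(\<lambda>t. indicator ?Q t * \<bar>R t - indicator A t\<bar>) \<in> borel_measurable lebesgue"
    by (intro borel_measurable_abs borel_measurable_diff borel_measurable_times Rm Am Qi)
  have "eventually (\<lambda>k. (\<integral>\<^sup>+t. ennreal (mixed_power p \<bar>R t * cutoff k t - R t * indicator unit_cube t\<bar>) \<partial>lebesgue) < ennreal (\<epsilon> / (2 * c))) sequentially"
    using nn_integral_mixed_power_cutoff_tendsto[OF R(1) p] \<epsilon> c by (intro order_tendstoD) auto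
  then have "eventually (\<lambda>k. (\<integral>\<^sup>+t. ennreal (mixed_power p \<bar>R t * cutoff k t - indicator A t\<bar>) \<partial>lebesgue) < ennreal \<epsilon>) sequentially"
  proof eventually_elim
    case (elim k)
    have "(\<integral>\<^sup>+t. ennreal (mixed_power p \<bar>R t * cutoff k t - indicator A t\<bar>) \<partial>lebesgue) \<le> ennreal (2 powr p) *
      ((\<integral>\<^sup>+t. ennreal (mixed_power p \<bar>R t * cutoff k t - R t * indicator unit_cube t\<bar>) \<partial>lebesgue) +
       (\<integral>\<^sup>+t. ennreal (mixed_power p (indicator unit_cube t * \<bar>R t - indicator A t\<bar>)) \<partial>lebesgue))"
    proof (rule nn_integral_mixed_power_triangle)
      fix t show "\<bar>R t * cutoff k t - indicator A t\<bar> \<le> \<bar>R t * cutoff k t - R t * indicator unit_cube t\<bar> + indicator unit_cube t * \<bar>R t - indicator A t\<bar>"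
        using A(2) by (cases "t \<in> unit_cube") (auto simp: indicator_def)
    qed (use p m1 m2 in simp_all)
    also have "\<dots> < ennreal c * (ennreal (\<epsilon> / (2 * c)) + ennreal (\<epsilon> / (2 * c)))"
      using elim R(2) c unfolding c_def
      by (intro ennreal_mult_strict_left_mono add_strict_mono) auto
    also have "\<dots> = ennreal (c * (\<epsilon> / (2 * c) + \<epsilon> / (2 * c)))"
      by (rule ennreal_mult_add_same) (use c \<epsilon> in auto)
    also have "c * (\<epsilon> / (2 * c) + \<epsilon> / (2 * c)) = \<epsilon>" using c by (simp add: field_simps)
    finally show ?case .
  qed
  then show ?thesis by (rule that[OF R(1)])
qed

lemma mixed_power_sum_le:
  assumes "finite J" "\<And>j. j \<in> J \<Longrightarrow> 0 \<le> x j" "1 \<le> p"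
  shows "mixed_power p (\<Sum>j\<in>J. x j) \<le> (2 powr p) ^ card J * (\<Sum>j\<in>J. mixed_power p (x j))"
  using assms(1,2)
proof (induction J rule: finite_induct)
  case (insert j J)
  have c1: "1 \<le> (2::real) powr p" using assms(3) by (simp add: ge_one_powr_ge_zero)
  have "mixed_power p (x j + sum x J) \<le> 2 powr p * (mixed_power p (x j) + mixed_power p (sum x J))"
    using insert.prems assms(3) by (intro mixed_power_add_le sum_nonneg) auto
  also have "\<dots> \<le> 2 powr p * ((2 powr p) ^ card J * mixed_power p (x j) + (2 powr p) ^ card J * (\<Sum>j\<in>J. mixed_power p (x j)))"
  proof (intro mult_left_mono add_mono)
    have "1 * mixed_power p (x j) \<le> (2 powr p) ^ card J * mixed_power p (x j)"
      using c1 insert.prems by (intro mult_right_mono one_le_power) auto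
    then show "mixed_power p (x j) \<le> (2 powr p) ^ card J * mixed_power p (x j)" by simp
    show "mixed_power p (sum x J) \<le> (2 powr p) ^ card J * (\<Sum>j\<in>J. mixed_power p (x j))"
      using insert by auto
  qed simp
  also have "\<dots> = (2 powr p) ^ card (insert j J) * (\<Sum>j\<in>insert j J. mixed_power p (x j))"
    using insert.hyps by (simp add: distrib_left mult.assoc)
  finally show ?case using insert.hyps by simp
qed simp

lemma borel_measurable_lebesgue_continuous:
  fixes f :: "real ^ 'd::finite \<Rightarrow> 'b::{second_countable_topology, metric_space}"
  shows "continuous_on UNIV f \<Longrightarrow> f \<in> borel_measurable lebesgue"
  by (rule measurable_completion) (simp add: borel_measurable_continuous_onI)

lemma strongly_measurable_polynomial_cutoff:
  fixes R :: "'x::real_normed_vector \<Rightarrow> real ^ 'd::finite \<Rightarrow> real"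
  assumes "\<And>y. y \<in> J \<Longrightarrow> real_polynomial_function (R y)" "finite J"
  shows "strongly_measurable lebesgue (\<lambda>t. \<Sum>y\<in>J. (R y t * cutoff k t) *\<^sub>R y)"
  using assms(2,1)
proof (induction J rule: finite_induct)
  case (insert y J)
  have "(\<lambda>t. R y t * cutoff k t) \<in> borel_measurable lebesgue"
    using insert.prems
    by (intro borel_measurable_lebesgue_continuous continuous_on_mult continuous_on_cutoff
          continuous_on_real_polynomial_function) auto
  then have "strongly_measurable lebesgue (\<lambda>t. (R y t * cutoff k t) *\<^sub>R y)"
    by (rule strongly_measurable_scaleR) (rule strongly_measurable_simple, simp)
  then have "strongly_measurable lebesgue (\<lambda>t. (R y t * cutoff k t) *\<^sub>R y + (\<Sum>y\<in>J. (R y t * cutoff k t) *\<^sub>R y))"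
    by (rule strongly_measurable_add) (use insert in auto)
  then show ?case using insert.hyps by simp
qed (simp add: strongly_measurable_simple)

text \<open>
  A simple function is a finite sum of indicator functions times vectors, and the vectors themselves
  index the sum. Functions vanishing off the cube have such approximants, because the approximating
  simple functions are dominated by \<open>f\<close>.
\<close>

lemma polynomial_cutoff_dense:
  fixes f :: "real ^ 'd::finite \<Rightarrow> 'x::real_normed_vector"
  assumes f: "strongly_measurable lebesgue f" and off: "\<And>t. t \<notin> unit_cube \<Longrightarrow> f t = 0"
    and p: "1 \<le> p" and fin: "(\<integral>\<^sup>+t. ennreal (mixed_power p (3 * norm (f t))) \<partial>lebesgue) < \<infinity>"
    and \<epsilon>: "0 < \<epsilon>"
  obtains J R k where "finite J" "\<And>y. y \<in> J \<Longrightarrow> real_polynomial_function (R y)" "1 \<le> k"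
    "(\<integral>\<^sup>+t. ennreal (mixed_power p (norm (f t - (\<Sum>y\<in>J. (R y t * cutoff k t) *\<^sub>R y)))) \<partial>lebesgue) < ennreal \<epsilon>"
proof -
  define c where "c = 2 powr p"
  have c: "c > 0" by (simp add: c_def)
  have lc: "complete_measure (lebesgue :: (real ^ 'd) measure)" by (rule completion.complete_measure_axioms)
  have p0: "0 < p" using p by simp
  obtain s where s: "\<And>i::nat. simple_function lebesgue (s i)" "AE t in lebesgue. (\<lambda>i. s i t) \<longlonglongrightarrow> f t"
    "\<And>i t. norm (s i t) \<le> 2 * norm (f t)"
    using strongly_measurable_dominated_approx[OF lc f] by blast
  have "(\<lambda>i. \<integral>\<^sup>+t. ennreal (mixed_power p (norm (f t - s i t))) \<partial>lebesgue) \<longlonglongrightarrow> 0"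
    using p by (intro nn_integral_dominated_approx_0[OF lc f s continuous_on_mixed_power[OF p0] _ _ fin])
      (auto simp: mono_on_def intro: mixed_power_mono)
  then have "eventually (\<lambda>i. (\<integral>\<^sup>+t. ennreal (mixed_power p (norm (f t - s i t))) \<partial>lebesgue) < ennreal (\<epsilon> / (2 * c))) sequentially"
    using \<epsilon> c by (intro order_tendstoD) auto
  then obtain i where i: "(\<integral>\<^sup>+t. ennreal (mixed_power p (norm (f t - s i t))) \<partial>lebesgue) < ennreal (\<epsilon> / (2 * c))"
    by (meson eventually_happens trivial_limit_sequentially)
  define J where "J = range (s i) - {0}"
  have J: "finite J" using simple_functionD(1)[OF s(1)[of i]] by (simp add: J_def)
  define A where "A y = s i -` {y}" for y
  have Am: "A y \<in> sets lebesgue" for y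
    using simple_functionD(2)[OF s(1)[of i], of "{y}"] by (simp add: A_def)
  have AQ: "A y \<subseteq> unit_cube" if "y \<in> J" for y
  proof
    fix t assume "t \<in> A y"
    then have "s i t \<noteq> 0" using that by (auto simp: A_def J_def)
    then have "f t \<noteq> 0" using s(3)[of i t] by auto
    then show "t \<in> unit_cube" using off by blast
  qed
  have s_eq: "s i t = (\<Sum>y\<in>J. indicator (A y) t *\<^sub>R y)" for t
  proof -
    have "(\<Sum>y\<in>J. indicator (A y) t *\<^sub>R y) = (\<Sum>y\<in>J. if y = s i t then s i t else 0)"
      by (intro sum.cong) (auto simp: A_def indicator_def)
    also have "\<dots> = s i t" using J by (auto simp: sum.delta' J_def)
    finally show ?thesis ..
  qed
  \<comment> \<open>Each indicator function must be approximated so well that the errors, weighted by the norms of the vectors, add up to less than \<open>\<epsilon>\<close>.\<close>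
  define D where "D = c ^ card J * (\<Sum>y\<in>J. (1 + norm y) powr p) + 1"
  have D: "D > 0" unfolding D_def using c by (intro add_nonneg_pos mult_nonneg_nonneg sum_nonneg) auto
  define \<eta> where "\<eta> = \<epsilon> / (2 * c) / D"
  have \<eta>: "\<eta> > 0" using \<epsilon> c D by (simp add: \<eta>_def)
  have "\<forall>y\<in>J. \<exists>R. real_polynomial_function R \<and>
    eventually (\<lambda>k. (\<integral>\<^sup>+t. ennreal (mixed_power p \<bar>R t * cutoff k t - indicator (A y) t\<bar>) \<partial>lebesgue) < ennreal \<eta>) sequentially"
  proof
    fix y assume y: "y \<in> J"
    show "\<exists>R. real_polynomial_function R \<and>
      eventually (\<lambda>k. (\<integral>\<^sup>+t. ennreal (mixed_power p \<bar>R t * cutoff k t - indicator (A y) t\<bar>) \<partial>lebesgue) < ennreal \<eta>) sequentially"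
      by (rule polynomial_cutoff_approx_indicator[OF Am AQ[OF y] p \<eta>]) blast
  qed
  from bchoice[OF this] obtain R where R': "\<forall>y\<in>J. real_polynomial_function (R y) \<and>
    eventually (\<lambda>k. (\<integral>\<^sup>+t. ennreal (mixed_power p \<bar>R y t * cutoff k t - indicator (A y) t\<bar>) \<partial>lebesgue) < ennreal \<eta>) sequentially"
    ..
  have R: "real_polynomial_function (R y)"
    "eventually (\<lambda>k. (\<integral>\<^sup>+t. ennreal (mixed_power p \<bar>R y t * cutoff k t - indicator (A y) t\<bar>) \<partial>lebesgue) < ennreal \<eta>) sequentially"
    if "y \<in> J" for y
    by (rule conjunct1[OF bspec[OF R' that]], rule conjunct2[OF bspec[OF R' that]])
  have "eventually (\<lambda>k. \<forall>y\<in>J. (\<integral>\<^sup>+t. ennreal (mixed_power p \<bar>R y t * cutoff k t - indicator (A y) t\<bar>) \<partial>lebesgue) < ennreal \<eta>) sequentially"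
    by (rule eventually_ball_finite[OF J]) (intro ballI R(2))
  then have "eventually (\<lambda>k. (\<forall>y\<in>J. (\<integral>\<^sup>+t. ennreal (mixed_power p \<bar>R y t * cutoff k t - indicator (A y) t\<bar>) \<partial>lebesgue) < ennreal \<eta>) \<and> 1 \<le> k) sequentially"
    by (rule eventually_conj[OF _ eventually_ge_at_top])
  from eventually_happens'[OF trivial_limit_sequentially this] obtain k where k: "1 \<le> k"
    "\<And>y. y \<in> J \<Longrightarrow> (\<integral>\<^sup>+t. ennreal (mixed_power p \<bar>R y t * cutoff k t - indicator (A y) t\<bar>) \<partial>lebesgue) < ennreal \<eta>"
    by blast
  define u where "u t = (\<Sum>y\<in>J. (R y t * cutoff k t) *\<^sub>R y)" for t
  have um: "strongly_measurable lebesgue u"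
    unfolding u_def by (rule strongly_measurable_polynomial_cutoff[OF R(1) J])
  let ?e = "\<lambda>y t. \<bar>R y t * cutoff k t - indicator (A y) t\<bar>"
  have em: "?e y \<in> borel_measurable lebesgue" if "y \<in> J" for y
    using that R(1)
    by (intro borel_measurable_abs borel_measurable_diff borel_measurable_times borel_measurable_indicator Am
        borel_measurable_lebesgue_continuous continuous_on_cutoff continuous_on_real_polynomial_function)
  have "(\<integral>\<^sup>+t. ennreal (mixed_power p (norm (s i t - u t))) \<partial>lebesgue) \<le>
      (\<integral>\<^sup>+t. (\<Sum>y\<in>J. ennreal (c ^ card J * (1 + norm y) powr p) * ennreal (mixed_power p (?e y t))) \<partial>lebesgue)"
  proof (intro nn_integral_mono)
    fix t
    have "norm (s i t - u t) = norm (\<Sum>y\<in>J. (indicator (A y) t - R y t * cutoff k t) *\<^sub>R y)"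
      unfolding s_eq u_def by (simp only: sum_subtractf scaleR_diff_left)
    also have "\<dots> \<le> (\<Sum>y\<in>J. norm y * ?e y t)"
    proof (rule order_trans[OF norm_sum], rule sum_mono)
      fix y
      show "norm ((indicator (A y) t - R y t * cutoff k t) *\<^sub>R y) \<le> norm y * ?e y t"
        unfolding norm_scaleR real_norm_def by (simp only: abs_minus_commute mult.commute)
    qed
    finally have "mixed_power p (norm (s i t - u t)) \<le> mixed_power p (\<Sum>y\<in>J. norm y * ?e y t)"
      using p by (intro mixed_power_mono) auto
    also have "\<dots> \<le> c ^ card J * (\<Sum>y\<in>J. mixed_power p (norm y * ?e y t))"
      unfolding c_def using p by (intro mixed_power_sum_le J) auto
    also have "\<dots> \<le> c ^ card J * (\<Sum>y\<in>J. (1 + norm y) powr p * mixed_power p (?e y t))"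
      using c p by (intro mult_left_mono sum_mono mixed_power_mult_le) auto
    also have "\<dots> = (\<Sum>y\<in>J. (c ^ card J * (1 + norm y) powr p) * mixed_power p (?e y t))"
      by (simp add: sum_distrib_left mult.assoc)
    finally have "ennreal (mixed_power p (norm (s i t - u t))) \<le> ennreal (\<Sum>y\<in>J. (c ^ card J * (1 + norm y) powr p) * mixed_power p (?e y t))"
      by (rule ennreal_leI)
    also have "\<dots> = (\<Sum>y\<in>J. ennreal ((c ^ card J * (1 + norm y) powr p) * mixed_power p (?e y t)))"
      using c by (intro sum_ennreal[symmetric]) auto
    also have "\<dots> = (\<Sum>y\<in>J. ennreal (c ^ card J * (1 + norm y) powr p) * ennreal (mixed_power p (?e y t)))"
      using c by (intro sum.cong ennreal_mult) auto
    finally show "ennreal (mixed_power p (norm (s i t - u t))) \<le> \<dots>" .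
  qed
  also have "\<dots> = (\<Sum>y\<in>J. ennreal (c ^ card J * (1 + norm y) powr p) * (\<integral>\<^sup>+t. ennreal (mixed_power p (?e y t)) \<partial>lebesgue))"
  proof -
    have m: "(\<lambda>t. ennreal (mixed_power p (?e y t))) \<in> borel_measurable lebesgue" if "y \<in> J" for y
      by (rule measurable_compose[OF borel_measurable_mixed_power[OF em[OF that]] measurable_ennreal])
    show ?thesis
      by (subst nn_integral_sum[OF borel_measurable_times_ennreal[OF borel_measurable_const m]])
        (auto intro: sum.cong[OF refl nn_integral_cmult[OF m]])
  qed
  also have "\<dots> \<le> (\<Sum>y\<in>J. ennreal (c ^ card J * (1 + norm y) powr p) * ennreal \<eta>)"
    by (intro sum_mono mult_left_mono less_imp_le[OF k(2)]) auto
  also have "\<dots> = (\<Sum>y\<in>J. ennreal (c ^ card J * (1 + norm y) powr p * \<eta>))"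
    using c \<eta> by (intro sum.cong ennreal_mult[symmetric]) auto
  also have "\<dots> = ennreal (\<Sum>y\<in>J. c ^ card J * (1 + norm y) powr p * \<eta>)"
    using c \<eta> by (intro sum_ennreal) auto
  also have "(\<Sum>y\<in>J. c ^ card J * (1 + norm y) powr p * \<eta>) = (D - 1) * \<eta>"
    by (simp add: D_def sum_distrib_left sum_distrib_right)
  also have "ennreal ((D - 1) * \<eta>) < ennreal (\<epsilon> / (2 * c))"
  proof (rule ennreal_lessI)
    have "(D - 1) * \<eta> < D * \<eta>" using \<eta> by (intro mult_strict_right_mono) auto
    also have "\<dots> = \<epsilon> / (2 * c)" using D by (simp add: \<eta>_def)
    finally show "(D - 1) * \<eta> < \<epsilon> / (2 * c)" .
  qed (use \<epsilon> c in simp)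
  finally have su: "(\<integral>\<^sup>+t. ennreal (mixed_power p (norm (s i t - u t))) \<partial>lebesgue) < ennreal (\<epsilon> / (2 * c))" .
  have "(\<integral>\<^sup>+t. ennreal (mixed_power p (norm (f t - u t))) \<partial>lebesgue) \<le> ennreal (2 powr p) *
    ((\<integral>\<^sup>+t. ennreal (mixed_power p (norm (f t - s i t))) \<partial>lebesgue) + (\<integral>\<^sup>+t. ennreal (mixed_power p (norm (s i t - u t))) \<partial>lebesgue))"
  proof (rule nn_integral_mixed_power_triangle)
    show "(\<lambda>t. norm (f t - s i t)) \<in> borel_measurable lebesgue"
      by (rule strongly_measurable_norm_diff[OF lc f strongly_measurable_simple[OF s(1)]])
    show "(\<lambda>t. norm (s i t - u t)) \<in> borel_measurable lebesgue"
      by (rule strongly_measurable_norm_diff[OF lc strongly_measurable_simple[OF s(1)] um])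
    show "norm (f t - u t) \<le> norm (f t - s i t) + norm (s i t - u t)" for t
      using norm_triangle_ineq[of "f t - s i t" "s i t - u t"] by simp
  qed (use p in auto)
  also have "\<dots> < ennreal c * (ennreal (\<epsilon> / (2 * c)) + ennreal (\<epsilon> / (2 * c)))"
    using i su c unfolding c_def[symmetric]
    by (intro ennreal_mult_strict_left_mono add_strict_mono) auto
  also have "\<dots> = ennreal (c * (\<epsilon> / (2 * c) + \<epsilon> / (2 * c)))"
    by (rule ennreal_mult_add_same) (use c \<epsilon> in auto)
  also have "c * (\<epsilon> / (2 * c) + \<epsilon> / (2 * c)) = \<epsilon>" using c by (simp add: field_simps)
  finally show ?thesis using that[OF J R(1) k(1)] by (simp add: u_def)
qed

lemma real_polynomial_function_has_derivative:
  fixes R :: "'a::real_normed_vector \<Rightarrow> real"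
  assumes "real_polynomial_function R"
  shows "\<exists>D. (\<forall>t. (R has_derivative D t) (at t)) \<and> (\<forall>v. real_polynomial_function (\<lambda>t. D t v))"
  using assms
proof induction
  case (linear f)
  then show ?case
    by (intro exI[of _ "\<lambda>_. f"]) (auto intro: bounded_linear_imp_has_derivative)
next
  case (const c)
  show ?case by (intro exI[of _ "\<lambda>_ _. 0"]) auto
next
  case (add f g)
  then obtain D E where "\<And>t. (f has_derivative D t) (at t)" "\<And>v. real_polynomial_function (\<lambda>t. D t v)"
    "\<And>t. (g has_derivative E t) (at t)" "\<And>v. real_polynomial_function (\<lambda>t. E t v)" by metis
  then show ?case by (intro exI[of _ "\<lambda>t v. D t v + E t v"]) (auto intro: has_derivative_add)
next
  case (mult f g)
  then obtain D E where "\<And>t. (f has_derivative D t) (at t)" "\<And>v. real_polynomial_function (\<lambda>t. D t v)"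
    "\<And>t. (g has_derivative E t) (at t)" "\<And>v. real_polynomial_function (\<lambda>t. E t v)" by metis
  then show ?case using mult.hyps
    by (intro exI[of _ "\<lambda>t v. f t * E t v + D t v * g t"])
      (auto intro: has_derivative_mult intro!: real_polynomial_function.intros(3,4))
qed

text \<open>
  The logarithm of the cutoff is a polynomial, so differentiation reproduces the cutoff times a
  polynomial.
\<close>

lemma polynomial_cutoff_has_derivative:
  fixes R :: "real ^ 'd::finite \<Rightarrow> real"
  assumes "real_polynomial_function R"
  obtains D where "\<And>t. ((\<lambda>t. R t * cutoff k t) has_derivative (\<lambda>v. D v t * cutoff k t)) (at t)"
    "\<And>v. real_polynomial_function (D v)"
proof -
  obtain E where E: "\<And>t. (R has_derivative E t) (at t)" "\<And>v. real_polynomial_function (\<lambda>t. E t v)"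
    using real_polynomial_function_has_derivative[OF assms] by blast
  define \<phi> where "\<phi> = (\<lambda>t::real^'d. - (\<Sum>i\<in>UNIV. (2 * t $ i) ^ (2 * k)))"
  have "real_polynomial_function \<phi>"
    unfolding \<phi>_def
    by (intro real_polynomial_function_minus real_polynomial_function_sum real_polynomial_function_power
        real_polynomial_function.intros(4,2) real_polynomial_function.intros(1)
        bounded_linear_vec_nth) auto
  then obtain F where F: "\<And>t. (\<phi> has_derivative F t) (at t)" "\<And>v. real_polynomial_function (\<lambda>t. F t v)"
    using real_polynomial_function_has_derivative by blast
  have c: "cutoff k = (\<lambda>t. exp (\<phi> t))" by (simp add: cutoff_def \<phi>_def fun_eq_iff)
  have "((\<lambda>t. R t * cutoff k t) has_derivative (\<lambda>v. (R t * F t v + E t v) * cutoff k t)) (at t)" for t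
    unfolding c using E(1) F(1)
    by (auto intro!: derivative_eq_intros simp: fun_eq_iff algebra_simps)
  moreover have "real_polynomial_function (\<lambda>t. R t * F t v + E t v)" for v
    using assms E F by (intro real_polynomial_function.intros(3,4)) auto
  ultimately show ?thesis using that[of "\<lambda>v t. R t * F t v + E t v"] by blast
qed

text \<open>
  By induction on the list of directions, every iterated partial derivative is a function of the same
  form; such functions are differentiable and decay exponentially.
\<close>

lemma schwartz_polynomial_cutoff:
  fixes R :: "'x::real_normed_vector \<Rightarrow> real ^ 'd::finite \<Rightarrow> real"
  assumes J: "finite J" and R: "\<And>y. y \<in> J \<Longrightarrow> real_polynomial_function (R y)" and k: "1 \<le> k"
  shows "schwartz (\<lambda>t. \<Sum>y\<in>J. (R y t * cutoff k t) *\<^sub>R y)"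
proof -
  let ?u = "\<lambda>R t. \<Sum>y\<in>J. (R y t * cutoff k t) *\<^sub>R y"
  have step: "\<exists>D. (\<forall>t. (?u S has_derivative (\<lambda>v. ?u (D v) t)) (at t)) \<and> (\<forall>v. \<forall>y\<in>J. real_polynomial_function (D v y))"
    if S: "\<forall>y\<in>J. real_polynomial_function (S y)" for S :: "'x \<Rightarrow> real ^ 'd \<Rightarrow> real"
  proof -
    have "\<forall>y\<in>J. \<exists>D. (\<forall>t. ((\<lambda>t. S y t * cutoff k t) has_derivative (\<lambda>v. D v t * cutoff k t)) (at t)) \<and>
        (\<forall>v. real_polynomial_function (D v))"
      using S polynomial_cutoff_has_derivative by metis
    then obtain D where D: "\<And>y t. y \<in> J \<Longrightarrow> ((\<lambda>t. S y t * cutoff k t) has_derivative (\<lambda>v. D y v t * cutoff k t)) (at t)"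
        "\<And>y v. y \<in> J \<Longrightarrow> real_polynomial_function (D y v)"
      by metis
    have "(?u S has_derivative (\<lambda>v. ?u (\<lambda>y. D y v) t)) (at t)" for t
      by (intro has_derivative_sum has_derivative_scaleR_left D)
    then show ?thesis using D(2) by (intro exI[of _ "\<lambda>v y. D y v"]) auto
  qed
  have ex: "\<exists>S. (\<forall>y\<in>J. real_polynomial_function (S y)) \<and> partial_deriv is (?u R) = ?u S" for "is"
  proof (induction "is")
    case Nil
    then show ?case using R by auto
  next
    case (Cons i "is")
    then obtain S where S: "\<forall>y\<in>J. real_polynomial_function (S y)" "partial_deriv is (?u R) = ?u S" by blast
    obtain D where D: "\<And>t. (?u S has_derivative (\<lambda>v. ?u (D v) t)) (at t)" "\<And>v y. y \<in> J \<Longrightarrow> real_polynomial_function (D v y)"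
      using step[OF S(1)] by blast
    have "frechet_derivative (?u S) (at t) = (\<lambda>v. ?u (D v) t)" for t
      by (rule frechet_derivative_at[symmetric, OF D(1)])
    then have "partial_deriv (i # is) (?u R) = ?u (D (axis i 1))" by (simp add: S(2))
    then show ?case using D(2) by blast
  qed
  have bnd: "\<exists>B. \<forall>t. norm t ^ n * norm (?u S t) \<le> B" if S: "\<forall>y\<in>J. real_polynomial_function (S y)" for S n
  proof -
    have "\<forall>y\<in>J. \<exists>B. 0 \<le> B \<and> (\<forall>t. \<bar>S y t * cutoff k t\<bar> \<le> B * exp (- norm t))"
      using S polynomial_cutoff_bound k by metis
    then obtain B where B: "\<And>y. y \<in> J \<Longrightarrow> 0 \<le> B y" "\<And>y t. y \<in> J \<Longrightarrow> \<bar>S y t * cutoff k t\<bar> \<le> B y * exp (- norm t)"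
      by metis
    have "norm t ^ n * norm (?u S t) \<le> fact n * (\<Sum>y\<in>J. B y * norm y)" for t
    proof -
      have "norm (?u S t) \<le> (\<Sum>y\<in>J. norm ((S y t * cutoff k t) *\<^sub>R y))" by (rule norm_sum)
      also have "\<dots> \<le> (\<Sum>y\<in>J. B y * exp (- norm t) * norm y)"
        unfolding norm_scaleR by (intro sum_mono mult_right_mono B) auto
      also have "\<dots> = exp (- norm t) * (\<Sum>y\<in>J. B y * norm y)" by (simp add: sum_distrib_left mult_ac)
      finally have "norm t ^ n * norm (?u S t) \<le> (fact n * exp (norm t)) * (exp (- norm t) * (\<Sum>y\<in>J. B y * norm y))"
        by (intro mult_mono power_le_fact_mult_exp) auto
      also have "\<dots> = fact n * (\<Sum>y\<in>J. B y * norm y)" by (simp add: exp_minus field_simps)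
      finally show ?thesis .
    qed
    then show ?thesis by blast
  qed
  show ?thesis unfolding schwartz_def
  proof (intro conjI allI)
    fix "is" t
    obtain S where S: "\<forall>y\<in>J. real_polynomial_function (S y)" "partial_deriv is (?u R) = ?u S" using ex by blast
    show "partial_deriv is (?u R) differentiable (at t)"
      using step[OF S(1)] unfolding S(2) differentiable_def by blast
  next
    fix "is" and n :: nat
    obtain S where S: "\<forall>y\<in>J. real_polynomial_function (S y)" "partial_deriv is (?u R) = ?u S" using ex by blast
    show "\<exists>B. \<forall>t. norm t ^ n * norm (partial_deriv is (?u R) t) \<le> B" unfolding S(2) by (rule bnd[OF S(1)])
  qed
qed

section \<open>From Euclidean space to Fourier coefficients\<close>

lemma epow_le_iff:
  assumes "0 < a" "0 \<le> c"
  shows "epow x a \<le> ennreal c \<longleftrightarrow> x \<le> ennreal (c powr (1 / a))"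
proof (cases x)
  case (real r)
  have "r powr a \<le> c \<longleftrightarrow> r \<le> c powr (1 / a)"
  proof
    assume "r powr a \<le> c"
    then have "(r powr a) powr (1 / a) \<le> c powr (1 / a)" using assms by (intro powr_mono2) auto
    then show "r \<le> c powr (1 / a)" using assms real by (simp add: powr_powr)
  next
    assume "r \<le> c powr (1 / a)"
    then have "r powr a \<le> (c powr (1 / a)) powr a" using assms real by (intro powr_mono2) auto
    then show "r powr a \<le> c" using assms by (simp add: powr_powr)
  qed
  then show ?thesis using real assms by (simp add: epow_def)
next
  case top
  then show ?thesis by (simp add: epow_def top_unique)
qed

lemma epow_mono: "x \<le> y \<Longrightarrow> 0 < a \<Longrightarrow> epow x a \<le> epow y a"
  by (cases x; cases y) (auto simp: epow_def top_unique intro!: ennreal_leI powr_mono2)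

lemma epow_ennreal: "0 \<le> r \<Longrightarrow> epow (ennreal r) a = ennreal (r powr a)"
  by (simp add: epow_def)

lemma strongly_measurable_lebesgue_on:
  fixes f :: "'a::euclidean_space \<Rightarrow> 'b::real_normed_vector"
  assumes S: "S \<in> sets lebesgue" and f: "strongly_measurable (lebesgue_on S) f"
  shows "strongly_measurable lebesgue (\<lambda>t. indicator S t *\<^sub>R f t)"
proof -
  have S': "S \<inter> space lebesgue \<in> sets lebesgue" using S by simp
  obtain r where r: "\<And>i::nat. simple_function (lebesgue_on S) (r i)" "AE t in lebesgue_on S. (\<lambda>i. r i t) \<longlonglongrightarrow> f t"
    using f by (auto simp: strongly_measurable_def)
  have "AE t in lebesgue. (\<lambda>i. indicator S t *\<^sub>R r i t) \<longlonglongrightarrow> indicator S t *\<^sub>R f t"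
    using r(2) unfolding AE_restrict_space_iff[OF S']
  proof eventually_elim
    case (elim t)
    then show ?case by (cases "t \<in> S") auto
  qed
  then show ?thesis
    unfolding strongly_measurable_def
    by (intro exI[of _ "\<lambda>i t. indicator S t *\<^sub>R r i t"] conjI allI)
       (use r(1) simple_function_restrict_space[OF S'] in auto)
qed

text \<open>
  Extension by zero, which puts integrals over the torus and integrals over the whole space on the
  same footing.
\<close>

lemma has_Bochner_integral_lebesgue_on:
  fixes f :: "'a::euclidean_space \<Rightarrow> 'b::real_normed_vector"
  assumes S: "S \<in> sets lebesgue" and f: "has_Bochner_integral (lebesgue_on S) f I"
  shows "has_Bochner_integral lebesgue (\<lambda>t. indicator S t *\<^sub>R f t) I"
proof -
  have S': "S \<inter> space lebesgue \<in> sets lebesgue" using S by simp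
  obtain s where s: "\<And>i::nat. Bochner_Integration.simple_bochner_integrable (lebesgue_on S) (s i)"
    "(\<lambda>i. \<integral>\<^sup>+t. ennreal (norm (f t - s i t)) \<partial>lebesgue_on S) \<longlonglongrightarrow> 0"
    "(\<lambda>i. Bochner_Integration.simple_bochner_integral (lebesgue_on S) (s i)) \<longlonglongrightarrow> I"
    using f by (auto simp: has_Bochner_integral_def)
  have "strongly_measurable lebesgue (\<lambda>t. indicator S t *\<^sub>R f t)"
    by (rule strongly_measurable_lebesgue_on[OF S]) (use f in \<open>simp add: has_Bochner_integral_def\<close>)
  moreover have "(\<integral>\<^sup>+t. ennreal (norm (f t - s i t)) \<partial>lebesgue_on S) =
      (\<integral>\<^sup>+t. ennreal (norm (indicator S t *\<^sub>R f t - indicator S t *\<^sub>R s i t)) \<partial>lebesgue)" for i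
    unfolding nn_integral_restrict_space[OF S']
    by (intro nn_integral_cong) (auto simp: indicator_def)
  moreover have "(\<lambda>i. Bochner_Integration.simple_bochner_integral lebesgue (\<lambda>t. indicator S t *\<^sub>R s i t)) =
      (\<lambda>i. Bochner_Integration.simple_bochner_integral (lebesgue_on S) (s i))"
    using simple_bochner_integral_restrict_space[OF S' s(1)] by simp
  ultimately show ?thesis
    unfolding has_Bochner_integral_def
    using s simple_bochner_integrable_restrict_space[OF S']
    by (intro conjI exI[of _ "\<lambda>i t. indicator S t *\<^sub>R s i t"]) auto
qed

text \<open>
  The Fourier transform of a finite sum of scalar functions times vectors is the sum of these scalar
  transforms times the vectors.
\<close>

definition scalar_fourier :: "(real ^ 'd::finite \<Rightarrow> real) \<Rightarrow> real ^ 'd \<Rightarrow> complex" where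
  "scalar_fourier w \<xi> = (\<integral>t. cis (- 2 * pi * (t \<bullet> \<xi>)) * of_real (w t) \<partial>lborel)"

lemma continuous_on_cis_compose: "continuous_on S f \<Longrightarrow> continuous_on S (\<lambda>x. cis (f x))"
  unfolding cis_conv_exp by (intro continuous_intros)

lemma borel_measurable_cis_inner:
  "(\<lambda>t. cis (- 2 * pi * (t \<bullet> \<xi>))) \<in> borel_measurable (borel :: (real ^ 'd::finite) measure)"
  by (intro borel_measurable_continuous_onI continuous_on_cis_compose continuous_intros)

lemma integrable_cis_mult:
  fixes w :: "real ^ 'd::finite \<Rightarrow> real"
  assumes w: "integrable lborel w"
  shows "integrable lborel (\<lambda>t. cis (- 2 * pi * (t \<bullet> \<xi>)) * of_real (w t))"
proof (rule Bochner_Integration.integrable_bound[OF w])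
  have "w \<in> borel_measurable lborel" using w by (rule borel_measurable_integrable)
  then show "(\<lambda>t. cis (- 2 * pi * (t \<bullet> \<xi>)) * of_real (w t)) \<in> borel_measurable lborel"
    using borel_measurable_cis_inner by (intro borel_measurable_times borel_measurable_of_real) auto
qed (simp add: norm_mult)

lemma continuous_on_scalar_fourier:
  fixes w :: "real ^ 'd::finite \<Rightarrow> real"
  assumes w: "integrable lborel w"
  shows "continuous_on UNIV (scalar_fourier w)"
proof -
  have "continuous (at \<xi>) (scalar_fourier w)" for \<xi>
  proof (rule continuous_at_sequentiallyI)
    fix u :: "nat \<Rightarrow> real ^ 'd" assume u: "u \<longlonglongrightarrow> \<xi>"
    show "(\<lambda>n. scalar_fourier w (u n)) \<longlonglongrightarrow> scalar_fourier w \<xi>"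
      unfolding scalar_fourier_def
    proof (rule integral_dominated_convergence[where w = "\<lambda>t. norm (w t)"])
      show "AE t in lborel. (\<lambda>n. cis (- 2 * pi * (t \<bullet> u n)) * complex_of_real (w t)) \<longlonglongrightarrow> cis (- 2 * pi * (t \<bullet> \<xi>)) * complex_of_real (w t)"
        unfolding cis_conv_exp by (intro AE_I2 tendsto_intros u)
      show "AE t in lborel. norm (cis (- 2 * pi * (t \<bullet> u n)) * complex_of_real (w t)) \<le> norm (w t)" for n
        by (simp add: norm_mult)
    qed (use w integrable_cis_mult[OF w] in auto)
  qed
  then show ?thesis by (simp add: continuous_on_eq_continuous_at)
qed

text \<open>
  The side is chosen such that \<open>2 \<pi> t \<bullet> \<eta>\<close> stays within
  \<open>\<pi>/3\<close> of \<open>0\<close> for \<open>t\<close> in the unit cube, and such that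
  integer translates are disjoint.
\<close>

definition small_cube :: "(real ^ 'd::finite) set" where
  "small_cube = cbox (\<chi> i. - (1 / (3 * real CARD('d)))) (\<chi> i. 1 / (3 * real CARD('d)))"

definition small_cube_transform :: "real ^ 'd::finite \<Rightarrow> complex" where
  "small_cube_transform t = (\<integral>\<eta>. indicator small_cube \<eta> *\<^sub>R cis (- 2 * pi * (t \<bullet> \<eta>)) \<partial>lborel)"

lemma small_cube_inner_le:
  fixes t \<eta> :: "real ^ 'd::finite"
  assumes "t \<in> unit_cube" "\<eta> \<in> small_cube"
  shows "\<bar>t \<bullet> \<eta>\<bar> \<le> 1/6"
proof -
  let ?d = "real CARD('d)"
  have "\<bar>t \<bullet> \<eta>\<bar> \<le> (\<Sum>i\<in>UNIV. \<bar>t $ i\<bar> * \<bar>\<eta> $ i\<bar>)"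
    unfolding inner_vec_def by (rule order_trans[OF sum_abs]) (simp add: abs_mult)
  also have "\<dots> \<le> (\<Sum>i\<in>(UNIV::'d set). 1/2 * (1 / (3 * ?d)))"
  proof (intro sum_mono mult_mono)
    fix i
    have "- (1/2) \<le> t $ i" "t $ i \<le> 1/2" using assms(1) by (auto simp: unit_cube_def mem_box_cart)
    then show "\<bar>t $ i\<bar> \<le> 1/2" by linarith
    have "- (1 / (3 * ?d)) \<le> \<eta> $ i" "\<eta> $ i \<le> 1 / (3 * ?d)" using assms(2) by (auto simp: small_cube_def mem_box_cart)
    then show "\<bar>\<eta> $ i\<bar> \<le> 1 / (3 * ?d)" by linarith
  qed auto
  also have "\<dots> = 1/6" by simp
  finally show ?thesis .
qed

lemma small_cube_measure:
  "emeasure lborel (small_cube :: (real ^ 'd::finite) set) < \<infinity>"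
  "0 < measure lborel (small_cube :: (real ^ 'd) set)"
proof -
  show "emeasure lborel (small_cube :: (real ^ 'd) set) < \<infinity>"
    unfolding small_cube_def by (rule emeasure_lborel_cbox_finite)
  have "measure lborel (small_cube :: (real ^ 'd) set) = (\<Prod>i\<in>(UNIV::'d set). 2 / (3 * real CARD('d)))"
    unfolding small_cube_def by (subst content_cbox_cart) (auto simp: interval_eq_empty_cart not_less)
  also have "\<dots> > 0" by (intro prod_pos) auto
  finally show "0 < measure lborel (small_cube :: (real ^ 'd) set)" .
qed

lemma small_cube_sets: "small_cube \<in> sets borel" "compact small_cube"
  by (auto simp: small_cube_def)

lemma integrable_small_cube_cis:
  "integrable lborel (\<lambda>\<eta>. indicator small_cube \<eta> *\<^sub>R cis (- 2 * pi * (t \<bullet> \<eta>)))"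
  by (intro borel_integrable_compact small_cube_sets continuous_on_cis_compose continuous_intros)

lemma integral_indicator_small_cube:
  "integrable lborel (indicator (small_cube :: (real ^ 'd::finite) set) :: _ \<Rightarrow> real)"
  "(\<integral>\<eta>. indicator (small_cube :: (real ^ 'd::finite) set) \<eta> \<partial>lborel) = measure lborel (small_cube :: (real ^ 'd) set)"
  using small_cube_measure(1) small_cube_sets(1) by auto

lemma norm_small_cube_transform_le:
  fixes t :: "real ^ 'd::finite"
  shows "norm (small_cube_transform t) \<le> measure lborel (small_cube :: (real ^ 'd) set)"
proof -
  have "norm (small_cube_transform t) \<le> (\<integral>\<eta>. norm (indicator (small_cube :: (real ^ 'd) set) \<eta> *\<^sub>R cis (- 2 * pi * (t \<bullet> \<eta>))) \<partial>lborel)"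
    unfolding small_cube_transform_def by (rule integral_norm_bound)
  also have "\<dots> = measure lborel (small_cube :: (real ^ 'd) set)"
    unfolding integral_indicator_small_cube(2)[symmetric]
    by (intro Bochner_Integration.integral_cong) auto
  finally show ?thesis .
qed

text \<open>
  On the relevant range the cosine is at least \<open>1/2\<close>. So the transform of the small cube
  may be divided by on the unit cube.
\<close>

lemma Re_small_cube_transform_ge:
  fixes t :: "real ^ 'd::finite"
  assumes "t \<in> unit_cube"
  shows "measure lborel (small_cube :: (real ^ 'd) set) / 2 \<le> Re (small_cube_transform t)"
proof -
  have "Re (small_cube_transform t) = (\<integral>\<eta>. Re (indicator (small_cube :: (real ^ 'd) set) \<eta> *\<^sub>R cis (- 2 * pi * (t \<bullet> \<eta>))) \<partial>lborel)"
    unfolding small_cube_transform_def by (rule integral_Re[OF integrable_small_cube_cis, symmetric])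
  moreover have "(\<integral>\<eta>. indicator (small_cube :: (real ^ 'd) set) \<eta> * (1/2) \<partial>lborel) \<le> \<dots>"
  proof (rule integral_mono)
    show "integrable lborel (\<lambda>\<eta>. indicat_real (small_cube :: (real ^ 'd) set) \<eta> * (1/2))"
      by (rule integrable_mult_left[OF integral_indicator_small_cube(1)])
    show "integrable lborel (\<lambda>\<eta>. Re (indicator (small_cube :: (real ^ 'd) set) \<eta> *\<^sub>R cis (- 2 * pi * (t \<bullet> \<eta>))))"
      by (rule integrable_Re[OF integrable_small_cube_cis])
    fix \<eta> :: "real ^ 'd"
    have "1/2 \<le> cos (2 * pi * (t \<bullet> \<eta>))" if "\<eta> \<in> small_cube"
    proof -
      have "\<bar>2 * pi * (t \<bullet> \<eta>)\<bar> \<le> pi / 3" using small_cube_inner_le[OF assms that] by (simp add: abs_mult)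
      then have "cos (pi / 3) \<le> cos \<bar>2 * pi * (t \<bullet> \<eta>)\<bar>" by (intro cos_monotone_0_pi_le) auto
      then show ?thesis by (simp add: cos_60)
    qed
    then show "indicator small_cube \<eta> * (1/2) \<le> Re (indicator small_cube \<eta> *\<^sub>R cis (- 2 * pi * (t \<bullet> \<eta>)))"
      by (auto simp: indicator_def)
  qed
  moreover have "(\<integral>\<eta>. indicator (small_cube :: (real ^ 'd) set) \<eta> * (1/2) \<partial>lborel) = measure lborel (small_cube :: (real ^ 'd) set) / 2"
    using integral_indicator_small_cube by simp
  ultimately show ?thesis by simp
qed

lemma borel_measurable_small_cube_transform:
  "small_cube_transform \<in> borel_measurable (borel :: (real ^ 'd::finite) measure)"
proof -
  have "(\<lambda>(t, \<eta>). indicator (small_cube :: (real ^ 'd) set) \<eta> *\<^sub>R cis (- 2 * pi * (t \<bullet> \<eta>))) \<in> borel_measurable (borel \<Otimes>\<^sub>M lborel)"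
  proof -
    have sets_eq: "sets (borel \<Otimes>\<^sub>M lborel) = sets (borel :: ((real ^ 'd) \<times> (real ^ 'd)) measure)"
      by (metis borel_prod sets_lborel sets_pair_measure_cong)
    have "(\<lambda>x::(real ^ 'd) \<times> (real ^ 'd). cis (- 2 * pi * (fst x \<bullet> snd x))) \<in> borel_measurable borel"
      by (intro borel_measurable_continuous_onI continuous_on_cis_compose continuous_intros)
    then have 1: "(\<lambda>x::(real ^ 'd) \<times> (real ^ 'd). cis (- 2 * pi * (fst x \<bullet> snd x))) \<in> borel_measurable (borel \<Otimes>\<^sub>M lborel)"
      unfolding measurable_cong_sets[OF sets_eq refl] .
    have 2: "(\<lambda>x::(real ^ 'd) \<times> (real ^ 'd). indicat_real (small_cube :: (real ^ 'd) set) (snd x)) \<in> borel_measurable (borel \<Otimes>\<^sub>M lborel)"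
      by (rule measurable_compose[OF measurable_snd borel_measurable_indicator]) (simp add: small_cube_sets(1))
    show ?thesis using borel_measurable_scaleR[OF 2 1] by (simp add: split_def)
  qed
  then show ?thesis
    unfolding small_cube_transform_def[abs_def]
    by (rule lborel.borel_measurable_lebesgue_integral)
qed

text \<open>
  Averaging a Fourier transform over a translate of the small cube amounts to multiplying the function
  by the transform of the small cube.
\<close>

lemma integral_scalar_fourier_small_cube:
  fixes w :: "real ^ 'd::finite \<Rightarrow> real"
  assumes w: "integrable lborel w"
  shows "(\<integral>\<eta>. indicator small_cube \<eta> *\<^sub>R scalar_fourier w (\<nu> + \<eta>) \<partial>lborel) =
    (\<integral>t. (cis (- 2 * pi * (t \<bullet> \<nu>)) * small_cube_transform t) * of_real (w t) \<partial>lborel)"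
proof -
  let ?V = "small_cube :: (real ^ 'd) set"
  define F where "F = (\<lambda>x::(real ^ 'd) \<times> (real ^ 'd).
    (indicat_real ?V (snd x) *\<^sub>R cis (- 2 * pi * (fst x \<bullet> (\<nu> + snd x)))) * complex_of_real (w (fst x)))"
  have wm: "w \<in> borel_measurable lborel" using w by (rule borel_measurable_integrable)
  have "(\<lambda>x::(real ^ 'd) \<times> (real ^ 'd). cis (- 2 * pi * (fst x \<bullet> (\<nu> + snd x)))) \<in> borel_measurable borel"
    by (intro borel_measurable_continuous_onI continuous_on_cis_compose continuous_intros)
  then have 1: "(\<lambda>x::(real ^ 'd) \<times> (real ^ 'd). cis (- 2 * pi * (fst x \<bullet> (\<nu> + snd x)))) \<in> borel_measurable (lborel \<Otimes>\<^sub>M lborel)"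
    by (simp add: lborel_prod)
  have 2: "(\<lambda>x::(real ^ 'd) \<times> (real ^ 'd). indicat_real ?V (snd x)) \<in> borel_measurable (lborel \<Otimes>\<^sub>M lborel)"
    by (rule measurable_compose[OF measurable_snd borel_measurable_indicator]) (simp add: small_cube_sets(1))
  have 3: "(\<lambda>x::(real ^ 'd) \<times> (real ^ 'd). complex_of_real (w (fst x))) \<in> borel_measurable (lborel \<Otimes>\<^sub>M lborel)"
    by (rule measurable_compose[OF measurable_compose[OF measurable_fst wm] borel_measurable_of_real])
  have Fm: "F \<in> borel_measurable (lborel \<Otimes>\<^sub>M lborel)"
    unfolding F_def by (rule borel_measurable_times[OF borel_measurable_scaleR[OF 2 1] 3])
  have nF: "norm (F (t, \<eta>)) = indicat_real ?V \<eta> * \<bar>w t\<bar>" for t \<eta>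
    by (simp add: F_def norm_mult)
  have int_eta: "integrable lborel (\<lambda>\<eta>. F (t, \<eta>))" for t
  proof (rule Bochner_Integration.integrable_bound)
    show "integrable lborel (\<lambda>\<eta>. indicat_real ?V \<eta> * \<bar>w t\<bar>)"
      by (rule integrable_mult_left[OF integral_indicator_small_cube(1)])
    show "(\<lambda>\<eta>. F (t, \<eta>)) \<in> borel_measurable lborel"
      by (rule measurable_compose[OF measurable_Pair1' Fm]) simp
  qed (simp add: nF)
  have Fi: "integrable (lborel \<Otimes>\<^sub>M lborel) F"
  proof (rule lborel_pair.Fubini_integrable[OF Fm])
    have "(\<lambda>t. \<integral>\<eta>. norm (F (t, \<eta>)) \<partial>lborel) = (\<lambda>t. measure lborel ?V * \<bar>w t\<bar>)"
      unfolding nF using integral_indicator_small_cube(2) by simp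
    then show "integrable lborel (\<lambda>t. \<integral>\<eta>. norm (F (t, \<eta>)) \<partial>lborel)" using w by simp
  qed (simp add: int_eta)
  have "(\<integral>\<eta>. indicator ?V \<eta> *\<^sub>R scalar_fourier w (\<nu> + \<eta>) \<partial>lborel) = (\<integral>\<eta>. (\<integral>t. F (t, \<eta>) \<partial>lborel) \<partial>lborel)"
    unfolding scalar_fourier_def F_def
    by (intro Bochner_Integration.integral_cong refl) (simp add: indicator_def)
  also have "\<dots> = (\<integral>t. (\<integral>\<eta>. F (t, \<eta>) \<partial>lborel) \<partial>lborel)"
    using lborel_pair.Fubini_integral[of "\<lambda>t \<eta>. F (t, \<eta>)"] Fi by (simp add: split_def)
  also have "\<dots> = (\<integral>t. (cis (- 2 * pi * (t \<bullet> \<nu>)) * small_cube_transform t) * of_real (w t) \<partial>lborel)"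
  proof (intro Bochner_Integration.integral_cong refl)
    fix t :: "real ^ 'd"
    have "F (t, \<eta>) = (cis (- 2 * pi * (t \<bullet> \<nu>)) * of_real (w t)) * (indicator ?V \<eta> *\<^sub>R cis (- 2 * pi * (t \<bullet> \<eta>)))" for \<eta>
    proof -
      have "cis (- 2 * pi * (t \<bullet> (\<nu> + \<eta>))) = cis (- 2 * pi * (t \<bullet> \<nu>)) * cis (- 2 * pi * (t \<bullet> \<eta>))"
        by (simp add: cis_mult inner_add_right algebra_simps)
      then show ?thesis by (simp add: F_def)
    qed
    then have "(\<integral>\<eta>. F (t, \<eta>) \<partial>lborel) = (cis (- 2 * pi * (t \<bullet> \<nu>)) * of_real (w t)) * small_cube_transform t"
      unfolding small_cube_transform_def by (simp only: integral_mult_right_zero)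
    then show "(\<integral>\<eta>. F (t, \<eta>) \<partial>lborel) = (cis (- 2 * pi * (t \<bullet> \<nu>)) * small_cube_transform t) * of_real (w t)"
      by simp
  qed
  finally show ?thesis .
qed

text \<open>
  Jensen's inequality on a set of finite measure, from the tangent at the mean value. The right-hand
  side may be infinite.
\<close>

lemma powr_le_nn_integral_powr:
  fixes h :: "'a \<Rightarrow> real"
  assumes V: "V \<in> sets M" "emeasure M V = ennreal v" "0 < v" and P: "1 \<le> P" and X: "0 \<le> X"
    and h: "h \<in> borel_measurable M" "\<And>t. 0 \<le> h t"
    and le: "ennreal X \<le> (\<integral>\<^sup>+t. ennreal (h t) * indicator V t \<partial>M)"
  shows "ennreal (X powr P) \<le> ennreal (v powr (P - 1)) * (\<integral>\<^sup>+t. ennreal (h t powr P) * indicator V t \<partial>M)"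
proof (cases "X = 0")
  case False
  define I where "I = (\<integral>\<^sup>+t. ennreal (h t powr P) * indicator V t \<partial>M)"
  define y where "y = X / v"
  have y: "y > 0" using False X V by (simp add: y_def)
  define Z where "Z = y powr P * v"
  have Z: "Z \<ge> 0" using V by (simp add: Z_def)
  have hp: "(\<lambda>t. ennreal (h t powr P) * indicator V t) \<in> borel_measurable M"
    by (intro borel_measurable_times_ennreal measurable_compose[OF powr_real_measurable measurable_ennreal]
        borel_measurable_indicator h V borel_measurable_const)
  have "ennreal (P * Z) = ennreal (P * y powr (P - 1)) * ennreal X"
  proof -
    have "y powr P = y powr (P - 1) * y" using y by (simp add: powr_diff)
    moreover have "y * v = X" using V by (simp add: y_def)
    ultimately have "P * Z = (P * y powr (P - 1)) * X" by (simp only: Z_def mult.assoc)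
    then have "ennreal (P * Z) = ennreal ((P * y powr (P - 1)) * X)" by (simp only:)
    then show ?thesis using P X by (subst (asm) ennreal_mult) auto
  qed
  also have "\<dots> \<le> ennreal (P * y powr (P - 1)) * (\<integral>\<^sup>+t. ennreal (h t) * indicator V t \<partial>M)"
    by (intro mult_left_mono le) auto
  also have "\<dots> = (\<integral>\<^sup>+t. ennreal (P * y powr (P - 1)) * (ennreal (h t) * indicator V t) \<partial>M)"
    by (rule nn_integral_cmult[symmetric])
       (intro borel_measurable_times_ennreal measurable_compose[OF h(1) measurable_ennreal] borel_measurable_indicator V)
  also have "\<dots> \<le> (\<integral>\<^sup>+t. ennreal (h t powr P) * indicator V t + ennreal ((P - 1) * y powr P) * indicator V t \<partial>M)"
  proof (intro nn_integral_mono)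
    fix t
    have "y powr P + P * y powr (P - 1) * (h t - y) \<le> h t powr P" using h(2) y P by (intro powr_tangent) auto
    moreover have "y powr (P - 1) * y = y powr P" using y by (simp add: powr_diff)
    ultimately have "P * y powr (P - 1) * h t \<le> h t powr P + (P - 1) * y powr P" by (simp add: algebra_simps)
    then have "ennreal (P * y powr (P - 1)) * ennreal (h t) \<le> ennreal (h t powr P) + ennreal ((P - 1) * y powr P)"
      using P h(2) by (simp flip: ennreal_mult ennreal_plus)
    then show "ennreal (P * y powr (P - 1)) * (ennreal (h t) * indicator V t) \<le>
        ennreal (h t powr P) * indicator V t + ennreal ((P - 1) * y powr P) * indicator V t"
      by (cases "t \<in> V") auto
  qed
  also have "\<dots> = I + (\<integral>\<^sup>+t. ennreal ((P - 1) * y powr P) * indicator V t \<partial>M)"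
    unfolding I_def by (rule nn_integral_add[OF hp]) (intro borel_measurable_times_ennreal borel_measurable_indicator V borel_measurable_const)
  also have "(\<integral>\<^sup>+t. ennreal ((P - 1) * y powr P) * indicator V t \<partial>M) = ennreal ((P - 1) * Z)"
    unfolding nn_integral_cmult_indicator[OF V(1)] V(2) Z_def using P V(3) by (simp flip: ennreal_mult add: mult.assoc)
  finally have le2: "ennreal (P * Z) \<le> I + ennreal ((P - 1) * Z)" .
  have ZI: "ennreal Z \<le> I"
  proof (cases I)
    case (real i)
    then have "ennreal (P * Z) \<le> ennreal (i + (P - 1) * Z)" using le2 P Z by simp
    then have "P * Z \<le> i + (P - 1) * Z" using real P Z by (subst (asm) ennreal_le_iff) auto
    then show ?thesis using real by (simp add: algebra_simps)
  qed simp
  have "X powr P = v powr (P - 1) * Z"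
    using X V(3) by (simp add: Z_def y_def powr_divide powr_diff)
  then have "ennreal (X powr P) = ennreal (v powr (P - 1)) * ennreal Z" using Z by (simp add: ennreal_mult)
  also have "\<dots> \<le> ennreal (v powr (P - 1)) * I" by (intro mult_left_mono ZI) auto
  finally show ?thesis by (simp add: I_def)
qed (use P in simp)

text \<open>
  Different integer translates of the small cube do not meet, because its side is less than
  \<open>1\<close>.
\<close>

lemma sum_nn_integral_translates_le:
  fixes h :: "real ^ 'd::finite \<Rightarrow> real" and B :: "(int ^ 'd) set"
  assumes h: "h \<in> borel_measurable borel" and B: "finite B"
  shows "(\<Sum>n\<in>B. \<integral>\<^sup>+\<eta>. ennreal (h ((\<chi> i. real_of_int (n $ i)) + \<eta>)) * indicator small_cube \<eta> \<partial>lborel)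
    \<le> (\<integral>\<^sup>+\<xi>. ennreal (h \<xi>) \<partial>lborel)"
proof -
  let ?V = "small_cube :: (real ^ 'd) set"
  let ?r = "\<lambda>n :: int ^ 'd. (\<chi> i. real_of_int (n $ i)) :: real ^ 'd"
  have hm: "(\<lambda>\<xi>. ennreal (h \<xi>)) \<in> borel_measurable borel" using h by simp
  have m: "(\<lambda>\<xi>. ennreal (h \<xi>) * indicator ?V (\<xi> - ?r n)) \<in> borel_measurable borel" for n
  proof (rule borel_measurable_times_ennreal[OF hm])
    have sub: "(\<lambda>\<xi>. \<xi> - ?r n) \<in> borel_measurable borel" by simp
    show "(\<lambda>\<xi>. indicator ?V (\<xi> - ?r n) :: ennreal) \<in> borel_measurable borel"
      by (rule measurable_compose[OF sub borel_measurable_indicator[OF small_cube_sets(1)]])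
  qed
  have tr: "(\<integral>\<^sup>+\<eta>. ennreal (h (?r n + \<eta>)) * indicator ?V \<eta> \<partial>lborel) = (\<integral>\<^sup>+\<xi>. ennreal (h \<xi>) * indicator ?V (\<xi> - ?r n) \<partial>lborel)" for n
  proof -
    have "(\<integral>\<^sup>+\<xi>. ennreal (h \<xi>) * indicator ?V (\<xi> - ?r n) \<partial>lborel) =
       (\<integral>\<^sup>+\<xi>. ennreal (h \<xi>) * indicator ?V (\<xi> - ?r n) \<partial>(distr lborel borel ((+) (?r n))))"
      by (simp add: lborel_distr_plus)
    also have "\<dots> = (\<integral>\<^sup>+\<eta>. ennreal (h (?r n + \<eta>)) * indicator ?V (?r n + \<eta> - ?r n) \<partial>lborel)"
      by (rule nn_integral_distr) (simp_all add: m)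
    finally show ?thesis by simp
  qed
  have "(\<Sum>n\<in>B. \<integral>\<^sup>+\<eta>. ennreal (h (?r n + \<eta>)) * indicator ?V \<eta> \<partial>lborel) =
      (\<integral>\<^sup>+\<xi>. (\<Sum>n\<in>B. ennreal (h \<xi>) * indicator ?V (\<xi> - ?r n)) \<partial>lborel)"
    unfolding tr by (rule nn_integral_sum[symmetric]) (use m in simp)
  also have "\<dots> \<le> (\<integral>\<^sup>+\<xi>. ennreal (h \<xi>) \<partial>lborel)"
  proof (intro nn_integral_mono)
    fix \<xi>
    show "(\<Sum>n\<in>B. ennreal (h \<xi>) * indicator ?V (\<xi> - ?r n)) \<le> ennreal (h \<xi>)"
    proof (cases "\<exists>n\<in>B. \<xi> - ?r n \<in> ?V")
      case True
      then obtain n where n: "n \<in> B" "\<xi> - ?r n \<in> ?V" by blast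
      have uniq: "n' = n" if "\<xi> - ?r n' \<in> ?V" for n'
      proof (rule vec_eq_iff[THEN iffD2], rule allI)
        fix i
        let ?\<delta> = "1 / (3 * real CARD('d))"
        have d: "?\<delta> \<le> 1/3" by (simp add: field_simps)
        have "- ?\<delta> \<le> \<xi> $ i - real_of_int (n $ i) \<and> \<xi> $ i - real_of_int (n $ i) \<le> ?\<delta>"
          "- ?\<delta> \<le> \<xi> $ i - real_of_int (n' $ i) \<and> \<xi> $ i - real_of_int (n' $ i) \<le> ?\<delta>"
          using n(2) that unfolding small_cube_def mem_box_cart vec_lambda_beta vector_minus_component by blast+
        then have "\<bar>real_of_int (n' $ i) - real_of_int (n $ i)\<bar> < 1" using d by linarith
        then show "n' $ i = n $ i" by linarith
      qed
      have "(\<Sum>n'\<in>B. ennreal (h \<xi>) * indicator ?V (\<xi> - ?r n')) = (\<Sum>n'\<in>B. if n' = n then ennreal (h \<xi>) else 0)"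
      proof (rule sum.cong[OF refl])
        fix n'
        show "ennreal (h \<xi>) * indicator ?V (\<xi> - ?r n') = (if n' = n then ennreal (h \<xi>) else 0)"
          by (cases "\<xi> - ?r n' \<in> ?V") (use n(2) uniq[of n'] in auto)
      qed
      also have "\<dots> = ennreal (h \<xi>)" using n(1) B by simp
      finally show ?thesis by simp
    qed (simp add: sum.neutral)
  qed
  finally show ?thesis .
qed

text \<open>
  Stated for a bounded multiplier \<open>g\<close>, which is a character for the Fourier transform and
  a character times the transform of the small cube for the averages.
\<close>

lemma has_Bochner_integral_finite_rank:
  fixes w :: "'x::complex_banach \<Rightarrow> real ^ 'd::finite \<Rightarrow> real"
  assumes w: "\<And>y. y \<in> J \<Longrightarrow> integrable lborel (w y)" and J: "finite J" and g: "g \<in> borel_measurable borel"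
    and gb: "\<And>t. norm (g t) \<le> c"
  shows "has_Bochner_integral lebesgue (\<lambda>t. g t *\<^sub>C (\<Sum>y\<in>J. w y t *\<^sub>R y))
    (\<Sum>y\<in>J. (\<integral>t. g t * of_real (w y t) \<partial>lborel) *\<^sub>C (y :: 'x))"
proof -
  have eq: "g t *\<^sub>C (\<Sum>y\<in>J. w y t *\<^sub>R y) = (\<Sum>y\<in>J. (g t * of_real (w y t)) *\<^sub>C y)" for t
    by (simp add: scaleC.sum_right scaleC_of_real[symmetric] scaleC_scaleC)
  have "has_Bochner_integral lebesgue (\<lambda>t. (g t * of_real (w y t)) *\<^sub>C y) ((\<integral>t. g t * of_real (w y t) \<partial>lborel) *\<^sub>C y)"
    if y: "y \<in> J" for y :: 'x
  proof -
    have wm: "w y \<in> borel_measurable lborel" by (rule borel_measurable_integrable[OF w[OF y]])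
    have m: "(\<lambda>t. g t * complex_of_real (w y t)) \<in> borel_measurable lborel"
      using g wm by (intro borel_measurable_times borel_measurable_of_real) auto
    have i: "integrable lborel (\<lambda>t. g t * complex_of_real (w y t))"
    proof (rule Bochner_Integration.integrable_bound[OF _ m])
      show "integrable lborel (\<lambda>t. c * w y t)" using w[OF y] by simp
      show "AE t in lborel. norm (g t * complex_of_real (w y t)) \<le> norm (c * w y t)"
        using gb by (intro AE_I2) (auto simp: norm_mult abs_mult intro!: mult_right_mono order_trans[OF gb abs_ge_self])
    qed
    have "integrable lebesgue (\<lambda>t. g t * complex_of_real (w y t))" using i integrable_completion[OF m] by simp
    from has_Bochner_integral_scaleC_left[OF this, of y] show ?thesis unfolding integral_completion[OF m] .
  qed
  then have "has_Bochner_integral lebesgue (\<lambda>t. \<Sum>y\<in>J. (g t * of_real (w y t)) *\<^sub>C y)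
      (\<Sum>y\<in>J. (\<integral>t. g t * of_real (w y t) \<partial>lborel) *\<^sub>C y)"
    by (intro has_Bochner_integral_sum completion.complete_measure_axioms J)
  then show ?thesis by (simp add: eq)
qed

lemma integrable_polynomial_cutoff:
  fixes R :: "real ^ 'd::finite \<Rightarrow> real"
  assumes R: "real_polynomial_function R" and k: "1 \<le> k"
  shows "integrable lborel (\<lambda>t. R t * cutoff k t)"
proof -
  obtain B where B: "0 \<le> B" "\<And>k t. 1 \<le> k \<Longrightarrow> \<bar>R t * cutoff k t\<bar> \<le> B * exp (- norm t)"
    using polynomial_cutoff_bound[OF R] by blast
  have e: "integrable lborel (\<lambda>t::real ^ 'd. exp (- norm t))"
  proof (rule integrableI_bounded)
    show "(\<lambda>t::real ^ 'd. exp (- norm t)) \<in> borel_measurable lborel"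
      by (simp add: borel_measurable_continuous_onI continuous_intros)
    show "(\<integral>\<^sup>+ t. ennreal (norm (exp (- norm (t::real ^ 'd)))) \<partial>lborel) < \<infinity>"
      using nn_integral_exp_norm_finite[where 'a = "real ^ 'd"] by simp
  qed
  show ?thesis
  proof (rule Bochner_Integration.integrable_bound)
    show "integrable lborel (\<lambda>t::real ^ 'd. B * exp (- norm t))" using e by simp
    show "(\<lambda>t. R t * cutoff k t) \<in> borel_measurable lborel"
      by (simp add: borel_measurable_continuous_onI continuous_on_mult continuous_on_cutoff continuous_on_real_polynomial_function R)
    show "AE t in lborel. norm (R t * cutoff k t) \<le> norm (B * exp (- norm t))"
    proof (intro AE_I2)
      fix t :: "real ^ 'd"
      have "0 \<le> B * exp (- norm t)" using B(1) by simp
      then show "norm (R t * cutoff k t) \<le> norm (B * exp (- norm t))"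
        unfolding real_norm_def using B(2)[OF k, of t] by linarith
    qed
  qed
qed

text \<open>
  The integrals in the sum are the averages of the Fourier transform of the Schwartz function over
  integer translates of the small cube, so Fourier type bounds them after Jensen's inequality. They
  are written with the multiplier on the function's side, the form that approximation needs.
\<close>

lemma fourier_type_sampled_averages:
  fixes R :: "'x::complex_banach \<Rightarrow> real ^ 'd::finite \<Rightarrow> real"
  assumes C: "0 \<le> C" "\<And>f :: real ^ 'd \<Rightarrow> 'x. schwartz f \<Longrightarrow> Lp_norm P (fourier lebesgue f) \<le> ennreal C * Lp_norm p f"
    and p: "1 \<le> p" and P: "1 \<le> P"
    and J: "finite J" and R: "\<And>y. y \<in> J \<Longrightarrow> real_polynomial_function (R y)" and k: "1 \<le> k"
    and I: "0 \<le> I" "(\<integral>\<^sup>+t. ennreal (norm (\<Sum>y\<in>J. (R y t * cutoff k t) *\<^sub>R y) powr p) \<partial>lebesgue) \<le> ennreal I"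
    and B: "finite B"
  shows "(\<Sum>n\<in>B. norm (Bochner_integral lebesgue (\<lambda>t. (cis (- 2 * pi * (t \<bullet> (\<chi> i. real_of_int (n $ i)))) * small_cube_transform t)
       *\<^sub>C (\<Sum>y\<in>J. (R y t * cutoff k t) *\<^sub>R y))) powr P)
    \<le> measure lborel (small_cube :: (real ^ 'd) set) powr (P - 1) * (C * I powr (1 / p)) powr P"
proof -
  let ?V = "small_cube :: (real ^ 'd) set"
  let ?r = "\<lambda>n :: int ^ 'd. (\<chi> i. real_of_int (n $ i)) :: real ^ 'd"
  define v where "v = measure lborel ?V"
  have v: "0 < v" unfolding v_def by (rule small_cube_measure)
  have Vm: "emeasure lborel ?V = ennreal v"
    unfolding v_def by (rule emeasure_eq_ennreal_measure) (use small_cube_measure(1)[where 'd='d] in simp)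
  define w where "w y t = R y t * cutoff k t" for y t
  define u where "u t = (\<Sum>y\<in>J. w y t *\<^sub>R y)" for t
  have lc: "complete_measure (lebesgue :: (real ^ 'd) measure)" by (rule completion.complete_measure_axioms)
  have w: "integrable lborel (w y)" if "y \<in> J" for y
    unfolding w_def[abs_def] by (rule integrable_polynomial_cutoff[OF R[OF that] k])
  have sch: "schwartz u" unfolding u_def w_def by (rule schwartz_polynomial_cutoff[OF J R k])
  have uhat: "fourier lebesgue u \<xi> = (\<Sum>y\<in>J. scalar_fourier (w y) \<xi> *\<^sub>C y)" for \<xi>
    unfolding fourier_def u_def scalar_fourier_def
    by (rule Bochner_integral_eq[OF lc has_Bochner_integral_finite_rank[OF w J borel_measurable_cis_inner, where c = 1]]) auto
  define h where "h \<xi> = norm (fourier lebesgue u \<xi>)" for \<xi>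
  have h0: "0 \<le> h \<xi>" for \<xi> by (simp add: h_def)
  have "continuous_on UNIV h"
    unfolding h_def uhat
    by (intro continuous_on_norm continuous_on_sum bounded_linear.continuous_on[OF scaleC.bounded_linear_left]
        continuous_on_scalar_fourier w)
  then have hm: "h \<in> borel_measurable borel" by (rule borel_measurable_continuous_onI)
  have hPm: "(\<lambda>\<xi>. h \<xi> powr P) \<in> borel_measurable borel"
    by (rule powr_real_measurable[OF hm borel_measurable_const])
  have "epow (\<integral>\<^sup>+t. ennreal (h t powr P) \<partial>lebesgue) (1 / P) \<le> ennreal C * epow (\<integral>\<^sup>+t. ennreal (norm (u t) powr p) \<partial>lebesgue) (1 / p)"
    using C(2)[OF sch] by (simp add: Lp_norm_def h_def)
  also have "\<dots> \<le> ennreal C * epow (ennreal I) (1 / p)"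
    using I p by (intro mult_left_mono epow_mono) (auto simp: u_def w_def)
  also have "\<dots> = ennreal (C * I powr (1 / p))" using C I by (simp add: epow_ennreal ennreal_mult)
  finally have "(\<integral>\<^sup>+t. ennreal (h t powr P) \<partial>lebesgue) \<le> ennreal ((C * I powr (1 / p)) powr P)"
    using P C by (subst (asm) epow_le_iff) auto
  then have hP: "(\<integral>\<^sup>+t. ennreal (h t powr P) \<partial>lborel) \<le> ennreal ((C * I powr (1 / p)) powr P)"
    unfolding nn_integral_completion .
  define S where "S n = Bochner_integral lebesgue (\<lambda>t. (cis (- 2 * pi * (t \<bullet> ?r n)) * small_cube_transform t) *\<^sub>C u t)" for n
  have S: "S n = (\<Sum>y\<in>J. (\<integral>\<eta>. indicator ?V \<eta> *\<^sub>R scalar_fourier (w y) (?r n + \<eta>) \<partial>lborel) *\<^sub>C y)" for n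
  proof -
    have "has_Bochner_integral lebesgue (\<lambda>t. (cis (- 2 * pi * (t \<bullet> ?r n)) * small_cube_transform t) *\<^sub>C (\<Sum>y\<in>J. w y t *\<^sub>R y))
      (\<Sum>y\<in>J. (\<integral>t. (cis (- 2 * pi * (t \<bullet> ?r n)) * small_cube_transform t) * of_real (w y t) \<partial>lborel) *\<^sub>C y)"
      using norm_small_cube_transform_le
      by (intro has_Bochner_integral_finite_rank[OF w J, where c = v] borel_measurable_times borel_measurable_cis_inner
           borel_measurable_small_cube_transform) (auto simp: norm_mult v_def)
    then have "S n = (\<Sum>y\<in>J. (\<integral>t. (cis (- 2 * pi * (t \<bullet> ?r n)) * small_cube_transform t) * of_real (w y t) \<partial>lborel) *\<^sub>C y)"
      unfolding S_def u_def by (rule Bochner_integral_eq[OF lc])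
    then show ?thesis using integral_scalar_fourier_small_cube[OF w] by simp
  qed
  have Sle: "ennreal (norm (S n)) \<le> (\<integral>\<^sup>+\<eta>. ennreal (h (?r n + \<eta>)) * indicator ?V \<eta> \<partial>lborel)" for n
  proof -
    have cont: "continuous_on ?V (\<lambda>\<eta>. scalar_fourier (w y) (?r n + \<eta>))" if "y \<in> J" for y
      by (rule continuous_on_compose2[OF continuous_on_scalar_fourier[OF w[OF that]]]) (auto intro!: continuous_intros)
    have i: "integrable lborel (\<lambda>\<eta>. indicator ?V \<eta> *\<^sub>R scalar_fourier (w y) (?r n + \<eta>))" if "y \<in> J" for y
      by (rule borel_integrable_compact[OF small_cube_sets(2) cont[OF that]])
    have m: "(\<lambda>\<eta>. indicator ?V \<eta> *\<^sub>R scalar_fourier (w y) (?r n + \<eta>)) \<in> borel_measurable lborel" if "y \<in> J" for y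
      by (rule borel_measurable_integrable[OF i[OF that]])
    have "has_Bochner_integral lebesgue (\<lambda>\<eta>. \<Sum>y\<in>J. (indicator ?V \<eta> *\<^sub>R scalar_fourier (w y) (?r n + \<eta>)) *\<^sub>C y) (S n)"
      unfolding S
    proof (rule has_Bochner_integral_sum[OF lc J])
      fix y assume y: "y \<in> J"
      have "integrable lebesgue (\<lambda>\<eta>. indicator ?V \<eta> *\<^sub>R scalar_fourier (w y) (?r n + \<eta>))"
        using i[OF y] integrable_completion[OF m[OF y]] by simp
      from has_Bochner_integral_scaleC_left[OF this, of y]
      show "has_Bochner_integral lebesgue (\<lambda>\<eta>. (indicator ?V \<eta> *\<^sub>R scalar_fourier (w y) (?r n + \<eta>)) *\<^sub>C y)
          ((\<integral>\<eta>. indicator ?V \<eta> *\<^sub>R scalar_fourier (w y) (?r n + \<eta>) \<partial>lborel) *\<^sub>C y)"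
        unfolding integral_completion[OF m[OF y]] .
    qed
    from has_Bochner_integral_norm_le[OF lc this]
    have "ennreal (norm (S n)) \<le> (\<integral>\<^sup>+\<eta>. ennreal (norm (\<Sum>y\<in>J. (indicator ?V \<eta> *\<^sub>R scalar_fourier (w y) (?r n + \<eta>)) *\<^sub>C y)) \<partial>lborel)"
      unfolding nn_integral_completion .
    also have "\<dots> = (\<integral>\<^sup>+\<eta>. ennreal (h (?r n + \<eta>)) * indicator ?V \<eta> \<partial>lborel)"
    proof (intro nn_integral_cong)
      fix \<eta>
      show "ennreal (norm (\<Sum>y\<in>J. (indicator ?V \<eta> *\<^sub>R scalar_fourier (w y) (?r n + \<eta>)) *\<^sub>C y)) = ennreal (h (?r n + \<eta>)) * indicator ?V \<eta>"
        by (cases "\<eta> \<in> ?V") (simp_all add: h_def uhat scaleC.zero_left)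
    qed
    finally show ?thesis .
  qed
  have "ennreal (norm (S n) powr P) \<le> ennreal (v powr (P - 1)) * (\<integral>\<^sup>+\<eta>. ennreal (h (?r n + \<eta>) powr P) * indicator ?V \<eta> \<partial>lborel)" for n
  proof (rule powr_le_nn_integral_powr[OF _ Vm v P _ _ _ Sle])
    have add: "(\<lambda>\<eta>. ?r n + \<eta>) \<in> borel_measurable borel" by simp
    show "(\<lambda>\<eta>. h (?r n + \<eta>)) \<in> borel_measurable lborel"
      using measurable_compose[OF add hm] by simp
  qed (auto simp: h0 small_cube_sets(1))
  then have "(\<Sum>n\<in>B. ennreal (norm (S n) powr P)) \<le> (\<Sum>n\<in>B. ennreal (v powr (P - 1)) * (\<integral>\<^sup>+\<eta>. ennreal (h (?r n + \<eta>) powr P) * indicator ?V \<eta> \<partial>lborel))"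
    by (intro sum_mono)
  also have "\<dots> = ennreal (v powr (P - 1)) * (\<Sum>n\<in>B. \<integral>\<^sup>+\<eta>. ennreal (h (?r n + \<eta>) powr P) * indicator ?V \<eta> \<partial>lborel)"
    by (simp add: sum_distrib_left)
  also have "\<dots> \<le> ennreal (v powr (P - 1)) * ennreal ((C * I powr (1 / p)) powr P)"
    by (intro mult_left_mono order_trans[OF sum_nn_integral_translates_le[OF hPm B] hP]) auto
  also have "\<dots> = ennreal (v powr (P - 1) * (C * I powr (1 / p)) powr P)" by (rule ennreal_mult[symmetric]) auto
  finally have "ennreal (\<Sum>n\<in>B. norm (S n) powr P) \<le> ennreal (v powr (P - 1) * (C * I powr (1 / p)) powr P)"
    by (simp only: sum_ennreal powr_ge_zero)
  then have "(\<Sum>n\<in>B. norm (S n) powr P) \<le> v powr (P - 1) * (C * I powr (1 / p)) powr P"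
    by (subst (asm) ennreal_le_iff) auto
  then show ?thesis unfolding S_def u_def w_def v_def .
qed

lemma torus_eq: "torus = lebesgue_on unit_cube"
  by (simp add: torus_def unit_cube_def)

lemma unit_cube_sets: "unit_cube \<in> sets lebesgue" "unit_cube \<in> sets borel"
  by (simp_all add: unit_cube_def)

lemma complete_measure_torus: "complete_measure torus"
  unfolding torus_eq by (rule complete_measure_lebesgue_on[OF unit_cube_sets(1)])

lemma nn_integral_torus: "(\<integral>\<^sup>+t. f t \<partial>torus) = (\<integral>\<^sup>+t. f t * indicator unit_cube t \<partial>lebesgue)"
  unfolding torus_eq by (rule nn_integral_restrict_space) (simp add: unit_cube_sets)

lemma strongly_measurable_torusD:
  "strongly_measurable torus f \<Longrightarrow> strongly_measurable lebesgue (\<lambda>t. indicator unit_cube t *\<^sub>R f t)"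
  unfolding torus_eq by (rule strongly_measurable_lebesgue_on[OF unit_cube_sets(1)])

lemma borel_measurable_cis_torus: "(\<lambda>t. cis (- 2 * pi * (t \<bullet> \<xi>))) \<in> borel_measurable torus"
  unfolding torus_eq
  by (intro borel_measurable_lebesgue_continuous[THEN measurable_restrict_space1] continuous_on_cis_compose continuous_intros)

lemma has_Bochner_integral_fourier_coeff:
  fixes f :: "real ^ 'd::finite \<Rightarrow> 'x::complex_banach"
  assumes f: "strongly_measurable torus f" and fin: "(\<integral>\<^sup>+t. ennreal (norm (f t)) \<partial>torus) < \<infinity>"
  shows "has_Bochner_integral torus (\<lambda>t. cis (- 2 * pi * (t \<bullet> (\<chi> i. real_of_int (n $ i)))) *\<^sub>C f t) (fourier_coeff f n)"
  unfolding fourier_coeff_def fourier_def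
proof (rule has_Bochner_integral_Bochner_integral[OF complete_measure_torus Bochner_integrableI[OF complete_measure_torus]])
  show "strongly_measurable torus (\<lambda>t. cis (- 2 * pi * (t \<bullet> (\<chi> i. real_of_int (n $ i)))) *\<^sub>C f t)"
    by (rule strongly_measurable_scaleC[OF borel_measurable_cis_torus f])
qed (use fin in \<open>simp add: norm_scaleC\<close>)

text \<open>
  The vectors \<open>s n\<close> are averages of the Fourier transform of a Schwartz function close to
  \<open>f\<close> divided by the transform of the small cube. Averaging undoes the division, so that
  they are close to the Fourier coefficients of \<open>f\<close> itself.
\<close>

lemma fourier_coeff_approx:
  fixes f :: "real ^ 'd::finite \<Rightarrow> 'x::complex_banach"
  defines "v \<equiv> measure lborel (small_cube :: (real ^ 'd) set)"
  assumes C: "0 \<le> C" "\<And>f :: real ^ 'd \<Rightarrow> 'x. schwartz f \<Longrightarrow> Lp_norm P (fourier lebesgue f) \<le> ennreal C * Lp_norm p f"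
    and p: "1 \<le> p" and P: "1 \<le> P"
    and f: "strongly_measurable torus f" and b: "\<And>t. norm (f t) \<le> b"
    and I: "0 \<le> I" "(\<integral>\<^sup>+t. ennreal (norm (f t) powr p) \<partial>torus) \<le> ennreal I"
    and B: "finite B" and \<epsilon>: "0 < \<epsilon>"
  shows "\<exists>s. (\<forall>n. norm (fourier_coeff f n - s n) \<le> v * \<epsilon>) \<and>
     (\<Sum>n\<in>B. norm (s n) powr P) \<le> v powr (P - 1) * (C * (2 powr p * ((2 / v) powr p * I + \<epsilon>)) powr (1 / p)) powr P"
proof -
  let ?Q = "unit_cube :: (real ^ 'd) set"
  let ?r = "\<lambda>n :: int ^ 'd. (\<chi> i. real_of_int (n $ i)) :: real ^ 'd"
  let ?e = "\<lambda>n t. cis (- 2 * pi * (t \<bullet> ?r n))"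
  let ?M = "small_cube_transform :: real ^ 'd \<Rightarrow> complex"
  have v: "0 < v" unfolding v_def by (rule small_cube_measure)
  have lc: "complete_measure (lebesgue :: (real ^ 'd) measure)" by (rule completion.complete_measure_axioms)
  have b0: "0 \<le> b" using b[of 0] norm_ge_zero order_trans by blast
  have "?Q \<in> sets borel" by (rule unit_cube_sets(2))
  then have "emeasure lebesgue ?Q = emeasure lborel ?Q" by simp
  also have "\<dots> = 1" by (rule emeasure_unit_cube)
  finally have Qm: "emeasure lebesgue ?Q = 1" .
  define F where "F t = indicator ?Q t *\<^sub>R f t" for t
  have Fm: "strongly_measurable lebesgue F" unfolding F_def[abs_def] by (rule strongly_measurable_torusD[OF f])
  \<comment> \<open>The averages of the Fourier transform of \<open>G\<close> over translates of the small cube are the Fourier coefficients of \<open>f\<close>.\<close>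
  define G where "G t = (1 / ?M t) *\<^sub>C F t" for t
  have Mm: "?M \<in> borel_measurable lebesgue"
    by (rule measurable_completion) (simp add: borel_measurable_small_cube_transform)
  have Gm: "strongly_measurable lebesgue G"
    unfolding G_def[abs_def] by (intro strongly_measurable_scaleC Fm borel_measurable_divide Mm borel_measurable_const)
  have Mv: "v / 2 \<le> norm (?M t)" if "t \<in> ?Q" for t
    using Re_small_cube_transform_ge[OF that] complex_Re_le_cmod[of "?M t"] unfolding v_def by linarith
  have MG: "?M t *\<^sub>C G t = F t" for t
  proof (cases "t \<in> ?Q")
    case True
    then have "?M t \<noteq> 0" using Mv[OF True] v by auto
    then show ?thesis unfolding G_def scaleC_scaleC using scaleC_of_real[of 1 "F t"] by simp
  qed (simp add: G_def F_def scaleC.zero_right)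
  have nG: "norm (G t) \<le> 2 / v * norm (F t)" for t
  proof (cases "t \<in> ?Q")
    case True
    have "1 / norm (?M t) \<le> 1 / (v / 2)" using Mv[OF True] v by (intro divide_left_mono mult_pos_pos) auto
    then have "1 / norm (?M t) * norm (F t) \<le> 1 / (v / 2) * norm (F t)" by (intro mult_right_mono) auto
    then show ?thesis by (simp add: G_def norm_scaleC norm_divide)
  qed (simp add: G_def F_def scaleC.zero_right)
  have nF: "norm (F t) \<le> b * indicator ?Q t" for t
    using b by (cases "t \<in> ?Q") (auto simp: F_def)
  have finG: "(\<integral>\<^sup>+t. ennreal (mixed_power p (3 * norm (G t))) \<partial>lebesgue) < \<infinity>"
  proof -
    have "(\<integral>\<^sup>+t. ennreal (mixed_power p (3 * norm (G t))) \<partial>lebesgue) \<le>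
        (\<integral>\<^sup>+t. ennreal (mixed_power p (3 * (2 / v * b))) * indicator ?Q t \<partial>lebesgue)"
    proof (intro nn_integral_mono)
      fix t
      show "ennreal (mixed_power p (3 * norm (G t))) \<le> ennreal (mixed_power p (3 * (2 / v * b))) * indicator ?Q t"
      proof (cases "t \<in> ?Q")
        case True
        have "norm (G t) \<le> 2 / v * b"
          using nF[of t] True v by (intro order_trans[OF nG] mult_left_mono) auto
        then have "mixed_power p (3 * norm (G t)) \<le> mixed_power p (3 * (2 / v * b))"
          using p by (intro mixed_power_mono) auto
        then show ?thesis using True by (simp add: ennreal_leI)
      qed (simp add: G_def F_def scaleC.zero_right)
    qed
    also have "\<dots> < \<infinity>" unfolding nn_integral_cmult_indicator[OF unit_cube_sets(1)] Qm by simp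
    finally show ?thesis .
  qed
  have Goff: "G t = 0" if "t \<notin> unit_cube" for t using that by (simp add: G_def F_def scaleC.zero_right)
  obtain J R k where u0: "finite J" "\<And>y. y \<in> J \<Longrightarrow> real_polynomial_function (R y)" "1 \<le> k"
    "(\<integral>\<^sup>+t. ennreal (mixed_power p (norm (G t - (\<Sum>y\<in>J. (R y t * cutoff k t) *\<^sub>R y)))) \<partial>lebesgue) < ennreal \<epsilon>"
    using polynomial_cutoff_dense[OF Gm Goff p finG \<epsilon>] by blast
  define u where "u t = (\<Sum>y\<in>J. (R y t * cutoff k t) *\<^sub>R y)" for t
  have um: "strongly_measurable lebesgue u"
    unfolding u_def[abs_def] by (rule strongly_measurable_polynomial_cutoff[OF u0(2,1)])
  define E where "E t = norm (G t - u t)" for t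
  have Em: "E \<in> borel_measurable lebesgue" unfolding E_def[abs_def] by (rule strongly_measurable_norm_diff[OF lc Gm um])
  have E0: "0 \<le> E t" for t by (simp add: E_def)
  have E\<Phi>: "(\<integral>\<^sup>+t. ennreal (mixed_power p (E t)) \<partial>lebesgue) \<le> ennreal \<epsilon>" using u0(4) by (simp add: u_def E_def)
  have E1: "(\<integral>\<^sup>+t. ennreal (E t) \<partial>lebesgue) \<le> ennreal \<epsilon>"
    by (rule order_trans[OF nn_integral_mono E\<Phi>]) (simp add: mixed_power_def ennreal_leI)
  have Ep: "(\<integral>\<^sup>+t. ennreal (E t powr p) \<partial>lebesgue) \<le> ennreal \<epsilon>"
    by (rule order_trans[OF nn_integral_mono E\<Phi>]) (simp add: mixed_power_def E0 ennreal_leI)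
  have Fp: "(\<integral>\<^sup>+t. ennreal (norm (F t) powr p) \<partial>lebesgue) \<le> ennreal I"
  proof -
    have "(\<integral>\<^sup>+t. ennreal (norm (F t) powr p) \<partial>lebesgue) = (\<integral>\<^sup>+t. ennreal (norm (f t) powr p) \<partial>torus)"
      unfolding nn_integral_torus by (intro nn_integral_cong) (auto simp: F_def indicator_def)
    then show ?thesis using I(2) by simp
  qed
  define I' where "I' = 2 powr p * ((2 / v) powr p * I + \<epsilon>)"
  have I'0: "0 \<le> I'" using I(1) \<epsilon> by (simp add: I'_def)
  have up: "(\<integral>\<^sup>+t. ennreal (norm (u t) powr p) \<partial>lebesgue) \<le> ennreal I'"
  proof -
    have m1: "(\<lambda>t. ennreal (norm (F t) powr p)) \<in> borel_measurable lebesgue"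
      by (intro measurable_compose[OF powr_real_measurable measurable_ennreal] strongly_measurable_norm[OF lc Fm] borel_measurable_const)
    have m2: "(\<lambda>t. ennreal (E t powr p)) \<in> borel_measurable lebesgue"
      by (intro measurable_compose[OF powr_real_measurable measurable_ennreal] Em borel_measurable_const)
    have "(\<integral>\<^sup>+t. ennreal (norm (u t) powr p) \<partial>lebesgue) \<le>
      (\<integral>\<^sup>+t. ennreal (2 powr p) * (ennreal ((2 / v) powr p) * ennreal (norm (F t) powr p) + ennreal (E t powr p)) \<partial>lebesgue)"
    proof (intro nn_integral_mono)
      fix t
      have "norm (u t) \<le> norm (G t) + E t"
        using norm_triangle_ineq4[of "G t" "G t - u t"] by (simp add: E_def)
      also have "\<dots> \<le> 2 / v * norm (F t) + E t" using nG by simp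
      finally have "norm (u t) powr p \<le> (2 / v * norm (F t) + E t) powr p" using p by (intro powr_mono2) auto
      also have "\<dots> \<le> 2 powr p * ((2 / v * norm (F t)) powr p + E t powr p)"
        using p v E0 by (intro powr_add_le) auto
      also have "(2 / v * norm (F t)) powr p = (2 / v) powr p * norm (F t) powr p" by (rule powr_mult)
      finally have "ennreal (norm (u t) powr p) \<le> ennreal (2 powr p * ((2 / v) powr p * norm (F t) powr p + E t powr p))"
        by (rule ennreal_leI)
      also have "\<dots> = ennreal (2 powr p) * (ennreal ((2 / v) powr p) * ennreal (norm (F t) powr p) + ennreal (E t powr p))"
        by (simp add: ennreal_mult)
      finally show "ennreal (norm (u t) powr p) \<le> \<dots>" .
    qed
    also have "\<dots> = ennreal (2 powr p) * (ennreal ((2 / v) powr p) * (\<integral>\<^sup>+t. ennreal (norm (F t) powr p) \<partial>lebesgue) + (\<integral>\<^sup>+t. ennreal (E t powr p) \<partial>lebesgue))"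
      using m1 m2 by (subst nn_integral_cmult) (simp_all add: nn_integral_add nn_integral_cmult)
    also have "\<dots> \<le> ennreal (2 powr p) * (ennreal ((2 / v) powr p) * ennreal I + ennreal \<epsilon>)"
      by (intro mult_left_mono add_mono Fp Ep) auto
    also have "\<dots> = ennreal I'" using I(1) \<epsilon> by (simp add: I'_def ennreal_mult)
    finally show ?thesis .
  qed
  define S where "S n = Bochner_integral lebesgue (\<lambda>t. (?e n t * ?M t) *\<^sub>C u t)" for n
  have "(\<Sum>n\<in>B. norm (S n) powr P) \<le> v powr (P - 1) * (C * I' powr (1 / p)) powr P"
    unfolding S_def v_def u_def
    by (rule fourier_type_sampled_averages[OF C p P u0(1,2,3) I'0 _ B]) (use up in \<open>simp_all add: u_def\<close>)
  moreover have "norm (fourier_coeff f n - S n) \<le> v * \<epsilon>" for n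
  proof -
    have "(\<integral>\<^sup>+t. ennreal (norm (f t)) \<partial>torus) \<le> (\<integral>\<^sup>+t. ennreal b * indicator ?Q t \<partial>lebesgue)"
      unfolding nn_integral_torus using b by (intro nn_integral_mono mult_right_mono ennreal_leI) auto
    also have "\<dots> < \<infinity>" unfolding nn_integral_cmult_indicator[OF unit_cube_sets(1)] Qm by simp
    finally have finf: "(\<integral>\<^sup>+t. ennreal (norm (f t)) \<partial>torus) < \<infinity>" .
    have "has_Bochner_integral lebesgue (\<lambda>t. indicator ?Q t *\<^sub>R (?e n t *\<^sub>C f t)) (fourier_coeff f n)"
      by (rule has_Bochner_integral_lebesgue_on[OF unit_cube_sets(1) has_Bochner_integral_fourier_coeff[OF f finf, unfolded torus_eq]])
    moreover have "(\<lambda>t. indicator ?Q t *\<^sub>R (?e n t *\<^sub>C f t)) = (\<lambda>t. ?e n t *\<^sub>C F t)"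
      by (simp add: F_def scaleC.scaleR_right)
    ultimately have fc: "has_Bochner_integral lebesgue (\<lambda>t. ?e n t *\<^sub>C F t) (fourier_coeff f n)" by simp
    have gm: "(\<lambda>t. ?e n t * ?M t) \<in> borel_measurable borel"
      by (rule borel_measurable_times[OF borel_measurable_cis_inner borel_measurable_small_cube_transform])
    have gb: "norm (?e n t * ?M t) \<le> v" for t
      using norm_small_cube_transform_le[of t] by (simp add: norm_mult v_def)
    have wi: "integrable lborel (\<lambda>t. R y t * cutoff k t)" if "y \<in> J" for y
      by (rule integrable_polynomial_cutoff[OF u0(2)[OF that] u0(3)])
    have "Bochner_integrable lebesgue (\<lambda>t. (?e n t * ?M t) *\<^sub>C u t)"
      unfolding Bochner_integrable_def u_def
      using has_Bochner_integral_finite_rank[of J "\<lambda>y t. R y t * cutoff k t", OF wi u0(1) gm gb] by blast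
    then have Sn: "has_Bochner_integral lebesgue (\<lambda>t. (?e n t * ?M t) *\<^sub>C u t) (S n)"
      unfolding S_def by (rule has_Bochner_integral_Bochner_integral[OF lc])
    \<comment> \<open>Multiplication by \<open>?M\<close> turns \<open>G\<close> back into \<open>f\<close>, so \<open>D\<close> is the difference of the two integrands.\<close>
    define D where "D t = (?e n t * ?M t) *\<^sub>C (G t - u t)" for t
    have nD: "(\<integral>\<^sup>+t. ennreal (norm (D t)) \<partial>lebesgue) \<le> ennreal (v * \<epsilon>)"
    proof -
      have "(\<integral>\<^sup>+t. ennreal (norm (D t)) \<partial>lebesgue) \<le> (\<integral>\<^sup>+t. ennreal v * ennreal (E t) \<partial>lebesgue)"
      proof (intro nn_integral_mono)
        fix t
        have "norm (D t) \<le> v * E t" unfolding D_def norm_scaleC E_def by (intro mult_right_mono gb) auto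
        then have "ennreal (norm (D t)) \<le> ennreal (v * E t)" by (rule ennreal_leI)
        then show "ennreal (norm (D t)) \<le> ennreal v * ennreal (E t)" using v E0 by (simp add: ennreal_mult)
      qed
      also have "\<dots> = ennreal v * (\<integral>\<^sup>+t. ennreal (E t) \<partial>lebesgue)"
        by (rule nn_integral_cmult[OF measurable_compose[OF Em measurable_ennreal]])
      also have "\<dots> \<le> ennreal v * ennreal \<epsilon>" by (intro mult_left_mono E1) auto
      also have "\<dots> = ennreal (v * \<epsilon>)" using v \<epsilon> by (simp add: ennreal_mult)
      finally show ?thesis .
    qed
    have gm': "(\<lambda>t. ?e n t * ?M t) \<in> borel_measurable lebesgue"
      by (rule measurable_completion) (use gm in simp)
    have "strongly_measurable lebesgue D"
      unfolding D_def[abs_def] by (rule strongly_measurable_scaleC[OF gm' strongly_measurable_diff[OF Gm um]])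
    then have "Bochner_integrable lebesgue D"
      by (rule Bochner_integrableI[OF lc]) (rule le_less_trans[OF nD], simp)
    then obtain d where d: "has_Bochner_integral lebesgue D d" unfolding Bochner_integrable_def by blast
    have "(\<lambda>t. D t + (?e n t * ?M t) *\<^sub>C u t) = (\<lambda>t. ?e n t *\<^sub>C F t)"
      unfolding D_def scaleC.diff_right MG[symmetric] scaleC_scaleC by simp
    then have "has_Bochner_integral lebesgue (\<lambda>t. ?e n t *\<^sub>C F t) (d + S n)"
      using has_Bochner_integral_add[OF lc d Sn] by simp
    then have "fourier_coeff f n = d + S n" by (rule has_Bochner_integral_unique[OF lc fc])
    moreover have "norm d \<le> v * \<epsilon>"
      using order_trans[OF has_Bochner_integral_norm_le[OF lc d] nD] v \<epsilon> by (subst (asm) ennreal_le_iff) auto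
    ultimately show ?thesis by simp
  qed
  ultimately show ?thesis unfolding I'_def by blast
qed

text \<open>
  The \<open>L\<^sup>p\<close> endpoint on the torus, for bounded functions and for finite sets of
  frequencies. This is all that the decomposition at a level uses, and it avoids infinite sums.
\<close>

definition fourier_coeff_Lp_constant :: "'d::finite itself \<Rightarrow> 'x::complex_banach itself \<Rightarrow> real \<Rightarrow> real \<Rightarrow> bool" where
  "fourier_coeff_Lp_constant _ _ p K \<longleftrightarrow> 0 \<le> K \<and>
     (\<forall>(f :: real ^ 'd \<Rightarrow> 'x) b B I. strongly_measurable torus f \<longrightarrow> (\<forall>t. norm (f t) \<le> b) \<longrightarrow> finite B \<longrightarrow>
        0 \<le> I \<longrightarrow> (\<integral>\<^sup>+t. ennreal (norm (f t) powr p) \<partial>torus) \<le> ennreal I \<longrightarrow>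
        (\<Sum>n\<in>B. norm (fourier_coeff f n) powr conj_exponent p) powr (1 / conj_exponent p) \<le> K * I powr (1 / p))"

text \<open>
  The approximation error tends to \<open>0\<close> while the bound on the approximating vectors stays
  finite.
\<close>

lemma fourier_coeff_Lp_bound:
  fixes p :: real
  assumes ft: "fourier_type TYPE('d::finite) TYPE('x::complex_banach) p" and p: "1 < p"
  shows "\<exists>K. fourier_coeff_Lp_constant TYPE('d) TYPE('x) p K"
proof -
  define P where "P = conj_exponent p"
  have P: "1 < P" using p by (simp add: P_def conj_exponent_def)
  obtain C0 where C0: "\<And>f :: real ^ 'd \<Rightarrow> 'x. schwartz f \<Longrightarrow> Lp_norm P (fourier lebesgue f) \<le> ennreal C0 * Lp_norm p f"
    using ft unfolding fourier_type_def P_def by blast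
  define C where "C = max 0 C0"
  have C: "0 \<le> C" "\<And>f :: real ^ 'd \<Rightarrow> 'x. schwartz f \<Longrightarrow> Lp_norm P (fourier lebesgue f) \<le> ennreal C * Lp_norm p f"
  proof -
    have "ennreal C0 \<le> ennreal C" by (rule ennreal_leI) (simp add: C_def)
    then show "\<And>f :: real ^ 'd \<Rightarrow> 'x. schwartz f \<Longrightarrow> Lp_norm P (fourier lebesgue f) \<le> ennreal C * Lp_norm p f"
      using C0 by (meson mult_right_mono order_trans zero_le)
  qed (simp add: C_def)
  define v where "v = measure lborel (small_cube :: (real ^ 'd) set)"
  have v: "0 < v" unfolding v_def by (rule small_cube_measure)
  define K where "K = v powr ((P - 1) / P) * C * (2 * (2 / v))"
  have K: "0 \<le> K" using C v by (simp add: K_def)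
  show ?thesis
    unfolding fourier_coeff_Lp_constant_def
  proof (intro exI[of _ K] conjI K allI impI)
    fix f :: "real ^ 'd \<Rightarrow> 'x" and b I :: real and B :: "(int ^ 'd) set"
    assume f1: "strongly_measurable torus f" and f2: "\<forall>t. norm (f t) \<le> b" and B: "finite B"
      and I: "0 \<le> I" "(\<integral>\<^sup>+t. ennreal (norm (f t) powr p) \<partial>torus) \<le> ennreal I"
    note f = f1 spec[OF f2]
    define bd where "bd \<epsilon> = v powr (P - 1) * (C * (2 powr p * ((2 / v) powr p * I + \<epsilon>)) powr (1 / p)) powr P" for \<epsilon>
    define \<epsilon> where "\<epsilon> k = 1 / real (Suc k)" for k
    have \<epsilon>pos: "0 < \<epsilon> k" for k unfolding \<epsilon>_def by simp
    have "\<forall>k. \<exists>s. (\<forall>n. norm (fourier_coeff f n - s n) \<le> v * \<epsilon> k) \<and> (\<Sum>n\<in>B. norm (s n) powr P) \<le> bd (\<epsilon> k)"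
      unfolding v_def bd_def
      by (intro allI fourier_coeff_approx[OF C less_imp_le[OF p] less_imp_le[OF P] f I B] \<epsilon>pos)
    then obtain s where s: "\<And>k n. norm (fourier_coeff f n - s k n) \<le> v * \<epsilon> k" "\<And>k. (\<Sum>n\<in>B. norm (s k n) powr P) \<le> bd (\<epsilon> k)"
      by metis
    have \<epsilon>0: "\<epsilon> \<longlonglongrightarrow> 0" unfolding \<epsilon>_def using LIMSEQ_inverse_real_of_nat by (simp add: inverse_eq_divide)
    have sl: "(\<lambda>k. s k n) \<longlonglongrightarrow> fourier_coeff f n" for n
    proof (rule metric_tendsto_imp_tendsto)
      show "(\<lambda>k. v * \<epsilon> k) \<longlonglongrightarrow> 0" using tendsto_mult[OF tendsto_const \<epsilon>0, of v] by simp
      show "eventually (\<lambda>k. dist (s k n) (fourier_coeff f n) \<le> dist (v * \<epsilon> k) 0) sequentially"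
        using s(1) v by (intro always_eventually allI) (simp add: dist_norm norm_minus_commute abs_mult \<epsilon>_def)
    qed
    have "(\<Sum>n\<in>B. norm (fourier_coeff f n) powr P) \<le> bd 0"
    proof (rule LIMSEQ_le)
      show "(\<lambda>k. \<Sum>n\<in>B. norm (s k n) powr P) \<longlonglongrightarrow> (\<Sum>n\<in>B. norm (fourier_coeff f n) powr P)"
        using P by (intro tendsto_sum tendsto_powr' tendsto_norm sl tendsto_const) auto
      show "(\<lambda>k. bd (\<epsilon> k)) \<longlonglongrightarrow> bd 0"
        unfolding bd_def using P p C I
        by (intro tendsto_mult tendsto_const tendsto_powr' tendsto_add \<epsilon>0)
          (auto intro!: always_eventually mult_nonneg_nonneg add_nonneg_nonneg simp: \<epsilon>_def)
    qed (use s(2) in blast)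
    also have "bd 0 = v powr (P - 1) * (C * (2 * (2 / v) * I powr (1 / p))) powr P"
      using p v I by (simp add: bd_def powr_mult powr_powr powr_divide)
    finally have "(\<Sum>n\<in>B. norm (fourier_coeff f n) powr P) powr (1 / P) \<le> (v powr (P - 1) * (C * (2 * (2 / v) * I powr (1 / p))) powr P) powr (1 / P)"
      using P by (intro powr_mono2) (auto intro: sum_nonneg)
    also have "\<dots> = (v powr (P - 1)) powr (1 / P) * ((C * (2 * (2 / v) * I powr (1 / p))) powr P) powr (1 / P)"
      by (rule powr_mult)
    also have "\<dots> = v powr ((P - 1) / P) * (C * (2 * (2 / v) * I powr (1 / p)))"
      unfolding powr_powr using P C v by simp
    also have "\<dots> = K * I powr (1 / p)" by (simp add: K_def)
    finally show "(\<Sum>n\<in>B. norm (fourier_coeff f n) powr conj_exponent p) powr (1 / conj_exponent p) \<le> K * I powr (1 / p)"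
      unfolding P_def .
  qed
qed

section \<open>Rearrangements and the decomposition at a level\<close>

lemma rearrangement_antimono:
  assumes "s \<le> t"
  shows "rearrangement M f t \<le> rearrangement M f s"
  unfolding rearrangement_def
  using assms by (intro Inf_superset_mono) (auto intro: order_trans ennreal_leI)

lemma emeasure_gt_of_less_rearrangement:
  assumes "s < rearrangement M f t"
  shows "ennreal t < emeasure M {x \<in> space M. s < ennreal (norm (f x))}"
proof (rule ccontr)
  assume "\<not> ?thesis"
  then have "rearrangement M f t \<le> s"
    unfolding rearrangement_def by (intro Inf_lower) (simp add: not_less)
  then show False using assms by simp
qed

lemma rearrangement_le_bound:
  assumes "\<And>x. x \<in> space M \<Longrightarrow> norm (f x) \<le> b"
  shows "rearrangement M f t \<le> ennreal b"
proof -
  have "{x \<in> space M. ennreal b < ennreal (norm (f x))} = {}"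
    using assms by (auto simp: not_less intro!: ennreal_leI)
  then have "emeasure M {x \<in> space M. ennreal b < ennreal (norm (f x))} \<le> ennreal t" by (simp only: emeasure_empty zero_le)
  then show ?thesis unfolding rearrangement_def by (intro Inf_lower) (rule CollectI)
qed

text \<open>The infimum defining the rearrangement is attained, by continuity of the measure from below.\<close>

lemma emeasure_above_rearrangement_le:
  assumes f: "(\<lambda>x. norm (f x)) \<in> borel_measurable M"
  shows "emeasure M {x \<in> space M. rearrangement M f t < ennreal (norm (f x))} \<le> ennreal t"
proof (cases "rearrangement M f t")
  case top
  then show ?thesis by simp
next
  case (real r)
  define A where "A n = {x \<in> space M. ennreal (r + 1 / real (Suc n)) < ennreal (norm (f x))}" for n
  have sm: "{x \<in> space M. s < ennreal (norm (f x))} \<in> sets M" for s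
    by (rule borel_measurable_less[OF borel_measurable_const measurable_compose[OF f measurable_ennreal]])
  have Am: "A n \<in> sets M" for n unfolding A_def by (rule sm)
  have A_le: "emeasure M (A n) \<le> ennreal t" for n
  proof -
    have "rearrangement M f t < ennreal (r + 1 / real (Suc n))" using real by (simp add: ennreal_less_iff)
    then obtain s where s: "emeasure M {x \<in> space M. s < ennreal (norm (f x))} \<le> ennreal t" "s < ennreal (r + 1 / real (Suc n))"
      unfolding rearrangement_def Inf_less_iff by blast
    have "emeasure M (A n) \<le> emeasure M {x \<in> space M. s < ennreal (norm (f x))}"
    proof (rule emeasure_mono)
      show "A n \<subseteq> {x \<in> space M. s < ennreal (norm (f x))}" using s(2) by (auto simp: A_def)
    qed (rule sm)
    then show ?thesis using s(1) by (rule order_trans)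
  qed
  have "incseq A"
  proof (rule incseq_SucI)
    fix n
    have "1 / real (Suc (Suc n)) \<le> 1 / real (Suc n)" by (simp add: frac_le)
    then have "ennreal (r + 1 / real (Suc (Suc n))) \<le> ennreal (r + 1 / real (Suc n))" by (intro ennreal_leI) simp
    then show "A n \<subseteq> A (Suc n)" by (auto simp: A_def)
  qed
  moreover have "(\<Union>n. A n) = {x \<in> space M. rearrangement M f t < ennreal (norm (f x))}"
  proof (intro set_eqI iffI)
    fix x assume "x \<in> (\<Union>n. A n)"
    then obtain n where n: "x \<in> space M" "ennreal (r + 1 / real (Suc n)) < ennreal (norm (f x))" by (auto simp: A_def)
    have "ennreal r \<le> ennreal (r + 1 / real (Suc n))" by (intro ennreal_leI) simp
    from le_less_trans[OF this n(2)] show "x \<in> {x \<in> space M. rearrangement M f t < ennreal (norm (f x))}"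
      using n(1) real(2) by simp
  next
    fix x assume x: "x \<in> {x \<in> space M. rearrangement M f t < ennreal (norm (f x))}"
    then have "r < norm (f x)" using real by (simp add: ennreal_less_iff)
    then obtain n where "1 / real (Suc n) < norm (f x) - r"
      using reals_Archimedean[of "norm (f x) - r"] by (auto simp: inverse_eq_divide)
    then have "r + 1 / real (Suc n) < norm (f x)" by linarith
    then have "ennreal (r + 1 / real (Suc n)) < ennreal (norm (f x))"
      using \<open>r < norm (f x)\<close> real(1) by (intro ennreal_lessI) linarith+
    then have "x \<in> A n" using x by (simp add: A_def)
    then show "x \<in> (\<Union>n. A n)" by blast
  qed
  ultimately have "emeasure M {x \<in> space M. rearrangement M f t < ennreal (norm (f x))} = (SUP n. emeasure M (A n))"
    using SUP_emeasure_incseq[of A M] Am by (metis image_subsetI)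
  then show ?thesis using A_le by (simp add: SUP_least)
qed

text \<open>
  The \<open>k\<close>-th height is exceeded at more than \<open>k\<close> indices, so new indices can
  be chosen one after the other. Vanishing heights are allowed, because any unused index serves for
  them. This replaces an enumeration of the sequence in decreasing order, which need not exist.
\<close>

lemma exists_finite_set_dominating:
  fixes c :: "'n \<Rightarrow> 'x::real_normed_vector" and t :: "nat \<Rightarrow> real"
  assumes inf: "infinite (UNIV :: 'n set)"
    and t: "\<And>k. k < N \<Longrightarrow> t k = 0 \<or> (0 < t k \<and> ennreal (t k) < rearrangement (count_space UNIV) c (real k))"
    and P: "0 < P"
  shows "\<exists>B. finite B \<and> card B = N \<and> (\<Sum>k<N. t k powr P) \<le> (\<Sum>n\<in>B. norm (c n) powr P)"
  using t
proof (induction N)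
  case 0
  then show ?case by (intro exI[of _ "{}"]) auto
next
  case (Suc N)
  have "\<exists>B. finite B \<and> card B = N \<and> (\<Sum>k<N. t k powr P) \<le> (\<Sum>n\<in>B. norm (c n) powr P)"
    by (rule Suc.IH) (rule Suc.prems, simp)
  then obtain B where B: "finite B" "card B = N" "(\<Sum>k<N. t k powr P) \<le> (\<Sum>n\<in>B. norm (c n) powr P)" by blast
  have "\<exists>n. n \<notin> B \<and> t N powr P \<le> norm (c n) powr P"
  proof (cases "t N = 0")
    case True
    obtain n where "n \<notin> B" using ex_new_if_finite[OF inf B(1)] by blast
    then show ?thesis using True by auto
  next
    case False
    then have tN: "0 < t N" "ennreal (t N) < rearrangement (count_space UNIV) c (real N)" using Suc.prems[of N] by auto
    let ?A = "{n. ennreal (t N) < ennreal (norm (c n))}"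
    have "ennreal (real N) < emeasure (count_space UNIV) ?A"
      using emeasure_gt_of_less_rearrangement[OF tN(2)] by simp
    then have "\<not> ?A \<subseteq> B"
    proof (rule contrapos_pn)
      assume AB: "?A \<subseteq> B"
      have fin: "finite ?A" by (rule finite_subset[OF AB B(1)])
      have "card ?A \<le> N" using card_mono[OF B(1) AB] B(2) by simp
      moreover have "emeasure (count_space UNIV) ?A = ennreal (real (card ?A))"
        using fin by (subst emeasure_count_space_finite) (simp_all add: ennreal_of_nat_eq_real_of_nat)
      ultimately have "emeasure (count_space UNIV) ?A \<le> ennreal (real N)" by (simp add: ennreal_leI)
      then show "\<not> ennreal (real N) < emeasure (count_space UNIV) ?A" by (simp add: not_less)
    qed
    then obtain n where "n \<notin> B" "ennreal (t N) < ennreal (norm (c n))" by blast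
    moreover from this have "t N powr P \<le> norm (c n) powr P" using tN P by (intro powr_mono2) (auto simp: ennreal_less_iff)
    ultimately show ?thesis by blast
  qed
  then obtain n where n: "n \<notin> B" "t N powr P \<le> norm (c n) powr P" by blast
  have "(\<Sum>k<Suc N. t k powr P) \<le> (\<Sum>n\<in>insert n B. norm (c n) powr P)"
    using add_mono[OF n(2) B(3)] n(1) B(1) by (simp add: add.commute)
  then show ?case using B n(1) by (intro exI[of _ "insert n B"]) simp
qed

text \<open>
  Cauchy condensation: each dyadic block of a decreasing sequence dominates its last term times its
  length.
\<close>

lemma dyadic_sum_le:
  fixes c :: "nat \<Rightarrow> real"
  assumes c: "\<And>k. 0 \<le> c k" "antimono c"
  shows "(\<Sum>i\<le>j. 2 ^ i * c (2 ^ i - 1)) \<le> 2 * (\<Sum>k<2 ^ j. c k)"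
proof (induction j)
  case 0
  then show ?case using c(1)[of 0] by simp
next
  case (Suc j)
  have "card {2 ^ j..<2 ^ Suc j :: nat} = 2 ^ j" unfolding card_atLeastLessThan by simp
  then have "(2::real) ^ j * c (2 ^ Suc j - 1) = (\<Sum>k\<in>{2 ^ j..<2 ^ Suc j :: nat}. c (2 ^ Suc j - 1))"
    unfolding sum_constant by (simp only: of_nat_power of_nat_numeral)
  also have "\<dots> \<le> (\<Sum>k\<in>{2 ^ j..<2 ^ Suc j :: nat}. c k)"
  proof (rule sum_mono)
    fix k assume "k \<in> {2 ^ j..<2 ^ Suc j :: nat}"
    then have "k \<le> 2 ^ Suc j - 1" unfolding atLeastLessThan_iff by linarith
    then show "c (2 ^ Suc j - 1) \<le> c k" by (rule antimonoD[OF c(2)])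
  qed
  finally have 1: "(2::real) ^ j * c (2 ^ Suc j - 1) \<le> (\<Sum>k\<in>{2 ^ j..<2 ^ Suc j :: nat}. c k)" .
  have 2: "(\<Sum>k<2 ^ Suc j. c k) = (\<Sum>k<2 ^ j. c k) + (\<Sum>k\<in>{2 ^ j..<2 ^ Suc j :: nat}. c k)"
    unfolding lessThan_atLeast0 by (rule sum.atLeastLessThan_concat[symmetric]) simp_all
  have "(\<Sum>i\<le>Suc j. 2 ^ i * c (2 ^ i - 1)) = (\<Sum>i\<le>j. 2 ^ i * c (2 ^ i - 1)) + 2 * (2 ^ j * c (2 ^ Suc j - 1))"
    unfolding sum.atMost_Suc by (simp only: power_Suc mult.assoc)
  also have "\<dots> \<le> 2 * (\<Sum>k<2 ^ j. c k) + 2 * (\<Sum>k\<in>{2 ^ j..<2 ^ Suc j :: nat}. c k)"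
    by (intro add_mono Suc.IH mult_left_mono 1) auto
  also have "\<dots> = 2 * (\<Sum>k<2 ^ Suc j. c k)" unfolding 2 by (rule distrib_left[symmetric])
  finally show ?case .
qed

text \<open>
  Every value lies between two consecutive levels. The first part locates a value above the level
  \<open>j\<close> at an index \<open>\<ge> j\<close>, the second a value below it at an index
  \<open>< j\<close>.
\<close>

lemma level_pointwise_bounds:
  fixes g :: "nat \<Rightarrow> real" and x :: real
  assumes g0: "g 0 = 0" and g: "mono g" and x: "0 \<le> x"
  shows "x \<le> g m \<Longrightarrow> g j < x \<Longrightarrow> \<exists>i\<ge>j. g i < x \<and> x \<le> g (Suc i)"
    and "0 < x \<Longrightarrow> x \<le> g j \<Longrightarrow> \<exists>i<j. g i < x \<and> x \<le> g (Suc i)"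
proof -
  assume m: "x \<le> g m" "g j < x"
  define l where "l = (LEAST l. x \<le> g l)"
  have l: "x \<le> g l" unfolding l_def using m(1) by (rule LeastI)
  have "j < l" using l m(2) g by (metis leD monoD not_le_imp_less order_trans)
  then obtain i where i: "l = Suc i" "j \<le> i" by (cases l) auto
  have "\<not> x \<le> g i" using not_less_Least[of i "\<lambda>l. x \<le> g l"] i by (simp add: l_def)
  then show "\<exists>i\<ge>j. g i < x \<and> x \<le> g (Suc i)" using i l by (intro exI[of _ i]) auto
next
  assume m: "0 < x" "x \<le> g j"
  define l where "l = (LEAST l. x \<le> g l)"
  have l: "x \<le> g l" unfolding l_def using m(2) by (rule LeastI)
  have lj: "l \<le> j" unfolding l_def using m(2) by (rule Least_le)
  have "l \<noteq> 0"
  proof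
    assume "l = 0"
    then have "x \<le> g 0" using l by (simp only:)
    then show False using m(1) g0 by linarith
  qed
  then obtain i where i: "l = Suc i" by (cases l) auto
  have "\<not> x \<le> g i" using not_less_Least[of i "\<lambda>l. x \<le> g l"] i by (simp add: l_def)
  then show "\<exists>i<j. g i < x \<and> x \<le> g (Suc i)" using i l lj by (intro exI[of _ i]) auto
qed

text \<open>
  On the set where the norm lies between the levels \<open>i\<close> and \<open>i + 1\<close> it is at
  most the upper level, and that set has measure at most \<open>1 / 2\<^sup>i\<close>. The points
  above all levels form a null set.
\<close>

lemma rearrangement_level_splitting:
  fixes f :: "'a \<Rightarrow> 'x::real_normed_vector" and g :: "nat \<Rightarrow> real"
  assumes f: "(\<lambda>x. norm (f x)) \<in> borel_measurable M"
    and g0: "g 0 = 0" and g: "mono g"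
    and lev: "\<And>i. emeasure M {x \<in> space M. g i < norm (f x)} \<le> ennreal (1 / 2 ^ i)"
    and p: "0 < p"
  shows "(\<And>J. (\<Sum>i=j..J. g (Suc i) / 2 ^ i) \<le> h) \<Longrightarrow>
      (\<integral>\<^sup>+x. ennreal (if g j < norm (f x) then norm (f x) else 0) \<partial>M) \<le> ennreal h"
    and "(\<integral>\<^sup>+x. ennreal ((if norm (f x) \<le> g j then norm (f x) else 0) powr p) \<partial>M) \<le> ennreal (\<Sum>i<j. g (Suc i) powr p / 2 ^ i)"
proof -
  define A where "A i = {x \<in> space M. g i < norm (f x)}" for i
  have Am: "A i \<in> sets M" for i
    unfolding A_def by (rule borel_measurable_less[OF borel_measurable_const f])
  have lev': "emeasure M (A i) \<le> ennreal (1 / 2 ^ i)" for i using lev by (simp add: A_def)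
  have gp: "0 \<le> g i" for i using monoD[OF g, of 0 i] g0 by simp
  {
    assume h: "\<And>J. (\<Sum>i=j..J. g (Suc i) / 2 ^ i) \<le> h"
    have null: "AE x in M. \<exists>m. norm (f x) \<le> g m"
    proof -
      have small: "emeasure M (\<Inter>i. A i) \<le> ennreal e" if e: "0 < e" for e :: real
      proof -
        have "(1/2 :: real) < 1" by simp
        from real_arch_pow_inv[OF e this] obtain i where "(1/2 :: real) ^ i < e" ..
        then have "1 / 2 ^ i \<le> e" unfolding power_one_over by (rule less_imp_le)
        then have e_i: "ennreal (1 / 2 ^ i) \<le> ennreal e" by (rule ennreal_leI)
        have "emeasure M (\<Inter>i. A i) \<le> emeasure M (A i)" by (rule emeasure_mono[OF _ Am]) (rule INT_lower, simp)
        then show ?thesis by (rule order_trans[OF _ order_trans[OF lev' e_i]])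
      qed
      have "emeasure M (\<Inter>i. A i) \<le> 0"
      proof (rule ennreal_le_epsilon)
        fix e :: real assume "0 < e"
        then show "emeasure M (\<Inter>i. A i) \<le> 0 + ennreal e" unfolding add_0_left by (rule small)
      qed
      then have z: "emeasure M (\<Inter>i. A i) = 0" unfolding le_zero_eq .
      have "range A \<subseteq> sets M" by (rule image_subsetI) (rule Am)
      then have "(\<Inter>i. A i) \<in> sets M" by (rule sets.countable_INT[OF _ UNIV_not_empty])
      with z have "(\<Inter>i. A i) \<in> null_sets M" by (rule null_setsI)
      moreover have "{x \<in> space M. \<not> (\<exists>m. norm (f x) \<le> g m)} \<subseteq> (\<Inter>i. A i)"
        unfolding A_def not_ex not_le by blast
      ultimately show ?thesis by (rule AE_I')
    qed
    have "(\<integral>\<^sup>+x. ennreal (if g j < norm (f x) then norm (f x) else 0) \<partial>M) \<le>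
        (\<integral>\<^sup>+x. (\<Sum>i. ennreal (if j \<le> i then g (Suc i) else 0) * indicator (A i) x) \<partial>M)"
    proof (rule nn_integral_mono_AE)
      show "AE x in M. ennreal (if g j < norm (f x) then norm (f x) else 0) \<le> (\<Sum>i. ennreal (if j \<le> i then g (Suc i) else 0) * indicator (A i) x)"
        using null AE_space
      proof eventually_elim
        case (elim x)
        show ?case
        proof (cases "g j < norm (f x)")
          case True
          obtain i where i: "j \<le> i" "g i < norm (f x)" "norm (f x) \<le> g (Suc i)"
            using level_pointwise_bounds(1)[OF g0 g norm_ge_zero _ True] elim(1) by blast
          have "ennreal (norm (f x)) \<le> ennreal (if j \<le> i then g (Suc i) else 0) * indicator (A i) x"
            using i elim(2) by (simp add: A_def ennreal_leI)
          also have "\<dots> \<le> (\<Sum>i. ennreal (if j \<le> i then g (Suc i) else 0) * indicator (A i) x)" (is "?F i \<le> _")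
            using sum_le_suminf[of ?F "{i}"] by (simp only: sum.insert sum.empty finite.emptyI finite.insertI
                empty_iff not_False_eq_True add_0_right zero_le summableI ball_simps simp_thms)
          finally show ?thesis using True by simp
        qed simp
      qed
    qed
    also have "\<dots> = (\<Sum>i. ennreal (if j \<le> i then g (Suc i) else 0) * emeasure M (A i))"
      using Am by (subst nn_integral_suminf) (auto simp: nn_integral_cmult_indicator)
    also have "\<dots> \<le> (\<Sum>i. ennreal (if j \<le> i then g (Suc i) / 2 ^ i else 0))"
    proof (intro suminf_le summableI allI)
      fix i
      have "ennreal (if j \<le> i then g (Suc i) else 0) * emeasure M (A i) \<le> ennreal (if j \<le> i then g (Suc i) else 0) * ennreal (1 / 2 ^ i)"
        by (intro mult_left_mono lev') auto
      also have "\<dots> = ennreal ((if j \<le> i then g (Suc i) else 0) * (1 / 2 ^ i))"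
        using gp by (intro ennreal_mult[symmetric]) auto
      also have "(if j \<le> i then g (Suc i) else 0) * (1 / 2 ^ i) = (if j \<le> i then g (Suc i) / 2 ^ i else 0)" by simp
      finally show "ennreal (if j \<le> i then g (Suc i) else 0) * emeasure M (A i) \<le> ennreal (if j \<le> i then g (Suc i) / 2 ^ i else 0)" .
    qed
    also have "\<dots> \<le> ennreal h"
    proof (subst suminf_eq_SUP, intro SUP_least)
      fix n
      have "(\<Sum>i<n. ennreal (if j \<le> i then g (Suc i) / 2 ^ i else 0)) = ennreal (\<Sum>i<n. if j \<le> i then g (Suc i) / 2 ^ i else 0)"
        using gp by (intro sum_ennreal) auto
      also have "(\<Sum>i<n. if j \<le> i then g (Suc i) / 2 ^ i else 0) \<le> (\<Sum>i=j..n. g (Suc i) / 2 ^ i)"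
        using gp unfolding sum.inter_filter[symmetric, OF finite_lessThan] by (intro sum_mono2) auto
      also have "\<dots> \<le> h" by (rule h)
      finally show "(\<Sum>i<n. ennreal (if j \<le> i then g (Suc i) / 2 ^ i else 0)) \<le> ennreal h" by (simp add: ennreal_leI)
    qed
    finally show "(\<integral>\<^sup>+x. ennreal (if g j < norm (f x) then norm (f x) else 0) \<partial>M) \<le> ennreal h" .
  }
  have "(\<integral>\<^sup>+x. ennreal ((if norm (f x) \<le> g j then norm (f x) else 0) powr p) \<partial>M) \<le>
      (\<integral>\<^sup>+x. (\<Sum>i<j. ennreal (g (Suc i) powr p) * indicator (A i) x) \<partial>M)"
  proof (rule nn_integral_mono)
    fix x assume xM: "x \<in> space M"
    show "ennreal ((if norm (f x) \<le> g j then norm (f x) else 0) powr p) \<le> (\<Sum>i<j. ennreal (g (Suc i) powr p) * indicator (A i) x)"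
    proof (cases "0 < norm (f x) \<and> norm (f x) \<le> g j")
      case True
      then obtain i where i: "i < j" "g i < norm (f x)" "norm (f x) \<le> g (Suc i)"
        using level_pointwise_bounds(2)[OF g0 g norm_ge_zero] by blast
      have "ennreal (norm (f x) powr p) \<le> ennreal (g (Suc i) powr p)"
        using i p by (intro ennreal_leI powr_mono2) auto
      also have "\<dots> = ennreal (g (Suc i) powr p) * indicator (A i) x" using i xM by (simp add: A_def)
      also have "\<dots> \<le> (\<Sum>i<j. ennreal (g (Suc i) powr p) * indicator (A i) x)"
        using i(1) by (intro member_le_sum) auto
      finally show ?thesis using True by simp
    qed auto
  qed
  also have "\<dots> = (\<Sum>i<j. ennreal (g (Suc i) powr p) * emeasure M (A i))"
    using Am by (subst nn_integral_sum) (auto simp: nn_integral_cmult_indicator)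
  also have "\<dots> \<le> (\<Sum>i<j. ennreal (g (Suc i) powr p) * ennreal (1 / 2 ^ i))"
    by (intro sum_mono mult_left_mono lev') auto
  also have "\<dots> = (\<Sum>i<j. ennreal (g (Suc i) powr p / 2 ^ i))"
    by (intro sum.cong refl) (simp flip: ennreal_mult)
  also have "\<dots> = ennreal (\<Sum>i<j. g (Suc i) powr p / 2 ^ i)" by (intro sum_ennreal) simp
  finally show "(\<integral>\<^sup>+x. ennreal ((if norm (f x) \<le> g j then norm (f x) else 0) powr p) \<partial>M) \<le> ennreal (\<Sum>i<j. g (Suc i) powr p / 2 ^ i)" .
qed

lemma infinite_UNIV_int_vec: "infinite (UNIV :: (int ^ 'd::finite) set)"
proof
  assume fin: "finite (UNIV :: (int ^ 'd) set)"
  have "inj (\<lambda>k::int. (\<chi> i. k) :: int ^ 'd)" by (rule injI) (simp add: vec_eq_iff)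
  then have "finite (UNIV :: int set)" using fin by (rule finite_imageD[OF finite_subset[OF subset_UNIV], rotated])
  then show False using infinite_UNIV_int by simp
qed

lemma norm_fourier_coeff_le:
  fixes f :: "real ^ 'd::finite \<Rightarrow> 'x::complex_banach"
  assumes f: "strongly_measurable torus f" and h: "(\<integral>\<^sup>+t. ennreal (norm (f t)) \<partial>torus) \<le> ennreal h" and h0: "0 \<le> h"
  shows "norm (fourier_coeff f n) \<le> h"
proof -
  have fin: "(\<integral>\<^sup>+t. ennreal (norm (f t)) \<partial>torus) < \<infinity>" using h by (rule le_less_trans) simp
  have "ennreal (norm (fourier_coeff f n)) \<le> (\<integral>\<^sup>+t. ennreal (norm (cis (- 2 * pi * (t \<bullet> (\<chi> i. real_of_int (n $ i)))) *\<^sub>C f t)) \<partial>torus)"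
    by (rule has_Bochner_integral_norm_le[OF complete_measure_torus has_Bochner_integral_fourier_coeff[OF f fin]])
  also have "\<dots> \<le> ennreal h" using h by (simp add: norm_scaleC)
  finally show ?thesis using h0 by (subst (asm) ennreal_le_iff) auto
qed

lemma emeasure_torus_le:
  fixes A :: "(real ^ 'd::finite) set"
  shows "emeasure torus A \<le> 1"
proof -
  let ?T = "torus :: (real ^ 'd) measure"
  have "(unit_cube :: (real ^ 'd) set) \<in> sets borel" by (rule unit_cube_sets(2))
  have "emeasure ?T A \<le> emeasure ?T (space ?T)" by (rule emeasure_space)
  also have "emeasure ?T (space ?T) = emeasure lebesgue (unit_cube :: (real ^ 'd) set)"
    unfolding torus_eq by (simp add: emeasure_restrict_space unit_cube_sets)
  also have "\<dots> = emeasure lborel (unit_cube :: (real ^ 'd) set)"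
    using \<open>(unit_cube :: (real ^ 'd) set) \<in> sets borel\<close> by simp
  also have "\<dots> = 1" by (rule emeasure_unit_cube)
  finally show ?thesis .
qed

text \<open>
  In particular, membership in the Lorentz-Zygmund space implies integrability, because the sums on
  the left bound the \<open>L\<^sup>1\<close> norm.
\<close>

lemma geometric_sum_bounded_of_weighted_bound:
  fixes A :: "nat \<Rightarrow> real"
  assumes \<theta>: "0 < \<theta>" "\<theta> < 1" and A: "\<And>i. 0 \<le> A i" "\<And>i. real (Suc i) powr c * A i \<le> m"
  shows "\<exists>H. \<forall>J. (\<Sum>i\<le>J. \<theta> ^ i * A i) \<le> H"
proof -
  obtain K where K: "K > 0" "\<And>n. (\<Sum>i\<le>n. \<theta> ^ i * real (Suc i) powr (-c)) \<le> K"
    using geometric_powr_sum_le[OF \<theta>] by blast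
  have m0: "0 \<le> m" using A(2)[of 0] A(1)[of 0] by simp
  have "(\<Sum>i\<le>J. \<theta> ^ i * A i) \<le> m * K" for J
  proof -
    have "(\<Sum>i\<le>J. \<theta> ^ i * A i) \<le> (\<Sum>i\<le>J. \<theta> ^ i * (m * real (Suc i) powr (-c)))"
    proof (intro sum_mono mult_left_mono)
      fix i
      have "A i = real (Suc i) powr c * real (Suc i) powr (-c) * A i" by (simp flip: powr_add)
      also have "\<dots> = (real (Suc i) powr c * A i) * real (Suc i) powr (-c)" by (simp only: mult_ac)
      also have "\<dots> \<le> m * real (Suc i) powr (-c)" by (intro mult_right_mono A(2)) simp
      finally show "A i \<le> m * real (Suc i) powr (-c)" .
    qed (use \<theta> in simp)
    also have "\<dots> = m * (\<Sum>i\<le>J. \<theta> ^ i * real (Suc i) powr (-c))" by (simp only: sum_distrib_left mult_ac)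
    also have "\<dots> \<le> m * K" by (intro mult_left_mono K m0)
    finally show ?thesis .
  qed
  then show ?thesis by blast
qed

text \<open>
  Up to constants, the values of \<open>t\<^sup>1\<^sup>/\<^sup>p f\<^sup>*(t)\<close> at the dyadic
  points \<open>1 / 2\<^sup>i\<^sup>+\<^sup>1\<close>. The point \<open>1\<close> is left out, since
  the rearrangement vanishes there: the torus has measure \<open>1\<close>.
\<close>

definition dyadic_function_level :: "real \<Rightarrow> (real ^ 'd::finite \<Rightarrow> 'x::real_normed_vector) \<Rightarrow> nat \<Rightarrow> real" where
  "dyadic_function_level p f i = 2 powr (- real i / p) * enn2real (rearrangement torus f (1 / 2 ^ Suc i))"

text \<open>
  The values of \<open>k\<^sup>1\<^sup>/\<^sup>P x\<^sup>*\<^sub>k\<close> at \<open>k =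
  2\<^sup>i\<close>. Rearrangements with respect to counting measure start at \<open>0\<close>, which
  explains the \<open>- 1\<close>.
\<close>

definition dyadic_sequence_level :: "real \<Rightarrow> (int ^ 'd::finite \<Rightarrow> 'x::real_normed_vector) \<Rightarrow> nat \<Rightarrow> real" where
  "dyadic_sequence_level P x i = 2 powr (real i / P) * enn2real (rearrangement (count_space UNIV) x (real (2 ^ i - 1)))"

lemma dyadic_level_nonneg: "0 \<le> dyadic_function_level p f i" "0 \<le> dyadic_sequence_level P x i"
  by (simp_all add: dyadic_function_level_def dyadic_sequence_level_def)

text \<open>
  Cut \<open>f\<close> at its level \<open>j\<close>. Each of \<open>2\<^sup>j\<close> chosen
  coefficients is at most \<open>\<theta>\<^sup>j H\<close>, which bounds the \<open>L\<^sup>1\<close>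
  norm of the high part, plus the coefficient of the low part. In the \<open>\<ell>\<^sup>P\<close>
  norm over these indices the first contributes \<open>H\<close>, because \<open>\<theta>\<^sup>P =
  1/2\<close>, and the second is controlled by the \<open>L\<^sup>p\<close> endpoint.
\<close>

lemma fourier_coeff_dyadic_estimate:
  fixes f :: "real ^ 'd::finite \<Rightarrow> 'x::complex_banach" and p K :: real
  defines "P \<equiv> p / (p - 1)"
  defines "\<theta> \<equiv> 2 powr (- 1 / (p / (p - 1)))"
  assumes p: "1 < p" and Kb: "fourier_coeff_Lp_constant TYPE('d) TYPE('x) p K"
    and f: "strongly_measurable torus f"
    and fin: "\<And>i. rearrangement torus f (1 / 2 ^ Suc i) < \<infinity>"
    and weighted: "\<And>i. real (Suc i) powr s * dyadic_function_level p f i \<le> m"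
  shows "Bochner_integrable torus f"
    and "\<And>t. rearrangement (count_space UNIV) (fourier_coeff f) t < \<infinity>"
    and "(\<And>J. (\<Sum>i=j..J. \<theta> ^ (i - j) * dyadic_function_level p f i) \<le> H) \<Longrightarrow>
       (\<Sum>i\<le>j. dyadic_sequence_level P (fourier_coeff f) i powr P) powr (1 / P)
       \<le> (16 * (1 + K)) * (H + (\<Sum>i\<le>j. dyadic_function_level p f i powr p) powr (1 / p))"
proof -
  define A where "A = dyadic_function_level p f"
  define c where "c k = enn2real (rearrangement (count_space UNIV) (fourier_coeff f) (real k))" for k
  have K: "0 \<le> K" using Kb by (simp add: fourier_coeff_Lp_constant_def)
  have Kb': "(\<Sum>n\<in>B. norm (fourier_coeff u n) powr P) powr (1 / P) \<le> K * I powr (1 / p)"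
    if "strongly_measurable torus u" "\<And>t. norm (u t) \<le> b" "finite B"
      "0 \<le> I" "(\<integral>\<^sup>+t. ennreal (norm (u t) powr p) \<partial>torus) \<le> ennreal I"
    for u :: "real ^ 'd \<Rightarrow> 'x" and b B I
    using Kb that unfolding fourier_coeff_Lp_constant_def conj_exponent_def P_def by blast
  define g where "g i = enn2real (rearrangement torus f (1 / 2 ^ i))" for i
  have P: "1 < P" and pP: "1 / p + 1 / P = 1" using p by (auto simp: P_def field_simps)
  have nf: "(\<lambda>t. norm (f t)) \<in> borel_measurable torus" by (rule strongly_measurable_norm[OF complete_measure_torus f])
  \<comment> \<open>The torus has measure \<open>1\<close>, so the lowest level is \<open>0\<close> and every nonzero value lies above it.\<close>
  have r0: "rearrangement torus f (1 / 2 ^ 0) = 0"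
  proof -
    have "rearrangement torus f (1 / 2 ^ 0) \<le> 0"
      unfolding rearrangement_def by (rule Inf_lower) (simp add: emeasure_torus_le)
    then show ?thesis by simp
  qed
  have fin': "rearrangement torus f (1 / 2 ^ i) < \<infinity>" for i
    using fin[of "i - 1"] r0 by (cases i) auto
  have ge: "rearrangement torus f (1 / 2 ^ i) = ennreal (g i)" for i
    unfolding g_def using fin'[of i] by (simp add: ennreal_enn2real_if less_top)
  have g0: "g 0 = 0" unfolding g_def r0 by simp
  have gnn: "0 \<le> g i" for i by (simp add: g_def)
  have gm: "mono g"
  proof (rule monoI)
    fix i k :: nat assume "i \<le> k"
    then have "(1::real) / 2 ^ k \<le> 1 / 2 ^ i" by (intro divide_left_mono power_increasing) auto
    then have "rearrangement torus f (1 / 2 ^ i) \<le> rearrangement torus f (1 / 2 ^ k)" by (rule rearrangement_antimono)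
    then show "g i \<le> g k" unfolding ge using gnn by (subst (asm) ennreal_le_iff) auto
  qed
  have lev: "emeasure torus {x \<in> space torus. g i < norm (f x)} \<le> ennreal (1 / 2 ^ i)" for i
  proof -
    have "{x \<in> space torus. g i < norm (f x)} = {x \<in> space torus. rearrangement torus f (1 / 2 ^ i) < ennreal (norm (f x))}"
      unfolding ge using gnn by (simp add: ennreal_less_iff)
    then show ?thesis using emeasure_above_rearrangement_le[OF nf, of "1 / 2 ^ i"] by simp
  qed
  have p0: "0 < p" using p by simp
  note split_level = rearrangement_level_splitting[OF nf g0 gm lev p0]
  have Ag: "A i = 2 powr (- real i / p) * g (Suc i)" for i by (simp add: A_def dyadic_function_level_def g_def)
  have A0: "0 \<le> A i" for i unfolding A_def by (rule dyadic_level_nonneg)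
  have th: "\<theta> ^ i = 2 powr (- real i / P)" for i
    unfolding \<theta>_def P_def[symmetric] by (simp add: powr_realpow[symmetric] powr_powr)
  have th0: "0 < \<theta>" by (simp add: \<theta>_def)
  have "\<theta> < 1" unfolding \<theta>_def by (rule dyadic_ratio_less_1[OF p])
  from geometric_sum_bounded_of_weighted_bound[where A = A, OF th0 this A0 weighted[folded A_def]]
  obtain H0 where H0: "\<And>J. (\<Sum>i\<le>J. \<theta> ^ i * A i) \<le> H0" by blast
  have two: "2 powr (- real i) = 1 / 2 ^ i" for i by (simp add: powr_minus powr_realpow inverse_eq_divide)
  have Ag1: "g (Suc i) / 2 ^ i = \<theta> ^ i * A i" for i
  proof -
    have "- real i / P + - real i / p = - real i * (1 / p + 1 / P)" by (simp add: algebra_simps)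
    then have "\<theta> ^ i * A i = 2 powr (- real i) * g (Suc i)"
      unfolding th Ag pP by (simp flip: powr_add add: mult.assoc[symmetric])
    then show ?thesis unfolding two by simp
  qed
  have Agp: "g (Suc i) powr p / 2 ^ i = A i powr p" for i
  proof -
    have "A i powr p = 2 powr (- real i) * g (Suc i) powr p" using p0 by (simp add: Ag powr_mult powr_powr)
    then show ?thesis unfolding two by simp
  qed
  have f_le: "(\<integral>\<^sup>+t. ennreal (norm (f t)) \<partial>torus) \<le> ennreal H0"
  proof -
    have "(\<integral>\<^sup>+t. ennreal (norm (f t)) \<partial>torus) = (\<integral>\<^sup>+t. ennreal (if g 0 < norm (f t) then norm (f t) else 0) \<partial>torus)"
      by (intro nn_integral_cong) (simp add: g0)
    also have "\<dots> \<le> ennreal H0"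
      by (rule split_level(1)) (use H0 in \<open>simp add: Ag1 atMost_atLeast0\<close>)
    finally show ?thesis .
  qed
  have H00: "0 \<le> H0" using H0[of 0] A0[of 0] by simp
  show "Bochner_integrable torus f"
    by (rule Bochner_integrableI[OF complete_measure_torus f]) (rule le_less_trans[OF f_le], simp)
  have "rearrangement (count_space UNIV) (fourier_coeff f) t \<le> ennreal H0" for t
    by (rule rearrangement_le_bound) (rule norm_fourier_coeff_le[OF f f_le H00])
  then show rfin: "rearrangement (count_space UNIV) (fourier_coeff f) t < \<infinity>" for t
    by (rule le_less_trans) simp
  assume "\<And>J. (\<Sum>i=j..J. \<theta> ^ (i - j) * dyadic_function_level p f i) \<le> H"
  then have H: "\<And>J. (\<Sum>i=j..J. \<theta> ^ (i - j) * A i) \<le> H" unfolding A_def .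
  have Hnn: "0 \<le> H" using H[of j] A0[of j] by simp
  define Y where "Y = (\<Sum>i\<le>j. A i powr p) powr (1 / p)"
  have Y: "0 \<le> Y" by (simp add: Y_def)
  define Z where "Z = H + K * Y"
  have Z: "0 \<le> Z" using Hnn K Y by (simp add: Z_def)
  define f0 where "f0 t = (if g j < norm (f t) then 1 else 0) *\<^sub>R f t" for t
  define f1 where "f1 t = (if g j < norm (f t) then 0 else 1) *\<^sub>R f t" for t
  have sm: "{t \<in> space torus. g j < norm (f t)} \<in> sets torus"
    by (rule borel_measurable_less[OF borel_measurable_const nf])
  have f0m: "strongly_measurable torus f0"
    unfolding f0_def[abs_def] by (rule strongly_measurable_scaleR[OF measurable_If[OF measurable_const measurable_const sm] f]) auto
  have f1m: "strongly_measurable torus f1"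
    unfolding f1_def[abs_def] by (rule strongly_measurable_scaleR[OF measurable_If[OF measurable_const measurable_const sm] f]) auto
  have f01: "f t = f0 t + f1 t" for t by (simp add: f0_def f1_def)
  define a where "a = \<theta> ^ j * H"
  have a: "0 \<le> a" using th0 Hnn by (simp add: a_def)
  have f0_le: "(\<integral>\<^sup>+t. ennreal (norm (f0 t)) \<partial>torus) \<le> ennreal a"
  proof -
    have "(\<integral>\<^sup>+t. ennreal (norm (f0 t)) \<partial>torus) = (\<integral>\<^sup>+t. ennreal (if g j < norm (f t) then norm (f t) else 0) \<partial>torus)"
      by (intro nn_integral_cong) (simp add: f0_def)
    also have "\<dots> \<le> ennreal a"
    proof (rule split_level(1))
      fix J
      have "(\<Sum>i=j..J. g (Suc i) / 2 ^ i) = (\<Sum>i=j..J. \<theta> ^ j * (\<theta> ^ (i - j) * A i))"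
        unfolding Ag1 by (intro sum.cong refl) (simp flip: power_add mult.assoc)
      also have "\<dots> \<le> a" unfolding a_def sum_distrib_left[symmetric] using th0 by (intro mult_left_mono H) simp
      finally show "(\<Sum>i=j..J. g (Suc i) / 2 ^ i) \<le> a" .
    qed
    finally show ?thesis .
  qed
  have c0: "norm (fourier_coeff f0 n) \<le> a" for n by (rule norm_fourier_coeff_le[OF f0m f0_le a])
  have f1_b: "norm (f1 t) \<le> g j" for t using gnn[of j] by (simp add: f1_def)
  have f1_le: "(\<integral>\<^sup>+t. ennreal (norm (f1 t) powr p) \<partial>torus) \<le> ennreal (\<Sum>i<j. A i powr p)"
  proof -
    have "(\<integral>\<^sup>+t. ennreal (norm (f1 t) powr p) \<partial>torus) = (\<integral>\<^sup>+t. ennreal ((if norm (f t) \<le> g j then norm (f t) else 0) powr p) \<partial>torus)"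
      by (intro nn_integral_cong) (simp add: f1_def)
    also have "\<dots> \<le> ennreal (\<Sum>i<j. A i powr p)" using split_level(2)[of j] unfolding Agp .
    finally show ?thesis .
  qed
  have c1: "(\<Sum>n\<in>B. norm (fourier_coeff f1 n) powr P) \<le> (K * Y) powr P" if B: "finite B" for B
  proof -
    define S where "S = (\<Sum>n\<in>B. norm (fourier_coeff f1 n) powr P)"
    have S0: "0 \<le> S" by (simp add: S_def sum_nonneg)
    have "S powr (1 / P) \<le> K * (\<Sum>i<j. A i powr p) powr (1 / p)"
      unfolding S_def by (rule Kb'[OF f1m f1_b B _ f1_le]) (simp add: sum_nonneg)
    also have "\<dots> \<le> K * Y"
      unfolding Y_def using K p0 by (intro mult_left_mono powr_mono2 sum_mono2 sum_nonneg) auto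
    finally have "(S powr (1 / P)) powr P \<le> (K * Y) powr P" using P by (intro powr_mono2) auto
    then show ?thesis using S0 P by (simp add: powr_powr S_def)
  qed
  have csum: "fourier_coeff f n = fourier_coeff f0 n + fourier_coeff f1 n" for n
  proof -
    let ?e = "\<lambda>t :: real ^ 'd. cis (- 2 * pi * (t \<bullet> (\<chi> i. real_of_int (n $ i))))"
    have finf: "(\<integral>\<^sup>+t. ennreal (norm (f t)) \<partial>torus) < \<infinity>" by (rule le_less_trans[OF f_le]) simp
    have fin0: "(\<integral>\<^sup>+t. ennreal (norm (f0 t)) \<partial>torus) < \<infinity>" by (rule le_less_trans[OF f0_le]) simp
    have "(\<integral>\<^sup>+t. ennreal (norm (f1 t)) \<partial>torus) \<le> (\<integral>\<^sup>+t. ennreal (norm (f t)) \<partial>torus)"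
      by (intro nn_integral_mono ennreal_leI) (simp add: f1_def)
    then have fin1: "(\<integral>\<^sup>+t. ennreal (norm (f1 t)) \<partial>torus) < \<infinity>" by (rule le_less_trans[OF _ finf])
    have "has_Bochner_integral torus (\<lambda>t. ?e t *\<^sub>C f0 t + ?e t *\<^sub>C f1 t) (fourier_coeff f0 n + fourier_coeff f1 n)"
      by (rule has_Bochner_integral_add[OF complete_measure_torus has_Bochner_integral_fourier_coeff[OF f0m fin0] has_Bochner_integral_fourier_coeff[OF f1m fin1]])
    then have "has_Bochner_integral torus (\<lambda>t. ?e t *\<^sub>C f t) (fourier_coeff f0 n + fourier_coeff f1 n)"
      unfolding f01 scaleC.add_right .
    then show ?thesis by (rule has_Bochner_integral_unique[OF complete_measure_torus has_Bochner_integral_fourier_coeff[OF f finf]])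
  qed
  have ce: "rearrangement (count_space UNIV) (fourier_coeff f) (real k) = ennreal (c k)" for k
    unfolding c_def using rfin[of "real k"] by (simp add: ennreal_enn2real_if less_top)
  have cnn: "0 \<le> c k" for k by (simp add: c_def)
  have canti: "antimono (\<lambda>k. c k powr P)"
  proof (rule antimonoI)
    fix k l :: nat assume "k \<le> l"
    then have "rearrangement (count_space UNIV) (fourier_coeff f) (real l) \<le> rearrangement (count_space UNIV) (fourier_coeff f) (real k)"
      by (intro rearrangement_antimono) simp
    then have "c l \<le> c k" unfolding ce using cnn by (subst (asm) ennreal_le_iff) auto
    then show "c l powr P \<le> c k powr P" using P cnn by (intro powr_mono2) auto
  qed
  \<comment> \<open>Half of each rearranged value is used, since only heights strictly below the rearrangement are known to be exceeded often enough.\<close>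
  have "\<exists>B. finite B \<and> card B = 2 ^ j \<and> (\<Sum>k<2 ^ j. (c k / 2) powr P) \<le> (\<Sum>n\<in>B. norm (fourier_coeff f n) powr P)"
  proof (rule exists_finite_set_dominating[OF infinite_UNIV_int_vec])
    fix k
    show "c k / 2 = 0 \<or> 0 < c k / 2 \<and> ennreal (c k / 2) < rearrangement (count_space UNIV) (fourier_coeff f) (real k)"
      unfolding ce using cnn[of k] by (auto intro!: ennreal_lessI)
  qed (use P in simp)
  then obtain B where B: "finite B" "card B = 2 ^ j"
    "(\<Sum>k<2 ^ j. (c k / 2) powr P) \<le> (\<Sum>n\<in>B. norm (fourier_coeff f n) powr P)" by blast
  \<comment> \<open>The number of chosen frequencies compensates the smallness of the \<open>L\<^sup>1\<close> norm of the high part exactly.\<close>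
  have aP: "2 ^ j * a powr P = H powr P"
  proof -
    have "a powr P = (2 powr (- real j / P)) powr P * H powr P" unfolding a_def th by (rule powr_mult)
    also have "(2 powr (- real j / P)) powr P = 2 powr (- real j)" using P by (simp add: powr_powr)
    finally show ?thesis unfolding two by simp
  qed
  have "(\<Sum>n\<in>B. norm (fourier_coeff f n) powr P) \<le> (\<Sum>n\<in>B. 2 powr P * (a powr P + norm (fourier_coeff f1 n) powr P))"
  proof (intro sum_mono)
    fix n
    have "norm (fourier_coeff f n) \<le> a + norm (fourier_coeff f1 n)"
      unfolding csum using norm_triangle_ineq[of "fourier_coeff f0 n" "fourier_coeff f1 n"] c0[of n] by linarith
    then have "norm (fourier_coeff f n) powr P \<le> (a + norm (fourier_coeff f1 n)) powr P" using P by (intro powr_mono2) auto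
    also have "\<dots> \<le> 2 powr P * (a powr P + norm (fourier_coeff f1 n) powr P)" using a P by (intro powr_add_le) auto
    finally show "norm (fourier_coeff f n) powr P \<le> \<dots>" .
  qed
  also have "\<dots> = 2 powr P * (2 ^ j * a powr P + (\<Sum>n\<in>B. norm (fourier_coeff f1 n) powr P))"
    unfolding sum_distrib_left[symmetric] sum.distrib sum_constant B(2) by simp
  also have "\<dots> \<le> 2 powr P * (Z powr P + Z powr P)"
  proof (intro mult_left_mono add_mono)
    show "2 ^ j * a powr P \<le> Z powr P" unfolding aP using Hnn K Y P by (intro powr_mono2) (auto simp: Z_def)
    have "(K * Y) powr P \<le> Z powr P" using Hnn K Y P by (intro powr_mono2) (auto simp: Z_def)
    then show "(\<Sum>n\<in>B. norm (fourier_coeff f1 n) powr P) \<le> Z powr P" using c1[OF B(1)] by linarith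
  qed simp
  finally have "(\<Sum>k<2 ^ j. (c k / 2) powr P) \<le> 2 powr P * (2 * Z powr P)" using B(3) by simp
  moreover have "(\<Sum>k<2 ^ j. c k powr P) = 2 powr P * (\<Sum>k<2 ^ j. (c k / 2) powr P)"
  proof -
    have "c k powr P = 2 powr P * (c k / 2) powr P" for k using powr_mult[of 2 "c k / 2" P] by simp
    then show ?thesis by (simp add: sum_distrib_left)
  qed
  ultimately have cs: "(\<Sum>k<2 ^ j. c k powr P) \<le> 2 powr P * (2 powr P * (2 * Z powr P))" by simp
  have D: "dyadic_sequence_level P (fourier_coeff f) i powr P = 2 ^ i * c (2 ^ i - 1) powr P" for i
    unfolding dyadic_sequence_level_def c_def[symmetric] using P by (simp add: powr_mult powr_powr powr_realpow)
  have four: "(4::real) \<le> 4 powr P" using powr_mono[of 1 P 4] P by simp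
  have "(\<Sum>i\<le>j. dyadic_sequence_level P (fourier_coeff f) i powr P) \<le> 2 * (\<Sum>k<2 ^ j. c k powr P)"
    unfolding D by (rule dyadic_sum_le[OF _ canti]) simp
  also have "\<dots> \<le> 2 * (2 powr P * (2 powr P * (2 * Z powr P)))" by (intro mult_left_mono cs) simp
  also have "\<dots> = 4 * (4 powr P * Z powr P)" using powr_mult[of 2 2 P] by simp
  also have "\<dots> \<le> 4 powr P * (4 powr P * Z powr P)" using four by (intro mult_right_mono) auto
  also have "\<dots> = (16 * Z) powr P" using powr_mult[of 4 "4 * Z" P] powr_mult[of 4 Z P] by simp
  finally have "(\<Sum>i\<le>j. dyadic_sequence_level P (fourier_coeff f) i powr P) powr (1 / P) \<le> ((16 * Z) powr P) powr (1 / P)"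
    using P by (intro powr_mono2 sum_nonneg) auto
  also have "\<dots> = 16 * Z" using P Z by (simp add: powr_powr)
  also have "\<dots> \<le> 16 * ((1 + K) * (H + Y))"
    using K Hnn Y unfolding Z_def by (intro mult_left_mono) (simp_all add: algebra_simps)
  finally show "(\<Sum>i\<le>j. dyadic_sequence_level P (fourier_coeff f) i powr P) powr (1 / P)
       \<le> (16 * (1 + K)) * (H + (\<Sum>i\<le>j. dyadic_function_level p f i powr p) powr (1 / p))"
    unfolding Y_def A_def by (simp only: mult.assoc)
qed

section \<open>Dyadic form of the Lorentz-Zygmund norms\<close>

text \<open>
  Stated with a factor \<open>3\<close> and for exponents of either sign, as the logarithmic weights
  occur with both.
\<close>

lemma powr_comparable:
  fixes m y c :: real
  assumes "0 < m" "y \<le> 3 * m" "m \<le> 3 * y"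
  shows "3 powr (- \<bar>c\<bar>) * m powr c \<le> y powr c" and "y powr c \<le> 3 powr \<bar>c\<bar> * m powr c"
proof -
  have y: "0 < y" using assms by linarith
  have a: "3 powr (- \<bar>c\<bar>) * m powr c \<le> y powr c" "y powr c \<le> 3 powr \<bar>c\<bar> * m powr c" if "0 \<le> c"
  proof -
    have "m powr c \<le> (3 * y) powr c" "y powr c \<le> (3 * m) powr c" using assms that y by (auto intro!: powr_mono2)
    then show "3 powr (- \<bar>c\<bar>) * m powr c \<le> y powr c" "y powr c \<le> 3 powr \<bar>c\<bar> * m powr c"
      using that by (simp_all add: powr_mult powr_minus field_simps)
  qed
  have b: "3 powr (- \<bar>c\<bar>) * m powr c \<le> y powr c" "y powr c \<le> 3 powr \<bar>c\<bar> * m powr c" if "c < 0"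
  proof -
    have "(3 * y) powr c \<le> m powr c" "(3 * m) powr c \<le> y powr c" using assms that y by (auto intro!: powr_mono2')
    then show "3 powr (- \<bar>c\<bar>) * m powr c \<le> y powr c" "y powr c \<le> 3 powr \<bar>c\<bar> * m powr c"
      using that by (simp_all add: powr_mult powr_minus field_simps)
  qed
  show "3 powr (- \<bar>c\<bar>) * m powr c \<le> y powr c" using a(1) b(1) by linarith
  show "y powr c \<le> 3 powr \<bar>c\<bar> * m powr c" using a(2) b(2) by linarith
qed

text \<open>
  On the dyadic block around \<open>1 / 2\<^sup>i\<^sup>+\<^sup>1\<close> the weight of the
  Lorentz-Zygmund norm is comparable to its dyadic form; \<open>1 + \<bar>ln t\<bar>\<close> lies
  within a factor \<open>3\<close> of \<open>i + 1\<close>.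
\<close>

lemma LZ_weight_lower_bound:
  fixes p c t :: real
  assumes p: "0 < p" and t: "1 / 2 ^ (i + 2) \<le> t" "t \<le> 1 / 2 ^ (i + 1)"
  shows "(4 powr (- 1 / p) * 3 powr (- \<bar>c\<bar>)) * (real (Suc i) powr c * 2 powr (- real i / p))
    \<le> t powr (1 / p) * (1 + \<bar>ln t\<bar>) powr c"
proof -
  have t0: "0 < t" using t(1) by (rule less_le_trans[rotated]) simp
  have ln2: "1/2 \<le> ln (2::real)" "ln (2::real) \<le> 1" using ln2_ge_two_thirds ln_le_minus_one[of 2] by auto
  have lp: "ln (1 / 2 ^ n) = - (real n * ln (2::real))" for n by (simp add: ln_div ln_realpow)
  have "ln t \<le> ln (1 / 2 ^ (i + 1))" using t t0 by simp
  also have "\<dots> = - (real (i + 1) * ln 2)" by (rule lp)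
  finally have l1: "real (i + 1) * ln 2 \<le> - ln t" by simp
  have "ln (1 / 2 ^ (i + 2)) \<le> ln t" using t t0 by simp
  moreover have "ln (1 / 2 ^ (i + 2)) = - (real (i + 2) * ln (2::real))" by (rule lp)
  ultimately have l2: "- ln t \<le> real (i + 2) * ln 2" by simp
  have "real (i + 1) * (1/2) \<le> - ln t"
    by (rule order_trans[OF mult_left_mono[OF ln2(1)] l1]) simp
  moreover have "- ln t \<le> real (i + 2) * 1"
    by (rule order_trans[OF l2 mult_left_mono[OF ln2(2)]]) simp
  ultimately have "real (i + 1) * (1/2) \<le> - ln t" "- ln t \<le> real (i + 2)" by simp_all
  then have "1 + \<bar>ln t\<bar> \<le> 3 * real (Suc i)" "real (Suc i) \<le> 3 * (1 + \<bar>ln t\<bar>)" by simp_all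
  then have 1: "3 powr (- \<bar>c\<bar>) * real (Suc i) powr c \<le> (1 + \<bar>ln t\<bar>) powr c"
    by (intro powr_comparable) auto
  have 2: "4 powr (- 1 / p) * 2 powr (- real i / p) \<le> t powr (1 / p)"
  proof -
    have "4 powr (- 1 / p) * 2 powr (- real i / p) = (1 / 2 ^ (i + 2)) powr (1 / p)"
    proof -
      have "(1 / 2 ^ (i + 2) :: real) = 2 powr (- real (i + 2))" 
        using powr_realpow[of 2 "i + 2"] by (simp only: powr_minus inverse_eq_divide)
      moreover have "(4::real) powr (- 1 / p) = 2 powr (- 2 / p)" using powr_powr[of 2 2 "- 1 / p"] by simp
      ultimately show ?thesis by (simp add: powr_powr add_divide_distrib diff_divide_distrib flip: powr_add)
    qed
    also have "\<dots> \<le> t powr (1 / p)" using t(1) p by (intro powr_mono2) auto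
    finally show ?thesis .
  qed
  have "(4 powr (- 1 / p) * 2 powr (- real i / p)) * (3 powr (- \<bar>c\<bar>) * real (Suc i) powr c) \<le> t powr (1 / p) * (1 + \<bar>ln t\<bar>) powr c"
    by (intro mult_mono 1 2) auto
  then show ?thesis by (simp only: mult_ac)
qed

text \<open>
  Keep only the values at the right ends of disjoint dyadic blocks, where the rearrangement is
  smallest. With respect to \<open>dt / t\<close> each block has measure at least \<open>1/2\<close>,
  whence the factor \<open>2\<close>.
\<close>

lemma LZ_integral_lower_bound:
  fixes p c q :: real and r :: "real \<Rightarrow> ennreal"
  assumes p: "0 < p" and q: "0 < q" and r: "antimono r"
  defines "\<kappa> \<equiv> 4 powr (- 1 / p) * 3 powr (- \<bar>c\<bar>)"
  shows "(\<Sum>i\<le>J. epow (ennreal (\<kappa> * (real (Suc i) powr c * 2 powr (- real i / p))) * r (1 / 2 ^ Suc i)) q)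
    \<le> 2 * (\<integral>\<^sup>+t\<in>{0<..<1}. epow (ennreal (t powr (1/p) * (1 + \<bar>ln t\<bar>) powr c) * r t) q * ennreal (1/t) \<partial>lborel)"
proof -
  define e where "e i = epow (ennreal (\<kappa> * (real (Suc i) powr c * 2 powr (- real i / p))) * r (1 / 2 ^ Suc i)) q" for i
  define bl where "bl i = {1 / 2 ^ (i + 2)<..(1 / 2 ^ (i + 1) :: real)}" for i :: nat
  let ?h = "\<lambda>t. epow (ennreal (t powr (1/p) * (1 + \<bar>ln t\<bar>) powr c) * r t) q * ennreal (1/t)"
  have half: "ennreal (2 ^ (i + 1)) * emeasure lborel (bl i) = ennreal (1/2)" for i
  proof -
    have "(1::real) / 2 ^ (i + 2) \<le> 1 / 2 ^ (i + 1)" by (intro divide_left_mono power_increasing) auto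
    then have "emeasure lborel (bl i) = ennreal (1 / 2 ^ (i + 1) - 1 / 2 ^ (i + 2))" by (simp add: bl_def)
    also have "(1 / 2 ^ (i + 1) - 1 / 2 ^ (i + 2) :: real) = 1 / 2 ^ (i + 2)" by (simp add: field_simps)
    finally show ?thesis by (simp flip: ennreal_mult)
  qed
  have pw: "e i * ennreal (2 ^ (i + 1)) \<le> ?h t" if "t \<in> bl i" for i t
  proof -
    have t: "1 / 2 ^ (i + 2) \<le> t" "t \<le> 1 / 2 ^ (i + 1)" and t0: "0 < t"
      using that by (auto simp: bl_def intro: less_trans[rotated])
    have "e i \<le> epow (ennreal (t powr (1/p) * (1 + \<bar>ln t\<bar>) powr c) * r t) q"
      unfolding e_def \<kappa>_def using t(2) q
      by (intro epow_mono mult_mono ennreal_leI LZ_weight_lower_bound p t antimonoD[OF r]) auto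
    moreover have "2 ^ (i + 1) \<le> 1 / t" using t(2) t0 by (simp add: field_simps)
    ultimately show ?thesis by (intro mult_mono ennreal_leI) auto
  qed
  have disj: "i = k" if "t \<in> bl i" "t \<in> bl k" for i k t
  proof -
    have "\<not> i < k" if "t \<in> bl i" "t \<in> bl k" for i k
    proof
      assume "i < k"
      then have "(1::real) / 2 ^ (k + 1) \<le> 1 / 2 ^ (i + 2)" by (intro divide_left_mono power_increasing) auto
      then show False using that by (simp add: bl_def)
    qed
    from this[OF that] this[OF that(2,1)] show ?thesis by simp
  qed
  have "(\<Sum>i\<le>J. e i) * ennreal (1/2) = (\<Sum>i\<le>J. e i * ennreal (2 ^ (i + 1)) * emeasure lborel (bl i))"
    unfolding sum_distrib_right by (intro sum.cong refl) (simp only: mult.assoc half)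
  also have "\<dots> = (\<integral>\<^sup>+t. (\<Sum>i\<le>J. e i * ennreal (2 ^ (i + 1)) * indicator (bl i) t) \<partial>lborel)"
    by (subst nn_integral_sum) (auto simp: bl_def nn_integral_cmult_indicator)
  also have "\<dots> \<le> (\<integral>\<^sup>+t. ?h t * indicator {0<..<1} t \<partial>lborel)"
  proof (intro nn_integral_mono)
    fix t :: real
    show "(\<Sum>i\<le>J. e i * ennreal (2 ^ (i + 1)) * indicator (bl i) t) \<le> ?h t * indicator {0<..<1} t"
    proof (cases "\<exists>i\<le>J. t \<in> bl i")
      case True
      then obtain i where i: "i \<le> J" "t \<in> bl i" by blast
      have "(\<Sum>k\<le>J. e k * ennreal (2 ^ (k + 1)) * indicator (bl k) t) = (\<Sum>k\<le>J. if k = i then e i * ennreal (2 ^ (i + 1)) else 0)"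
      proof (rule sum.cong[OF refl])
        fix k
        show "e k * ennreal (2 ^ (k + 1)) * indicator (bl k) t = (if k = i then e i * ennreal (2 ^ (i + 1)) else 0)"
          using disj[OF _ i(2), of k] i(2) by (cases "t \<in> bl k") auto
      qed
      also have "\<dots> = e i * ennreal (2 ^ (i + 1))" using i(1) by simp
      also have "\<dots> \<le> ?h t" by (rule pw[OF i(2)])
      also have "\<dots> = ?h t * indicator {0<..<1} t"
      proof -
        have "0 < t" using i(2) by (auto simp: bl_def intro: less_trans[rotated])
        moreover have "t < 1"
        proof -
          have "t \<le> 1 / 2 ^ (i + 1)" using i(2) by (simp add: bl_def)
          also have "\<dots> < (1::real)" using one_less_power[of "2::real" "i + 1"] by simp
          finally show ?thesis .
        qed
        ultimately show ?thesis by simp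
      qed
      finally show ?thesis .
    next
      case False
      then have "(\<Sum>i\<le>J. e i * ennreal (2 ^ (i + 1)) * indicator (bl i) t) = 0" by (intro sum.neutral) auto
      then show ?thesis by simp
    qed
  qed
  finally have "(\<Sum>i\<le>J. e i) * ennreal (1/2) \<le> (\<integral>\<^sup>+t. ?h t * indicator {0<..<1} t \<partial>lborel)" .
  then have "2 * ((\<Sum>i\<le>J. e i) * ennreal (1/2)) \<le> 2 * (\<integral>\<^sup>+t. ?h t * indicator {0<..<1} t \<partial>lborel)" by (rule mult_left_mono) simp
  moreover have "2 * ((\<Sum>i\<le>J. e i) * ennreal (1/2)) = (\<Sum>i\<le>J. e i)"
  proof -
    have "ennreal 2 * ennreal (1/2) = 1" by (subst ennreal_mult[symmetric]) simp_all
    then show ?thesis by (metis ennreal_numeral mult.assoc mult.commute mult.left_neutral zero_le_numeral)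
  qed
  ultimately show ?thesis unfolding e_def by simp
qed

lemma lz_seq_weight_upper_bound:
  fixes P c :: real
  assumes P: "1 \<le> P" and k: "2 ^ i \<le> Suc k" "Suc k < 2 ^ Suc i"
  shows "real (Suc k) powr (1 / P) * (1 + ln (real (Suc k))) powr c
    \<le> (2 * 3 powr \<bar>c\<bar>) * (real (Suc i) powr c * 2 powr (real i / P))"
proof -
  have k1: "(2::real) ^ i \<le> real (Suc k)" "real (Suc k) \<le> 2 ^ Suc i"
    using k by (metis of_nat_le_iff of_nat_numeral of_nat_power, metis less_imp_le of_nat_le_iff of_nat_numeral of_nat_power)
  have ln2: "1/2 \<le> ln (2::real)" "ln (2::real) \<le> 1" using ln2_ge_two_thirds ln_le_minus_one[of 2] by auto
  have "ln (2 ^ i) \<le> ln (real (Suc k))" "ln (real (Suc k)) \<le> ln (2 ^ Suc i)" using k1 by (simp_all del: of_nat_Suc)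
  then have l: "real i * ln 2 \<le> ln (real (Suc k))" "ln (real (Suc k)) \<le> real (Suc i) * ln 2" by (simp_all only: ln_realpow zero_less_numeral)
  have "real i * (1/2) \<le> ln (real (Suc k))"
    by (rule order_trans[OF mult_left_mono[OF ln2(1)] l(1)]) simp
  then have lo: "real (Suc i) \<le> 3 * (1 + ln (real (Suc k)))" by simp
  have "ln (real (Suc k)) \<le> real (Suc i) * 1"
    by (rule order_trans[OF l(2) mult_left_mono[OF ln2(2)]]) simp
  then have hi: "1 + ln (real (Suc k)) \<le> 3 * real (Suc i)" by simp
  have 1: "(1 + ln (real (Suc k))) powr c \<le> 3 powr \<bar>c\<bar> * real (Suc i) powr c"
    by (rule powr_comparable(2)[OF _ hi lo]) simp
  have "real (Suc k) powr (1 / P) \<le> (2 * 2 ^ i) powr (1 / P)" using k1 P by (intro powr_mono2) auto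
  also have "\<dots> = 2 powr (1 / P) * 2 powr (real i / P)" by (simp add: powr_mult powr_realpow[symmetric] powr_powr)
  also have "\<dots> \<le> 2 * 2 powr (real i / P)" using powr_mono[of "1 / P" 1 2] P by (intro mult_right_mono) auto
  finally have 2: "real (Suc k) powr (1 / P) \<le> 2 * 2 powr (real i / P)" .
  have "real (Suc k) powr (1 / P) * (1 + ln (real (Suc k))) powr c \<le> (2 * 2 powr (real i / P)) * (3 powr \<bar>c\<bar> * real (Suc i) powr c)"
    by (intro mult_mono 1 2) auto
  then show ?thesis by (simp only: mult_ac)
qed

text \<open>
  On the dyadic block \<open>2\<^sup>i \<le> k < 2\<^sup>i\<^sup>+\<^sup>1\<close> the rearrangement
  is largest at the left end, and the weights \<open>1 / k\<close> sum to at most \<open>1\<close>.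
\<close>

lemma lz_seq_norm_le:
  fixes P c q M :: real and x :: "int ^ 'd::finite \<Rightarrow> 'x::real_normed_vector"
  assumes P: "1 \<le> P" and q: "0 < q" and fin: "\<And>t. rearrangement (count_space UNIV) x t < \<infinity>"
    and M: "\<And>J. (\<Sum>j\<le>J. (real (Suc j) powr c * dyadic_sequence_level P x j) powr q) \<le> M"
  shows "lz_seq_norm P (ennreal q) c x \<le> ennreal (2 * 3 powr \<bar>c\<bar> * M powr (1 / q))"
proof -
  define r where "r k = enn2real (rearrangement (count_space UNIV) x (real k))" for k
  define \<kappa> where "\<kappa> = 2 * 3 powr \<bar>c\<bar>"
  have \<kappa>: "0 < \<kappa>" by (simp add: \<kappa>_def)
  have M0: "0 \<le> M" by (rule order_trans[OF _ M[of 0]]) (simp add: sum_nonneg)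
  have rn: "0 \<le> r k" for k by (simp add: r_def)
  have re: "rearrangement (count_space UNIV) x (real k) = ennreal (r k)" for k
    unfolding r_def using fin[of "real k"] by (simp add: ennreal_enn2real_if less_top)
  have ranti: "r l \<le> r k" if "k \<le> l" for k l
  proof -
    have "ennreal (r l) \<le> ennreal (r k)" unfolding re[symmetric] using that by (intro rearrangement_antimono) simp
    then show ?thesis using rn by (subst (asm) ennreal_le_iff) auto
  qed
  define w where "w k = real (Suc k) powr (1 / P) * (1 + ln (real (Suc k))) powr c" for k
  have w0: "0 \<le> w k" for k by (simp add: w_def)
  define E where "E k = (w k * r k) powr q * (1 / real (Suc k))" for k
  have E0: "0 \<le> E k" for k by (simp add: E_def)
  define F where "F i = real (Suc i) powr c * dyadic_sequence_level P x i" for i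
  have blk: "E k \<le> (\<kappa> * F i) powr q / 2 ^ i" if k: "2 ^ i \<le> Suc k" "Suc k < 2 ^ Suc i" for i k
  proof -
    have "w k * r k \<le> (\<kappa> * (real (Suc i) powr c * 2 powr (real i / P))) * r (2 ^ i - 1)"
      unfolding w_def \<kappa>_def using k rn by (intro mult_mono lz_seq_weight_upper_bound P ranti) auto
    also have "\<dots> = \<kappa> * F i" by (simp add: F_def dyadic_sequence_level_def r_def)
    finally have 1: "(w k * r k) powr q \<le> (\<kappa> * F i) powr q" using w0 rn q by (intro powr_mono2) auto
    have "(2::real) ^ i \<le> real (Suc k)" using k(1) by (metis of_nat_le_iff of_nat_numeral of_nat_power)
    then have 2: "1 / real (Suc k) \<le> 1 / 2 ^ i" by (intro divide_left_mono) auto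
    have "E k \<le> (\<kappa> * F i) powr q * (1 / 2 ^ i)" unfolding E_def by (intro mult_mono 1 2) auto
    then show ?thesis by simp
  qed
  have sumE: "(\<Sum>k<2 ^ n - 1. E k) \<le> (\<Sum>i<n. (\<kappa> * F i) powr q)" for n
  proof (induction n)
    case (Suc n)
    have le: "(2::nat) ^ n - 1 \<le> 2 ^ Suc n - 1" by simp
    have "(\<Sum>k<2 ^ Suc n - 1. E k) = (\<Sum>k<2 ^ n - 1. E k) + (\<Sum>k\<in>{2 ^ n - 1..<2 ^ Suc n - 1}. E k)"
      unfolding lessThan_atLeast0 by (rule sum.atLeastLessThan_concat[symmetric]) (use le in auto)
    also have "(\<Sum>k\<in>{2 ^ n - 1..<2 ^ Suc n - 1}. E k) \<le> (\<Sum>k\<in>{2 ^ n - 1..<2 ^ Suc n - 1 :: nat}. (\<kappa> * F n) powr q / 2 ^ n)"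
    proof (rule sum_mono)
      fix k assume "k \<in> {2 ^ n - 1..<2 ^ Suc n - 1 :: nat}"
      then have "2 ^ n \<le> Suc k" "Suc k < 2 ^ Suc n" unfolding atLeastLessThan_iff by linarith+
      then show "E k \<le> (\<kappa> * F n) powr q / 2 ^ n" by (rule blk)
    qed
    also have "\<dots> = (\<kappa> * F n) powr q"
    proof -
      have "(1::nat) \<le> 2 ^ n" by simp
      then have "card {2 ^ n - 1..<2 ^ Suc n - 1 :: nat} = 2 ^ n" unfolding card_atLeastLessThan power_Suc by linarith
      then show ?thesis unfolding sum_constant by simp
    qed
    finally show ?case using Suc.IH by simp
  qed simp
  have fsum: "(\<Sum>k<n. E k) \<le> \<kappa> powr q * M" for n
  proof -
    have "n \<le> 2 ^ n - 1" using less_exp[of n] by linarith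
    then have "(\<Sum>k<n. E k) \<le> (\<Sum>k<2 ^ n - 1. E k)" using E0 by (intro sum_mono2) auto
    also have "\<dots> \<le> (\<Sum>i<n. (\<kappa> * F i) powr q)" by (rule sumE)
    also have "\<dots> \<le> (\<Sum>i\<le>n. (\<kappa> * F i) powr q)" by (intro sum_mono2) auto
    also have "\<dots> = \<kappa> powr q * (\<Sum>i\<le>n. F i powr q)" by (simp add: powr_mult sum_distrib_left)
    also have "\<dots> \<le> \<kappa> powr q * M" using M[of n] unfolding F_def by (intro mult_left_mono) auto
    finally show ?thesis .
  qed
  have "(\<Sum>j. epow (ennreal (w j) * rearrangement (count_space UNIV) x (real j)) q * ennreal (1 / real (Suc j))) = (\<Sum>j. ennreal (E j))"
  proof (intro suminf_cong)
    fix j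
    have ep: "epow (ennreal (w j) * rearrangement (count_space UNIV) x (real j)) q = ennreal ((w j * r j) powr q)"
      unfolding re using w0 rn by (simp add: epow_ennreal flip: ennreal_mult)
    show "epow (ennreal (w j) * rearrangement (count_space UNIV) x (real j)) q * ennreal (1 / real (Suc j)) = ennreal (E j)"
      unfolding E_def ep by (rule ennreal_mult[symmetric]) simp_all
  qed
  also have "\<dots> \<le> ennreal (\<kappa> powr q * M)"
  proof (subst suminf_eq_SUP, intro SUP_least)
    fix n
    have "(\<Sum>k<n. ennreal (E k)) = ennreal (\<Sum>k<n. E k)" using E0 by (intro sum_ennreal) auto
    also have "\<dots> \<le> ennreal (\<kappa> powr q * M)" by (intro ennreal_leI fsum)
    finally show "(\<Sum>k<n. ennreal (E k)) \<le> ennreal (\<kappa> powr q * M)" .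
  qed
  finally have S: "(\<Sum>j. epow (ennreal (w j) * rearrangement (count_space UNIV) x (real j)) q * ennreal (1 / real (Suc j))) \<le> ennreal (\<kappa> powr q * M)" .
  have "lz_seq_norm P (ennreal q) c x = epow (\<Sum>j. epow (ennreal (w j) * rearrangement (count_space UNIV) x (real j)) q * ennreal (1 / real (Suc j))) (1 / q)"
    using q by (simp add: lz_seq_norm_def Let_def w_def)
  also have "\<dots> \<le> epow (ennreal (\<kappa> powr q * M)) (1 / q)" using S q by (intro epow_mono) auto
  also have "\<dots> = ennreal ((\<kappa> powr q * M) powr (1 / q))" using M0 by (intro epow_ennreal) simp
  also have "(\<kappa> powr q * M) powr (1 / q) = \<kappa> * M powr (1 / q)" using q \<kappa> by (simp add: powr_mult powr_powr)
  finally show ?thesis by (simp add: \<kappa>_def)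
qed

section \<open>Boundedness between Lorentz-Zygmund spaces\<close>

text \<open>
  A finite norm forces the rearrangement to be finite away from \<open>0\<close>, so real numbers
  suffice from here on.
\<close>

lemma weighted_rearrangement_eq:
  assumes \<kappa>: "0 < \<kappa>"
    and le: "ennreal (\<kappa> * (real (Suc i) powr c * 2 powr (- real i / p))) * rearrangement torus f (1 / 2 ^ Suc i) \<le> ennreal y"
  shows "rearrangement torus f (1 / 2 ^ Suc i) < \<infinity>"
    and "ennreal (\<kappa> * (real (Suc i) powr c * 2 powr (- real i / p))) * rearrangement torus f (1 / 2 ^ Suc i)
      = ennreal (\<kappa> * (real (Suc i) powr c * dyadic_function_level p f i))"
proof -
  let ?r = "rearrangement torus f (1 / 2 ^ Suc i)"
  let ?w = "\<kappa> * (real (Suc i) powr c * 2 powr (- real i / p))"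
  have w: "0 < ?w" using \<kappa> by simp
  show fin: "?r < \<infinity>"
  proof (rule ccontr)
    assume "\<not> ?thesis"
    then have "?r = \<infinity>" unfolding infinity_ennreal_def less_top[symmetric] by blast
    then have "ennreal ?w * ?r = \<infinity>" using w \<kappa> by (simp add: ennreal_mult_top del: of_nat_Suc)
    then show False using le by (simp add: top_unique)
  qed
  then have "?r = ennreal (enn2real ?r)" by (simp add: ennreal_enn2real_if less_top)
  then have "ennreal ?w * ?r = ennreal ?w * ennreal (enn2real ?r)" by (rule arg_cong)
  also have "\<dots> = ennreal (?w * enn2real ?r)" by (rule ennreal_mult[symmetric]) (use w in simp_all)
  also have "?w * enn2real ?r = \<kappa> * (real (Suc i) powr c * dyadic_function_level p f i)"
    by (simp only: dyadic_function_level_def mult.assoc)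
  finally show "ennreal ?w * ?r = \<dots>" .
qed

text \<open>
  Both norms are replaced by their dyadic forms, between which
  \<open>limiting_interpolation_sequences\<close> applies to the estimate obtained from the
  decomposition.
\<close>

lemma fourier_coeff_bounded_finite:
  fixes p b q :: real
  assumes ft: "fourier_type TYPE('d::finite) TYPE('x::complex_banach) p" and p: "1 < p"
    and q: "1 \<le> q" and b: "b < - 1 / q"
  shows "\<exists>C\<ge>0. \<forall>f :: real ^ 'd \<Rightarrow> 'x. strongly_measurable torus f \<longrightarrow> LZ_norm p (ennreal q) (b + 1 / min p q) f < \<infinity> \<longrightarrow>
    Bochner_integrable torus f \<and>
    lz_seq_norm (conj_exponent p) (ennreal q) (b + 1 / max (conj_exponent p) q) (fourier_coeff f)
      \<le> ennreal C * LZ_norm p (ennreal q) (b + 1 / min p q) f"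
proof -
  define P where "P = p / (p - 1)"
  define \<theta> where "\<theta> = 2 powr (- 1 / (p / (p - 1)))"
  have P: "1 < P" using p by (simp add: P_def)
  have Pc: "conj_exponent p = P" by (simp add: P_def conj_exponent_def)
  have q0: "0 < q" and p0: "0 < p" using q p by auto
  obtain K where K: "fourier_coeff_Lp_constant TYPE('d) TYPE('x) p K"
    using fourier_coeff_Lp_bound[OF ft p] by blast
  define L where "L = 16 * (1 + K)"
  have L: "0 \<le> L" using K by (simp add: L_def fourier_coeff_Lp_constant_def)
  define c where "c = b + 1 / min p q"
  define c' where "c' = b + 1 / max P q"
  obtain C1 where C1: "C1 \<ge> 0" "\<And>A D M J. (\<And>i. 0 \<le> A i) \<Longrightarrow> (\<And>i. 0 \<le> D i) \<Longrightarrow>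
    (\<And>J. (\<Sum>j\<le>J. (real (Suc j) powr c * A j) powr q) \<le> M) \<Longrightarrow>
    (\<And>j H. (\<And>J. (\<Sum>i=j..J. \<theta> ^ (i - j) * A i) \<le> H) \<Longrightarrow>
       (\<Sum>i\<le>j. D i powr P) powr (1 / P) \<le> L * (H + (\<Sum>i\<le>j. A i powr p) powr (1 / p))) \<Longrightarrow>
    (\<Sum>j\<le>J. (real (Suc j) powr c' * D j) powr q) \<le> C1 * M"
    using limiting_interpolation_sequences[OF p q b L] unfolding P_def c_def c'_def \<theta>_def by blast
  define \<kappa> where "\<kappa> = 4 powr (- 1 / p) * 3 powr (- \<bar>c\<bar>)"
  have \<kappa>: "0 < \<kappa>" by (simp add: \<kappa>_def)
  define C where "C = 2 * 3 powr \<bar>c'\<bar> * ((C1 * 2) powr (1 / q) / \<kappa>)"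
  have C: "0 \<le> C" using \<kappa> by (simp add: C_def)
  have "Bochner_integrable torus f \<and> lz_seq_norm P (ennreal q) c' (fourier_coeff f) \<le> ennreal C * LZ_norm p (ennreal q) c f"
    if f: "strongly_measurable torus f" and X: "LZ_norm p (ennreal q) c f < \<infinity>" for f :: "real ^ 'd \<Rightarrow> 'x"
  proof -
    let ?A = "dyadic_function_level p f" and ?D = "dyadic_sequence_level P (fourier_coeff f)"
    let ?X = "\<lambda>i. ennreal (\<kappa> * (real (Suc i) powr c * 2 powr (- real i / p))) * rearrangement torus f (1 / 2 ^ Suc i)"
    define Y where "Y = (\<integral>\<^sup>+t\<in>{0<..<1}. epow (ennreal (t powr (1/p) * (1 + \<bar>ln t\<bar>) powr c) * rearrangement torus f t) q * ennreal (1/t) \<partial>lborel)"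
    have LZ: "LZ_norm p (ennreal q) c f = epow Y (1 / q)" using q0 by (simp add: LZ_norm_def Let_def Y_def)
    have "Y \<noteq> \<infinity>" using X by (auto simp: LZ epow_def)
    then obtain y where y: "Y = ennreal y" "0 \<le> y" by (cases Y) auto
    have LZy: "LZ_norm p (ennreal q) c f = ennreal (y powr (1 / q))" unfolding LZ y(1) using y(2) by (rule epow_ennreal)
    have Y2: "2 * Y = ennreal (2 * y)" unfolding y(1) using y(2) by (simp add: ennreal_mult)
    have lower: "(\<Sum>i\<le>J. epow (?X i) q) \<le> ennreal (2 * y)" for J
      unfolding Y2[symmetric] Y_def \<kappa>_def by (rule LZ_integral_lower_bound[OF p0 q0 antimonoI[OF rearrangement_antimono]])
    have X_le: "?X i \<le> ennreal ((2 * y) powr (1 / q))" for i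
    proof -
      have "epow (?X i) q \<le> ennreal (2 * y)" by (rule order_trans[OF member_le_sum lower[of i]]) auto
      then show ?thesis using q0 y(2) by (subst (asm) epow_le_iff) auto
    qed
    note fin = weighted_rearrangement_eq(1)[OF \<kappa> X_le] and X_eq = weighted_rearrangement_eq(2)[OF \<kappa> X_le]
    define M where "M = 2 * y / \<kappa> powr q"
    have AM: "(\<Sum>i\<le>J. (real (Suc i) powr c * ?A i) powr q) \<le> M" for J
    proof -
      have "epow (?X i) q = ennreal (\<kappa> powr q * (real (Suc i) powr c * ?A i) powr q)" for i
        unfolding X_eq using \<kappa> dyadic_level_nonneg(1)[of p f i] by (subst epow_ennreal) (simp, simp only: powr_mult)
      then have "(\<Sum>i\<le>J. ennreal (\<kappa> powr q * (real (Suc i) powr c * ?A i) powr q)) \<le> ennreal (2 * y)"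
        using lower[of J] by simp
      then have "ennreal (\<Sum>i\<le>J. \<kappa> powr q * (real (Suc i) powr c * ?A i) powr q) \<le> ennreal (2 * y)"
        by (subst (asm) sum_ennreal) simp_all
      then have "\<kappa> powr q * (\<Sum>i\<le>J. (real (Suc i) powr c * ?A i) powr q) \<le> 2 * y"
        using y(2) by (subst (asm) ennreal_le_iff) (simp_all add: sum_distrib_left)
      then show ?thesis using \<kappa> by (simp add: M_def field_simps)
    qed
    have Ai: "real (Suc i) powr c * ?A i \<le> M powr (1 / q)" for i
    proof -
      have "(real (Suc i) powr c * ?A i) powr q \<le> M" by (rule order_trans[OF member_le_sum AM[of i]]) auto
      then have "((real (Suc i) powr c * ?A i) powr q) powr (1 / q) \<le> M powr (1 / q)" using q0 by (intro powr_mono2) auto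
      then show ?thesis using q0 dyadic_level_nonneg(1)[of p f i] by (simp add: powr_powr)
    qed
    note est = fourier_coeff_dyadic_estimate[OF p K f fin Ai, folded P_def L_def \<theta>_def]
    have DM: "(\<Sum>j\<le>J. (real (Suc j) powr c' * ?D j) powr q) \<le> C1 * M" for J
      by (rule C1(2)[OF dyadic_level_nonneg(1) dyadic_level_nonneg(2) AM]) (rule est(3))
    have "lz_seq_norm P (ennreal q) c' (fourier_coeff f) \<le> ennreal (2 * 3 powr \<bar>c'\<bar> * (C1 * M) powr (1 / q))"
      by (rule lz_seq_norm_le[OF less_imp_le[OF P] q0 est(2) DM])
    also have "2 * 3 powr \<bar>c'\<bar> * (C1 * M) powr (1 / q) = C * y powr (1 / q)"
    proof -
      have "C1 * M = (C1 * 2) * y * (1 / \<kappa> powr q)" by (simp add: M_def)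
      then have "(C1 * M) powr (1 / q) = (C1 * 2) powr (1 / q) * y powr (1 / q) * (1 / \<kappa> powr q) powr (1 / q)"
        by (simp only: powr_mult)
      also have "(1 / \<kappa> powr q) powr (1 / q) = 1 / \<kappa>" using \<kappa> q0 by (simp add: powr_divide powr_powr)
      finally show ?thesis by (simp add: C_def)
    qed
    also have "ennreal (C * y powr (1 / q)) = ennreal C * LZ_norm p (ennreal q) c f"
      unfolding LZy using C by (simp add: ennreal_mult)
    finally show ?thesis using est(1) by blast
  qed
  then show ?thesis unfolding Pc c_def c'_def using C by blast
qed

text \<open>
  The same argument with suprema. Here \<open>1 / min p q\<close> is \<open>1 / p\<close> and \<open>1
  / max p' q\<close> is \<open>0\<close>.
\<close>

lemma fourier_coeff_bounded_sup:
  fixes p b :: real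
  assumes ft: "fourier_type TYPE('d::finite) TYPE('x::complex_banach) p" and p: "1 < p" and b: "b < 0"
  shows "\<exists>C\<ge>0. \<forall>f :: real ^ 'd \<Rightarrow> 'x. strongly_measurable torus f \<longrightarrow> LZ_norm p \<infinity> (b + 1 / p) f < \<infinity> \<longrightarrow>
    Bochner_integrable torus f \<and>
    lz_seq_norm (conj_exponent p) \<infinity> b (fourier_coeff f) \<le> ennreal C * LZ_norm p \<infinity> (b + 1 / p) f"
proof -
  define P where "P = p / (p - 1)"
  define \<theta> where "\<theta> = 2 powr (- 1 / (p / (p - 1)))"
  have P: "1 < P" using p by (simp add: P_def)
  have Pc: "conj_exponent p = P" by (simp add: P_def conj_exponent_def)
  have p0: "0 < p" using p by auto
  obtain K where K: "fourier_coeff_Lp_constant TYPE('d) TYPE('x) p K"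
    using fourier_coeff_Lp_bound[OF ft p] by blast
  define L where "L = 16 * (1 + K)"
  have L: "0 \<le> L" using K by (simp add: L_def fourier_coeff_Lp_constant_def)
  define c where "c = b + 1 / p"
  obtain C1 where C1: "C1 \<ge> 0" "\<And>A D M j. (\<And>i. 0 \<le> A i) \<Longrightarrow> (\<And>i. 0 \<le> D i) \<Longrightarrow>
    (\<And>j. real (Suc j) powr c * A j \<le> M) \<Longrightarrow>
    (\<And>j H. (\<And>J. (\<Sum>i=j..J. \<theta> ^ (i - j) * A i) \<le> H) \<Longrightarrow>
       (\<Sum>i\<le>j. D i powr P) powr (1 / P) \<le> L * (H + (\<Sum>i\<le>j. A i powr p) powr (1 / p))) \<Longrightarrow>
    real (Suc j) powr b * D j \<le> C1 * M"
    using limiting_interpolation_sequences_sup[OF p b L] unfolding P_def c_def \<theta>_def by blast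
  define \<kappa> where "\<kappa> = 4 powr (- 1 / p) * 3 powr (- \<bar>c\<bar>)"
  have \<kappa>: "0 < \<kappa>" by (simp add: \<kappa>_def)
  define C where "C = 2 * 3 powr \<bar>b\<bar> * (C1 / \<kappa>)"
  have C: "0 \<le> C" using \<kappa> C1(1) by (simp add: C_def)
  have "Bochner_integrable torus f \<and> lz_seq_norm P \<infinity> b (fourier_coeff f) \<le> ennreal C * LZ_norm p \<infinity> c f"
    if f: "strongly_measurable torus f" and X: "LZ_norm p \<infinity> c f < \<infinity>" for f :: "real ^ 'd \<Rightarrow> 'x"
  proof -
    let ?A = "dyadic_function_level p f" and ?D = "dyadic_sequence_level P (fourier_coeff f)"
    have LZ: "LZ_norm p \<infinity> c f = (SUP t\<in>{0<..<1}. ennreal (t powr (1/p) * (1 + \<bar>ln t\<bar>) powr c) * rearrangement torus f t)"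
      by (simp add: LZ_norm_def Let_def)
    obtain y where y: "LZ_norm p \<infinity> c f = ennreal y" "0 \<le> y" using X by (cases "LZ_norm p \<infinity> c f") auto
    have lower: "ennreal (\<kappa> * (real (Suc i) powr c * 2 powr (- real i / p))) * rearrangement torus f (1 / 2 ^ Suc i) \<le> ennreal y" for i
    proof -
      let ?t = "1 / 2 ^ Suc i :: real"
      have t1: "1 / 2 ^ (i + 2) \<le> ?t" by (intro divide_left_mono power_increasing) auto
      have t01: "?t \<in> {0<..<1}" using one_less_power[of "2::real" "Suc i"] by simp
      have "\<kappa> * (real (Suc i) powr c * 2 powr (- real i / p)) \<le> ?t powr (1/p) * (1 + \<bar>ln ?t\<bar>) powr c"
        unfolding \<kappa>_def by (rule LZ_weight_lower_bound[OF p0 t1]) simp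
      then have "ennreal (\<kappa> * (real (Suc i) powr c * 2 powr (- real i / p))) * rearrangement torus f ?t
          \<le> ennreal (?t powr (1/p) * (1 + \<bar>ln ?t\<bar>) powr c) * rearrangement torus f ?t"
        by (intro mult_right_mono ennreal_leI) auto
      also have "\<dots> \<le> ennreal y" unfolding y(1)[symmetric] LZ by (rule SUP_upper[OF t01])
      finally show ?thesis .
    qed
    define M where "M = y / \<kappa>"
    have AM: "real (Suc i) powr c * ?A i \<le> M" for i
    proof -
      have "\<kappa> * (real (Suc i) powr c * ?A i) \<le> y"
        using lower[of i] y(2) unfolding weighted_rearrangement_eq(2)[OF \<kappa> lower] by (subst (asm) ennreal_le_iff) auto
      then show ?thesis using \<kappa> by (simp only: M_def pos_le_divide_eq mult.commute)
    qed
    note est = fourier_coeff_dyadic_estimate[OF p K f weighted_rearrangement_eq(1)[OF \<kappa> lower] AM, folded P_def L_def \<theta>_def]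
    have DM: "real (Suc j) powr b * ?D j \<le> C1 * M" for j
      by (rule C1(2)[OF dyadic_level_nonneg(1) dyadic_level_nonneg(2) AM]) (rule est(3))
    have "lz_seq_norm P \<infinity> b (fourier_coeff f) \<le> ennreal (2 * 3 powr \<bar>b\<bar> * (C1 * M))"
      unfolding lz_seq_norm_def Let_def if_P[OF refl]
    proof (rule SUP_least)
      fix k :: nat
      let ?r = "rearrangement (count_space UNIV) (fourier_coeff f)"
      let ?w = "real (Suc k) powr (1/P) * (1 + ln (real (Suc k))) powr b"
      have re: "?r t = ennreal (enn2real (?r t))" for t using est(2)[of t] by (simp add: ennreal_enn2real_if less_top)
      obtain i where i: "2 ^ i \<le> Suc k" "Suc k < 2 ^ Suc i" using ex_power_ivl1[of 2 "Suc k"] by auto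
      have "real (2 ^ i - 1) \<le> real k" using i(1) by linarith
      then have "ennreal (enn2real (?r (real k))) \<le> ennreal (enn2real (?r (real (2 ^ i - 1))))"
        unfolding re[symmetric] by (rule rearrangement_antimono)
      then have "enn2real (?r (real k)) \<le> enn2real (?r (real (2 ^ i - 1)))" by (subst (asm) ennreal_le_iff) auto
      then have "?w * enn2real (?r (real k))
          \<le> (2 * 3 powr \<bar>b\<bar>) * (real (Suc i) powr b * 2 powr (real i / P)) * enn2real (?r (real (2 ^ i - 1)))"
        using i P by (intro mult_mono lz_seq_weight_upper_bound) auto
      also have "\<dots> = (2 * 3 powr \<bar>b\<bar>) * (real (Suc i) powr b * ?D i)" by (simp only: dyadic_sequence_level_def mult.assoc)
      also have "\<dots> \<le> (2 * 3 powr \<bar>b\<bar>) * (C1 * M)" by (intro mult_left_mono DM) simp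
      finally have "ennreal (?w * enn2real (?r (real k))) \<le> ennreal (2 * 3 powr \<bar>b\<bar> * (C1 * M))"
        by (rule ennreal_leI)
      moreover have "ennreal ?w * ?r (real k) = ennreal (?w * enn2real (?r (real k)))"
        by (subst re, rule ennreal_mult[symmetric]) auto
      ultimately show "ennreal ?w * ?r (real k) \<le> ennreal (2 * 3 powr \<bar>b\<bar> * (C1 * M))" by (simp only:)
    qed
    also have "2 * 3 powr \<bar>b\<bar> * (C1 * M) = C * y" by (simp add: C_def M_def)
    also have "ennreal (C * y) = ennreal C * LZ_norm p \<infinity> c f" unfolding y(1) using C y(2) by (rule ennreal_mult)
    finally show ?thesis using est(1) by blast
  qed
  then show ?thesis unfolding Pc c_def using C by blast
qed

theorem theorem7p5:
  fixes p0 b :: real and q :: ennreal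
  assumes "\<exists>x::'x::complex_banach. x \<noteq> 0"
    and "1 < p0" and "p0 \<le> 2"
    and "fourier_type TYPE('d::finite) TYPE('x) p0"
    and "1 \<le> q"
    and "b < - enn2real (1 / q)"
  shows "\<exists>C::real. C \<ge> 0 \<and>
    (\<forall>f \<in> (LZ_space p0 q (b + enn2real (1 / min (ennreal p0) q)) :: (real ^ 'd \<Rightarrow> 'x) set).
       Bochner_integrable torus f \<and>
       fourier_coeff f \<in>
         lz_seq_space (conj_exponent p0) q (b + enn2real (1 / max (ennreal (conj_exponent p0)) q)) \<and>
       lz_seq_norm (conj_exponent p0) q (b + enn2real (1 / max (ennreal (conj_exponent p0)) q))
           (fourier_coeff f)
         \<le> ennreal C * LZ_norm p0 q (b + enn2real (1 / min (ennreal p0) q)) f)"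
proof -
  have P: "1 < conj_exponent p0" using assms(2) by (simp add: conj_exponent_def)
  have inv: "enn2real (1 / ennreal r) = 1 / r" if "0 < r" for r
    using that by (simp add: divide_ennreal flip: ennreal_1)
  define c where "c = b + enn2real (1 / min (ennreal p0) q)"
  define c' where "c' = b + enn2real (1 / max (ennreal (conj_exponent p0)) q)"
  have "\<exists>C\<ge>0. \<forall>f :: real ^ 'd \<Rightarrow> 'x. strongly_measurable torus f \<longrightarrow> LZ_norm p0 q c f < \<infinity> \<longrightarrow>
    Bochner_integrable torus f \<and> lz_seq_norm (conj_exponent p0) q c' (fourier_coeff f) \<le> ennreal C * LZ_norm p0 q c f"
  proof (cases q)
    case (real r)
    have r: "1 \<le> r"
    proof -
      have "ennreal 1 \<le> ennreal r" using assms(5) real(2) by simp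
      then show ?thesis using real(1) by (subst (asm) ennreal_le_iff) auto
    qed
    have "min (ennreal p0) q = ennreal (min p0 r)" "max (ennreal (conj_exponent p0)) q = ennreal (max (conj_exponent p0) r)"
      using assms(2) P r unfolding real(2) by (simp_all add: min_def max_def ennreal_le_iff)
    then have "c = b + 1 / min p0 r" "c' = b + 1 / max (conj_exponent p0) r"
      using inv[of "min p0 r"] inv[of "max (conj_exponent p0) r"] assms(2) r by (simp_all add: c_def c'_def)
    moreover have "b < - 1 / r" using assms(6) inv[of r] r real(2) by simp
    ultimately show ?thesis
      using fourier_coeff_bounded_finite[OF assms(4,2) r] real(2) by simp
  next
    case top
    have "c = b + 1 / p0" "c' = b"
      using inv[of p0] assms(2) by (simp_all add: c_def c'_def top min_def max_def top_unique)
    moreover have "b < 0" using assms(6) top by simp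
    ultimately show ?thesis using fourier_coeff_bounded_sup[OF assms(4,2)] top by simp
  qed
  then obtain C where C: "0 \<le> C" "\<And>f :: real ^ 'd \<Rightarrow> 'x. strongly_measurable torus f \<Longrightarrow> LZ_norm p0 q c f < \<infinity> \<Longrightarrow>
    Bochner_integrable torus f \<and> lz_seq_norm (conj_exponent p0) q c' (fourier_coeff f) \<le> ennreal C * LZ_norm p0 q c f"
    by blast
  have "Bochner_integrable torus f \<and> fourier_coeff f \<in> lz_seq_space (conj_exponent p0) q c' \<and>
      lz_seq_norm (conj_exponent p0) q c' (fourier_coeff f) \<le> ennreal C * LZ_norm p0 q c f"
    if f: "f \<in> LZ_space p0 q c" for f :: "real ^ 'd \<Rightarrow> 'x"
  proof -
    have f': "strongly_measurable torus f" "LZ_norm p0 q c f < \<infinity>" using f by (auto simp: LZ_space_def)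
    have "ennreal C * LZ_norm p0 q c f < \<infinity>" using f'(2) by (simp add: ennreal_mult_less_top)
    then show ?thesis using C(2)[OF f'] by (auto simp: lz_seq_space_def intro: le_less_trans)
  qed
  then show ?thesis using C(1) unfolding c_def c'_def by blast
qed

end
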